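(* Let $d\ge1$ and $\alpha=sd-r$ with integers $s\ge1$, $0\le r<d$. Let $\Delta\subset\mathbb{P}_n$ be the residual of a complete intersection of type $(1,r)$ in a complete intersection of type $(d,s)$. Let $Y\subset\mathbb{P}_n$ be an arithmetically Cohen-Macaulay subscheme of codimension two and degree $\alpha$ contained in an irreducible hypersurface $X$ of degree $d$. Then $\phi_Y(i)\ge\phi_\Delta(i)$ for all $i$. Moreover, $\phi_Y(i)=\phi_\Delta(i)$ for all $i$ if and only if $Y$ is, like $\Delta$, the residual, in a complete intersection of type $(d,s)$, of a degenerate (i.e. contained in a hyperplane) subscheme of codimension two and degree $r$.
   Context: $k$ is an algebraically closed field of characteristic $0$, $A_n=k[X_0,\dots,X_n]$. A projective subscheme $X\subset\mathbb{P}_n$ is given by its saturated homogeneous ideal $I_X$; $A_X=A_n/I_X$ and $\phi_X(l)=\dim_k A_X(l)$ is the Hilbert function. "Irreducible" hypersurface means that $I_X$ is prime. $X$ of dimension $m$ is arithmetically Cohen-Macaulay (ACM) if $A_X$ admits a regular sequence of $m+1$ homogeneous polynomials. A complete intersection of type $(a,b)$ is the codimension-two subscheme defined by two forms of degrees $a,b$ without common factor; for $r=0$ the complete intersection $(1,r)$ (subscheme of degree $0$) is empty. Linkage: two subschemes $V,V'\subset Z$ with $I_VI_{V'}\subset I_Z$ are linked in $Z$, and each is the residual of the other in $Z$, if the multiplication map $I_{V'}\to\operatorname{Hom}_{A_n}(I_V,I_Z)$ is an isomorphism, and likewise with $V,V'$ exchanged (for codimension-two subschemes this says $I_{V'}=(I_Z:I_V)$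 and $I_V=(I_Z:I_{V'})$). *)

theory Defs
  imports
    "HOL-Library.Poly_Mapping"
    "HOL-Library.FuncSet"
    "HOL-Library.Cardinality"
    "HOL-Computational_Algebra.Polynomial"
begin

text \<open>
  The coordinate ring \<open>A\<^sub>n\<close> of \<open>P\<^sub>n\<close> is the polynomial ring \<open>('v, 'k) mpoly\<close> with variables
  indexed by a finite type \<open>'v\<close>, where \<open>CARD('v) = n + 1\<close>. A monomial is its exponent
  vector \<open>'v \<Rightarrow>\<^sub>0 nat\<close>.
\<close>

type_synonym ('v, 'k) mpoly = "('v \<Rightarrow>\<^sub>0 nat) \<Rightarrow>\<^sub>0 'k"

definition mpoly_var :: "'v \<Rightarrow> ('v, 'k::comm_ring_1) mpoly"
  where "mpoly_var i = Poly_Mapping.single (Poly_Mapping.single i 1) 1"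

definition mpoly_scale :: "'k::comm_ring_1 \<Rightarrow> ('v, 'k) mpoly \<Rightarrow> ('v, 'k) mpoly"
  where "mpoly_scale c p = Poly_Mapping.single 0 c * p"

lemma vector_space_mpoly_scale:
  "vector_space (mpoly_scale :: 'k::field \<Rightarrow> ('v, 'k) mpoly \<Rightarrow> _)"
  by unfold_locales
    (simp_all add: mpoly_scale_def algebra_simps single_add mult_single flip: mult.assoc)

definition monom_deg :: "('v::finite \<Rightarrow>\<^sub>0 nat) \<Rightarrow> nat"
  where "monom_deg m = (\<Sum>i\<in>UNIV. Poly_Mapping.lookup m i)"

text \<open>Homogeneous polynomials of degree \<open>l\<close>, including \<open>0\<close>.\<close>

definition forms :: "nat \<Rightarrow> ('v::finite, 'k::comm_ring_1) mpoly set"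
  where "forms l = {p. \<forall>m\<in>Poly_Mapping.keys p. monom_deg m = l}"


subsection \<open>Ideals and projective subschemes\<close>

lemma module_times: "module ((*) :: 'a::comm_ring_1 \<Rightarrow> 'a \<Rightarrow> 'a)"
  by unfold_locales (simp_all add: algebra_simps)

definition ideal_gen :: "'a::comm_ring_1 set \<Rightarrow> 'a set"
  where "ideal_gen S = module.span (*) S"

definition is_ideal :: "'a::comm_ring_1 set \<Rightarrow> bool"
  where "is_ideal I \<longleftrightarrow> module.subspace (*) I"

definition prime_ideal :: "'a::comm_ring_1 set \<Rightarrow> bool"
  where "prime_ideal I \<longleftrightarrow> is_ideal I \<and> I \<noteq> UNIV \<and> (\<forall>a b. a * b \<in> I \<longrightarrow> a \<in> I \<or> b \<in> I)"

definition homogeneous_ideal :: "('v::finite, 'k::comm_ring_1) mpoly set \<Rightarrow> bool"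
  where "homogeneous_ideal I \<longleftrightarrow> (\<exists>S \<subseteq> (\<Union>l. forms l). I = ideal_gen S)"

definition saturated_ideal :: "('v::finite, 'k::comm_ring_1) mpoly set \<Rightarrow> bool"
  where "saturated_ideal I \<longleftrightarrow> (\<forall>f. (\<forall>i. \<exists>N. mpoly_var i ^ N * f \<in> I) \<longrightarrow> f \<in> I)"

text \<open>
  A projective subscheme is represented by its saturated homogeneous ideal, so inclusion of
  subschemes is reverse inclusion of ideals, and \<open>UNIV\<close> is the empty subscheme.
\<close>

definition proj_subscheme :: "('v::finite, 'k::comm_ring_1) mpoly set \<Rightarrow> bool"
  where "proj_subscheme I \<longleftrightarrow> homogeneous_ideal I \<and> saturated_ideal I"


subsection \<open>Hilbert function, dimension, degree\<close>

text \<open>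
  The degree \<open>l\<close> part of \<open>A / I\<close> is the quotient of the finite-dimensional space \<open>forms l\<close> by
  its subspace \<open>forms l \<inter> I\<close>; the subtraction below does not truncate.
\<close>

definition hilbert_fun :: "('v::finite, 'k::field) mpoly set \<Rightarrow> nat \<Rightarrow> nat"
  where "hilbert_fun I l =
    vector_space.dim mpoly_scale (forms l :: ('v, 'k) mpoly set) -
    vector_space.dim mpoly_scale (forms l \<inter> I)"

definition is_hilbert_poly :: "('v::finite, 'k::field) mpoly set \<Rightarrow> rat poly \<Rightarrow> bool"
  where "is_hilbert_poly I P \<longleftrightarrow>
    (\<forall>\<^sub>F l in sequentially. of_nat (hilbert_fun I l) = poly P (of_nat l))"

text \<open>
  A nonempty subscheme has dimension \<open>m\<close> and degree \<open>e\<close> if its Hilbert polynomial has leading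
  term \<open>(e / m!) t\<^sup>m\<close>. The empty subscheme has Hilbert polynomial \<open>0\<close> and no dimension here.
\<close>

definition has_dim :: "('v::finite, 'k::field) mpoly set \<Rightarrow> nat \<Rightarrow> bool"
  where "has_dim I m \<longleftrightarrow> (\<exists>P. is_hilbert_poly I P \<and> P \<noteq> 0 \<and> degree P = m)"

definition has_dim_degree :: "('v::finite, 'k::field) mpoly set \<Rightarrow> nat \<Rightarrow> nat \<Rightarrow> bool"
  where "has_dim_degree I m e \<longleftrightarrow>
    (\<exists>P. is_hilbert_poly I P \<and> P \<noteq> 0 \<and> degree P = m \<and> fact m * lead_coeff P = of_nat e)"

text \<open>
  With \<open>CARD('v) = n + 1\<close>, the equation \<open>m + 3 = CARD('v)\<close> says \<open>m = n - 2\<close> and \<open>n \<ge> 2\<close>.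
  By convention the subscheme of codimension two and degree \<open>0\<close> is the empty one.
\<close>

definition codim_two_degree :: "('v::finite, 'k::field) mpoly set \<Rightarrow> nat \<Rightarrow> bool"
  where "codim_two_degree I e \<longleftrightarrow>
    (if e = 0 then I = UNIV else (\<exists>m. m + 3 = CARD('v) \<and> has_dim_degree I m e))"

definition degenerate :: "('v::finite, 'k::field) mpoly set \<Rightarrow> bool"
  where "degenerate I \<longleftrightarrow> (\<exists>h\<in>I. h \<noteq> 0 \<and> h \<in> forms 1)"


subsection \<open>Arithmetically Cohen-Macaulay subschemes\<close>

text \<open>\<open>fs\<close> is a regular sequence on \<open>A / I\<close>.\<close>

definition regular_sequence :: "'a::comm_ring_1 set \<Rightarrow> 'a list \<Rightarrow> bool"
  where "regular_sequence I fs \<longleftrightarrow>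
    (\<forall>i<length fs. \<forall>g. fs ! i * g \<in> ideal_gen (I \<union> set (take i fs)) \<longrightarrow>
        g \<in> ideal_gen (I \<union> set (take i fs))) \<and>
    ideal_gen (I \<union> set fs) \<noteq> UNIV"

definition ACM :: "('v::finite, 'k::field) mpoly set \<Rightarrow> bool"
  where "ACM I \<longleftrightarrow> proj_subscheme I \<and>
    (\<exists>m fs. has_dim I m \<and> length fs = m + 1 \<and> set fs \<subseteq> (\<Union>l. forms l) \<and>
       regular_sequence I fs)"


subsection \<open>Hypersurfaces, complete intersections, linkage\<close>

definition irreducible_hypersurface :: "nat \<Rightarrow> ('v::finite, 'k::field) mpoly set \<Rightarrow> bool"
  where "irreducible_hypersurface d I \<longleftrightarrow>
    (\<exists>F\<in>forms d. F \<noteq> 0 \<and> I = ideal_gen {F}) \<and> prime_ideal I"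

text \<open>For \<open>b = 0\<close> the form \<open>g\<close> is a nonzero constant and the complete intersection is empty.\<close>

definition complete_intersection :: "nat \<Rightarrow> nat \<Rightarrow> ('v::finite, 'k::field) mpoly set \<Rightarrow> bool"
  where "complete_intersection a b I \<longleftrightarrow>
    (\<exists>f\<in>forms a. \<exists>g\<in>forms b. f \<noteq> 0 \<and> g \<noteq> 0 \<and>
       (\<forall>h. h dvd f \<longrightarrow> h dvd g \<longrightarrow> h dvd 1) \<and> I = ideal_gen {f, g})"

text \<open>The \<open>A\<close>-module \<open>Hom\<^sub>A(I, J)\<close> for ideals \<open>I\<close> and \<open>J\<close> of \<open>A\<close>.\<close>

definition ideal_hom :: "'a::comm_ring_1 set \<Rightarrow> 'a set \<Rightarrow> ('a \<Rightarrow> 'a) set"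
  where "ideal_hom I J = {u \<in> I \<rightarrow>\<^sub>E J.
    (\<forall>x\<in>I. \<forall>y\<in>I. u (x + y) = u x + u y) \<and> (\<forall>a. \<forall>x\<in>I. u (a * x) = a * u x)}"

text \<open>
  \<open>V\<close> and \<open>V'\<close> are linked in \<open>Z\<close>, that is, each is the residual of the other in \<open>Z\<close>.
  The multiplication maps are always additive and linear, so being isomorphisms means being bijective.
\<close>

definition linked :: "('v::finite, 'k::field) mpoly set \<Rightarrow> ('v, 'k) mpoly set \<Rightarrow>
    ('v, 'k) mpoly set \<Rightarrow> bool"
  where "linked Z V V' \<longleftrightarrow>
    proj_subscheme Z \<and> proj_subscheme V \<and> proj_subscheme V' \<and> Z \<subseteq> V \<and> Z \<subseteq> V' \<and>
    (\<forall>f\<in>V. \<forall>g\<in>V'. f * g \<in> Z) \<and>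
    bij_betw (\<lambda>g. \<lambda>f\<in>V. g * f) V' (ideal_hom V Z) \<and>
    bij_betw (\<lambda>f. \<lambda>g\<in>V'. f * g) V (ideal_hom V' Z)"

end

theory Submission
  imports Defs
    "HOL-Computational_Algebra.Formal_Power_Series"
    "HOL-Computational_Algebra.Primes"
begin

text \<open>
  Cut the \<open>(n - 2)\<close>-dimensional schemes by \<open>n - 1\<close> generic linear forms. By the
  Cohen-Macaulay property the Hilbert series are multiplied by \<open>(1 - t)\<^sup>n\<^sup>-\<^sup>1\<close>, and everything
  happens in a polynomial ring \<open>B\<close> in two variables. Let \<open>h\<close> be the Hilbert function of
  the section of \<open>Y\<close>. The ideal of \<open>Y\<close> contains \<open>F\<close> and a form \<open>G\<close> outside \<open>(F)\<close> of minimal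
  degree \<open>e\<close>; as \<open>F\<close> is irreducible, \<open>F, G\<close> is a regular sequence, so \<open>deg Y \<le> d e\<close> and \<open>s \<le> e\<close>.
  Below degree \<open>e\<close> the function \<open>h\<close> is that of \<open>B / F\<close>, from degree \<open>e\<close> on it does not increase,
  and from degree \<open>max d e\<close> on it decreases strictly until it vanishes: otherwise every linear form
  would act bijectively between two consecutive degrees, which is impossible over an algebraically
  closed field. Hence \<open>h\<close> minus the Hilbert function of the section of \<open>\<Delta>\<close> changes sign at most
  once, and both have the same sum \<open>\<alpha>\<close>, which gives the inequality.

  In the case of equality \<open>e = s\<close>. For \<open>Z = (F, G)\<close> the quotient of the sections of the ideals of
  \<open>Y\<close> and \<open>Z\<close> has dimension one in the degrees \<open>d + s - 1 - r, \<dots>, d + s - 2\<close>, and the position of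
  the socle of \<open>B / (F, G)\<close> makes it cyclic; so \<open>Y = Z + (D)\<close>, and \<open>Z : D\<close> is recognized as a complete
  intersection of type \<open>(1, r)\<close> from its Hilbert series. Conversely, if a linear form kills
  \<open>Y / Z\<close>, then its section is a submodule of a uniserial module and the Hilbert series is determined
  by its length \<open>r\<close>.
\<close>


section \<open>Ideals\<close>

text \<open>The sections never leave the given ring: B is A modulo the ideal K of m + 1 = n - 1
  linear forms, and its ideals are the ideals of A that contain K. The same forms must be regular on
  Y, on Z and on principal ideals at once, while depth is known only through some regular sequence
  of forms of unspecified degrees. Hence the need for finitely many associated primes, prime
  avoidance over an infinite field and the exchange of a form in a regular sequence for a generic
  linear one. Coprime forms are regular because polynomial rings are factorial, which is Gauss's
  lemma. The inequality cannot hold for the plane sections themselves unless they agree, since their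
  sums agree; one sign change orders only the partial sums. These are the series after m cuts, which
  explains the two exponents m and m + 1, and m further summations lead back to Y. Since 1 - t can
  be cancelled, the series of a section determines that of the ideal, and nested homogeneous ideals
  with equal series are equal. Graded Nakayama carries equality of sections back to the
  ideals.\<close>

definition adjoin :: "'a::comm_ring_1 set \<Rightarrow> 'a \<Rightarrow> 'a set"
  where "adjoin I f = {x. \<exists>a. x - a * f \<in> I}"

definition colon :: "'a::comm_ring_1 set \<Rightarrow> 'a \<Rightarrow> 'a set"
  where "colon I f = {x. f * x \<in> I}"

definition nzd :: "'a::comm_ring_1 set \<Rightarrow> 'a \<Rightarrow> bool"
  where "nzd I f \<longleftrightarrow> (\<forall>g. f * g \<in> I \<longrightarrow> g \<in> I)"

lemma is_ideal_iff:
  "is_ideal I \<longleftrightarrow> 0 \<in> I \<and> (\<forall>x\<in>I. \<forall>y\<in>I. x + y \<in> I) \<and> (\<forall>a. \<forall>x\<in>I. a * x \<in> I)"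
  unfolding is_ideal_def module.subspace_def[OF module_times] by blast

lemma ideal_0: "is_ideal I \<Longrightarrow> 0 \<in> I"
  and ideal_add: "is_ideal I \<Longrightarrow> x \<in> I \<Longrightarrow> y \<in> I \<Longrightarrow> x + y \<in> I"
  and ideal_mult: "is_ideal I \<Longrightarrow> x \<in> I \<Longrightarrow> a * x \<in> I"
  unfolding is_ideal_iff by auto

lemma ideal_mult_right: "is_ideal I \<Longrightarrow> x \<in> I \<Longrightarrow> x * a \<in> I"
  using ideal_mult[of I x a] by (simp add: mult.commute)

lemma ideal_uminus: "is_ideal I \<Longrightarrow> x \<in> I \<Longrightarrow> - x \<in> I"
  using ideal_mult[of I x "-1"] by simp

lemma ideal_diff: "is_ideal I \<Longrightarrow> x \<in> I \<Longrightarrow> y \<in> I \<Longrightarrow> x - y \<in> I"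
  using ideal_add[of I x "-y"] ideal_uminus[of I y] by simp

lemma ideal_sum: "is_ideal I \<Longrightarrow> (\<And>x. x \<in> A \<Longrightarrow> f x \<in> I) \<Longrightarrow> sum f A \<in> I"
  by (induction A rule: infinite_finite_induct) (auto intro: ideal_0 ideal_add)

lemma ideal_cong: "is_ideal I \<Longrightarrow> x - y \<in> I \<Longrightarrow> x \<in> I \<longleftrightarrow> y \<in> I"
  using ideal_diff[of I x "x - y"] ideal_add[of I "x - y" y] by auto

lemma ideal_zero: "is_ideal {0}"
  and ideal_UNIV: "is_ideal UNIV"
  by (auto simp: is_ideal_iff)

lemma ideal_eq_UNIV: "is_ideal I \<Longrightarrow> 1 \<in> I \<Longrightarrow> I = UNIV"
  using ideal_mult[of I 1] by auto

lemma ideal_ideal_gen: "is_ideal (ideal_gen S)"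
  unfolding is_ideal_def ideal_gen_def by (rule module.subspace_span[OF module_times])

lemma ideal_gen_superset: "S \<subseteq> ideal_gen S"
  unfolding ideal_gen_def by (rule module.span_superset[OF module_times])

lemma ideal_gen_minimal: "S \<subseteq> I \<Longrightarrow> is_ideal I \<Longrightarrow> ideal_gen S \<subseteq> I"
  unfolding is_ideal_def ideal_gen_def by (rule module.span_minimal[OF module_times])

lemma ideal_gen_eqI: "S \<subseteq> I \<Longrightarrow> is_ideal I \<Longrightarrow> I \<subseteq> ideal_gen S \<Longrightarrow> ideal_gen S = I"
  using ideal_gen_minimal by blast

lemma ideal_adjoin: assumes "is_ideal I" shows "is_ideal (adjoin I f)"
  unfolding is_ideal_iff
proof (intro conjI ballI allI)
  show "0 \<in> adjoin I f"
    using ideal_0[OF assms] by (auto simp: adjoin_def intro: exI[of _ 0])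
next
  fix x y assume "x \<in> adjoin I f" "y \<in> adjoin I f"
  then obtain a b where "x - a * f \<in> I" "y - b * f \<in> I" by (auto simp: adjoin_def)
  then have "(x - a * f) + (y - b * f) \<in> I" by (rule ideal_add[OF assms])
  moreover have "(x - a * f) + (y - b * f) = (x + y) - (a + b) * f" by (simp add: algebra_simps)
  ultimately show "x + y \<in> adjoin I f" unfolding adjoin_def by (metis mem_Collect_eq)
next
  fix c x assume "x \<in> adjoin I f"
  then obtain a where "x - a * f \<in> I" by (auto simp: adjoin_def)
  then have "c * (x - a * f) \<in> I" by (rule ideal_mult[OF assms])
  moreover have "c * (x - a * f) = c * x - (c * a) * f" by (simp add: algebra_simps)
  ultimately show "c * x \<in> adjoin I f" unfolding adjoin_def by (metis mem_Collect_eq)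
qed

lemma adjoin_superset: "I \<subseteq> adjoin I f"
  by (auto simp: adjoin_def intro: exI[of _ 0])

lemma adjoin_mem: "is_ideal I \<Longrightarrow> f \<in> adjoin I f"
  by (auto simp: adjoin_def ideal_0 intro!: exI[of _ 1])

lemma adjoin_minimal: assumes "I \<subseteq> J" "f \<in> J" "is_ideal J" shows "adjoin I f \<subseteq> J"
proof
  fix x assume "x \<in> adjoin I f"
  then obtain a where "x - a * f \<in> J" using assms by (auto simp: adjoin_def)
  then show "x \<in> J" using ideal_cong[OF assms(3)] ideal_mult[OF assms(3,2)] by blast
qed

lemma adjoin_mono: "I \<subseteq> J \<Longrightarrow> adjoin I f \<subseteq> adjoin J f"
  by (auto simp: adjoin_def)

lemma adjoin_absorb: "is_ideal I \<Longrightarrow> f \<in> I \<Longrightarrow> adjoin I f = I"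
  using adjoin_minimal[of I I f] adjoin_superset[of I f] by auto

lemma adjoin_commute: assumes "is_ideal I" shows "adjoin (adjoin I f) g = adjoin (adjoin I g) f"
proof -
  have "adjoin (adjoin I f) g \<subseteq> adjoin (adjoin I g) f" for f g
    using assms by (meson adjoin_minimal adjoin_mono adjoin_superset adjoin_mem ideal_adjoin in_mono)
  then show ?thesis by blast
qed

lemma ideal_colon: "is_ideal I \<Longrightarrow> is_ideal (colon I f)"
  unfolding is_ideal_iff by (simp add: colon_def distrib_left mult.left_commute)

lemma colon_superset: "is_ideal I \<Longrightarrow> I \<subseteq> colon I f"
  by (auto simp: colon_def ideal_mult)

lemma nzd_iff_colon: "is_ideal I \<Longrightarrow> nzd I f \<longleftrightarrow> colon I f = I"
  using colon_superset[of I f] by (auto simp: nzd_def colon_def)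

section \<open>Regular sequences as lists\<close>

fun adjoin_list :: "'a::comm_ring_1 set \<Rightarrow> 'a list \<Rightarrow> 'a set"
  where "adjoin_list I [] = I" | "adjoin_list I (f # fs) = adjoin_list (adjoin I f) fs"

text \<open>Peels off the first form, as the inductions do. Unlike \<open>regular_sequence\<close>
  it does not ask the last quotient to be nonzero, so forms can be permuted and exchanged without a
  properness argument.\<close>

fun regular :: "'a::comm_ring_1 set \<Rightarrow> 'a list \<Rightarrow> bool"
  where "regular I [] = True" | "regular I (f # fs) = (nzd I f \<and> regular (adjoin I f) fs)"

lemma regular_append: "regular I (fs @ gs) \<longleftrightarrow> regular I fs \<and> regular (adjoin_list I fs) gs"
  by (induction fs arbitrary: I) auto

lemma ideal_adjoin_list: "is_ideal I \<Longrightarrow> is_ideal (adjoin_list I fs)"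
  by (induction fs arbitrary: I) (auto simp: ideal_adjoin)

lemma adjoin_list_superset: "I \<subseteq> adjoin_list I fs"
proof (induction fs arbitrary: I)
  case (Cons f fs) show ?case using adjoin_superset[of I f] Cons[of "adjoin I f"] by auto
qed auto

lemma adjoin_list_mono: "I \<subseteq> J \<Longrightarrow> adjoin_list I fs \<subseteq> adjoin_list J fs"
  by (induction fs arbitrary: I J) (auto simp: adjoin_mono)

lemma adjoin_list_commute:
  "is_ideal I \<Longrightarrow> adjoin_list (adjoin I f) gs = adjoin (adjoin_list I gs) f"
  by (induction gs arbitrary: I) (auto simp: adjoin_commute ideal_adjoin)

lemma adjoin_list_mem: "is_ideal I \<Longrightarrow> set fs \<subseteq> adjoin_list I fs"
proof (induction fs arbitrary: I)
  case (Cons f fs)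
  then show ?case
    using adjoin_list_superset[of "adjoin I f" fs] adjoin_mem[of I f] Cons.IH[of "adjoin I f"]
    by (auto simp: ideal_adjoin)
qed auto

lemma adjoin_list_minimal: "I \<subseteq> J \<Longrightarrow> set fs \<subseteq> J \<Longrightarrow> is_ideal J \<Longrightarrow> adjoin_list I fs \<subseteq> J"
  by (induction fs arbitrary: I) (auto simp: adjoin_minimal)

lemma adjoin_list_eq_ideal_gen: assumes "is_ideal I" shows "adjoin_list I fs = ideal_gen (I \<union> set fs)"
proof (rule sym, rule ideal_gen_eqI)
  show "I \<union> set fs \<subseteq> adjoin_list I fs"
    using adjoin_list_superset adjoin_list_mem[OF assms] by auto
  show "adjoin_list I fs \<subseteq> ideal_gen (I \<union> set fs)"
    using ideal_gen_superset[of "I \<union> set fs"] by (intro adjoin_list_minimal ideal_ideal_gen) auto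
qed (rule ideal_adjoin_list[OF assms])

lemma regular_sequence_imp_regular:
  assumes "is_ideal I" "regular_sequence I fs" shows "regular I fs"
proof -
  have "regular I (take i fs)" if "i \<le> length fs" for i
    using that
  proof (induction i)
    case (Suc i)
    then have "nzd (adjoin_list I (take i fs)) (fs ! i)"
      using assms by (auto simp: regular_sequence_def nzd_def adjoin_list_eq_ideal_gen)
    then show ?case using Suc by (simp add: take_Suc_conv_app_nth regular_append)
  qed auto
  from this[of "length fs"] show ?thesis by simp
qed

lemma ideal_gen_pair: "ideal_gen {f, g} = adjoin_list {0} [f, g]"
proof -
  have "{0} \<union> {f, g} \<subseteq> ideal_gen {f, g}"
    using ideal_gen_superset[of "{f, g}"] ideal_0[OF ideal_ideal_gen] by auto
  moreover have "ideal_gen {f, g} \<subseteq> ideal_gen ({0} \<union> {f, g})"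
    using ideal_gen_superset[of "{0} \<union> {f, g}"] by (intro ideal_gen_minimal ideal_ideal_gen) auto
  ultimately have "ideal_gen ({0} \<union> {f, g}) = ideal_gen {f, g}"
    by (intro ideal_gen_eqI ideal_ideal_gen)
  then show ?thesis
    using adjoin_list_eq_ideal_gen[OF ideal_zero, of "[f, g]"] by simp
qed

lemma ideal_gen_single: "ideal_gen {f} = adjoin {0} f"
  using ideal_gen_pair[of f f] by (simp add: adjoin_absorb ideal_adjoin ideal_zero adjoin_mem)

lemma adjoin_zero: "x \<in> adjoin {0} f \<longleftrightarrow> f dvd x"
  by (auto simp: adjoin_def dvd_def mult.commute)


section \<open>Homogeneous components\<close>

definition hom_comp :: "nat \<Rightarrow> ('v::finite, 'k::comm_ring_1) mpoly \<Rightarrow> ('v, 'k) mpoly"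
  where "hom_comp j p = Poly_Mapping.mapp (\<lambda>m c. c when monom_deg m = j) p"

text \<open>Closure under components instead of generation by forms, which suits arguments degree by
  degree; \<open>homogeneous_ideal_iff\<close> shows that both agree.\<close>

definition homog :: "('v::finite, 'k::comm_ring_1) mpoly set \<Rightarrow> bool"
  where "homog I \<longleftrightarrow> is_ideal I \<and> (\<forall>p\<in>I. \<forall>j. hom_comp j p \<in> I)"

abbreviation coeff_at :: "('v, 'k::zero) mpoly \<Rightarrow> ('v \<Rightarrow>\<^sub>0 nat) \<Rightarrow> 'k"
  where "coeff_at \<equiv> Poly_Mapping.lookup"

lemma coeff_hom_comp: "coeff_at (hom_comp j p) m = (coeff_at p m when monom_deg m = j)"
  by (simp add: hom_comp_def lookup_mapp in_keys_iff when_def)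

lemma forms_iff: "p \<in> forms j \<longleftrightarrow> (\<forall>m. coeff_at p m \<noteq> 0 \<longrightarrow> monom_deg m = j)"
  by (auto simp: forms_def in_keys_iff)

lemma hom_comp_forms: "hom_comp j p \<in> forms j"
  by (auto simp: forms_iff coeff_hom_comp)

lemma hom_comp_form: "p \<in> forms i \<Longrightarrow> hom_comp j p = (if i = j then p else 0)"
  by (rule poly_mapping_eqI) (auto simp: coeff_hom_comp forms_iff when_def)

lemma hom_comp_add: "hom_comp j (p + q) = hom_comp j p + hom_comp j q"
  by (rule poly_mapping_eqI) (auto simp: coeff_hom_comp lookup_add when_def)

lemma hom_comp_diff: "hom_comp j (p - q) = hom_comp j p - hom_comp j q"
  by (rule poly_mapping_eqI) (auto simp: coeff_hom_comp lookup_minus when_def)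

lemma hom_comp_0 [simp]: "hom_comp j 0 = 0"
  by (rule poly_mapping_eqI) (auto simp: coeff_hom_comp)

lemma hom_comp_sum: "hom_comp j (sum f A) = (\<Sum>a\<in>A. hom_comp j (f a))"
  by (induction A rule: infinite_finite_induct) (auto simp: hom_comp_add)

lemma hom_comp_decompose: "\<exists>n. p = (\<Sum>j<n. hom_comp j p)"
proof -
  obtain n where n: "\<And>m. m \<in> Poly_Mapping.keys p \<Longrightarrow> monom_deg m < n"
    using finite_nat_set_iff_bounded[of "monom_deg ` Poly_Mapping.keys p"] by auto
  have "p = (\<Sum>j<n. hom_comp j p)"
  proof (rule poly_mapping_eqI)
    fix m
    show "coeff_at p m = coeff_at (\<Sum>j<n. hom_comp j p) m"
      using n[of m] by (cases "m \<in> Poly_Mapping.keys p")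
        (auto simp: lookup_sum coeff_hom_comp when_def in_keys_iff sum.delta)
  qed
  then show ?thesis by blast
qed

lemma monom_deg_add: "monom_deg (m + n) = monom_deg m + monom_deg n"
  by (simp add: monom_deg_def lookup_add sum.distrib)

lemma monom_deg_zero [simp]: "monom_deg 0 = 0"
  by (simp add: monom_deg_def)

lemma monom_deg_single [simp]: "monom_deg (Poly_Mapping.single i n) = n"
  by (simp add: monom_deg_def lookup_single when_def sum.delta)

lemma monom_deg_eq_0: "monom_deg m = 0 \<longleftrightarrow> m = 0"
  by (auto simp: monom_deg_def intro!: poly_mapping_eqI)

lemma forms_0 [simp]: "0 \<in> forms j" by (simp add: forms_def)

lemma forms_add: "p \<in> forms j \<Longrightarrow> q \<in> forms j \<Longrightarrow> p + q \<in> forms j"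
  by (auto simp: forms_iff lookup_add) (metis add.right_neutral)

lemma forms_uminus: "p \<in> forms j \<Longrightarrow> - p \<in> forms j"
  by (auto simp: forms_iff)

lemma forms_diff: "p \<in> forms j \<Longrightarrow> q \<in> forms j \<Longrightarrow> p - q \<in> forms j"
  using forms_add[of p j "-q"] forms_uminus[of q j] by simp

lemma forms_mult: "p \<in> forms i \<Longrightarrow> q \<in> forms j \<Longrightarrow> p * q \<in> forms (i + j)"
  unfolding forms_def using keys_mult[of p q] by (fastforce simp: monom_deg_add)

lemma forms_sum: "(\<And>a. a \<in> A \<Longrightarrow> f a \<in> forms j) \<Longrightarrow> sum f A \<in> forms j"
  by (induction A rule: infinite_finite_induct) (auto simp: forms_add)

lemma forms_single: "monom_deg m = j \<Longrightarrow> Poly_Mapping.single m c \<in> forms j"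
  by (auto simp: forms_iff lookup_single when_def)

lemma forms_const: "Poly_Mapping.single 0 c \<in> forms 0"
  by (rule forms_single) simp

lemma forms_one [simp]: "1 \<in> forms 0"
  using forms_const[of 1] by simp

lemma forms_power: "p \<in> forms j \<Longrightarrow> p ^ n \<in> forms (n * j)"
  by (induction n) (auto dest: forms_mult)

lemma forms_var: "mpoly_var i \<in> forms 1"
  unfolding mpoly_var_def by (rule forms_single) simp

lemma forms_zero_const: assumes "p \<in> forms 0" shows "p = Poly_Mapping.single 0 (coeff_at p 0)"
  using assms by (intro poly_mapping_eqI) (auto simp: forms_iff monom_deg_eq_0 lookup_single when_def)

lemma hom_comp_form_mult:
  assumes "f \<in> forms a"
  shows "hom_comp j (f * p) = (if a \<le> j then f * hom_comp (j - a) p else 0)"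
proof -
  obtain n where n: "p = (\<Sum>i<n. hom_comp i p)" using hom_comp_decompose by blast
  have "hom_comp j (f * p) = (\<Sum>i<n. hom_comp j (f * hom_comp i p))"
    by (subst n) (simp add: sum_distrib_left hom_comp_sum)
  also have "\<dots> = (\<Sum>i<n. if i = j - a \<and> a \<le> j then f * hom_comp i p else 0)"
    by (intro sum.cong refl, subst hom_comp_form[OF forms_mult[OF assms hom_comp_forms]]) auto
  also have "\<dots> = (if a \<le> j then f * hom_comp (j - a) p else 0)"
  proof (cases "j - a < n")
    case True then show ?thesis by (simp add: sum.delta)
  next
    case False
    have "hom_comp (j - a) p = (\<Sum>i<n. hom_comp (j - a) (hom_comp i p))"
      by (subst n) (simp add: hom_comp_sum)
    also have "\<dots> = 0"
      using False by (intro sum.neutral ballI) (simp add: hom_comp_form[OF hom_comp_forms])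
    finally show ?thesis using False by (auto intro!: sum.neutral)
  qed
  finally show ?thesis .
qed

lemma homog_ideal: "homog I \<Longrightarrow> is_ideal I" by (simp add: homog_def)

lemma homog_comp: "homog I \<Longrightarrow> p \<in> I \<Longrightarrow> hom_comp j p \<in> I" by (simp add: homog_def)

lemma homog_iff_forms: assumes "homog I"
  shows "p \<in> I \<longleftrightarrow> (\<forall>j. hom_comp j p \<in> I)"
  using hom_comp_decompose[of p] homog_comp[OF assms] ideal_sum[OF homog_ideal[OF assms]] by metis

lemma homog_subset: assumes "homog I" "is_ideal J" "\<And>j p. p \<in> I \<Longrightarrow> p \<in> forms j \<Longrightarrow> p \<in> J"
  shows "I \<subseteq> J"
proof
  fix p assume "p \<in> I"
  then have "\<And>j. hom_comp j p \<in> J" using assms hom_comp_forms homog_comp by blast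
  then show "p \<in> J" using hom_comp_decompose[of p] ideal_sum[OF assms(2)] by metis
qed

lemma homog_zero: "homog {0}" by (simp add: homog_def ideal_zero)

lemma homog_UNIV: "homog UNIV" by (simp add: homog_def ideal_UNIV)

lemma homog_adjoin: assumes "homog I" "f \<in> forms a" shows "homog (adjoin I f)"
  unfolding homog_def
proof (intro conjI ballI allI)
  show "is_ideal (adjoin I f)" using assms by (simp add: ideal_adjoin homog_ideal)
  fix p j assume "p \<in> adjoin I f"
  then obtain b where "p - b * f \<in> I" by (auto simp: adjoin_def)
  then have "hom_comp j p - hom_comp j (f * b) \<in> I"
    using homog_comp[OF assms(1)] by (metis hom_comp_diff mult.commute)
  then show "hom_comp j p \<in> adjoin I f"
    unfolding hom_comp_form_mult[OF assms(2)]
    by (cases "a \<le> j") (auto simp: adjoin_def mult.commute intro: exI[of _ 0])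
qed

text \<open>Taking the component in degree \<open>j\<close> makes the multiplier of \<open>f\<close>
  a form. Subtraction is truncated, hence the separate clause for \<open>j < a\<close>, where no
  multiple of \<open>f\<close> takes part.\<close>

lemma adjoin_form: assumes "homog I" "f \<in> forms a" "p \<in> adjoin I f" "p \<in> forms j"
  shows "\<exists>w\<in>forms (j - a). p - w * f \<in> I \<and> (j < a \<longrightarrow> w = 0)"
proof -
  obtain b where "p - b * f \<in> I" using assms by (auto simp: adjoin_def)
  then have "hom_comp j p - hom_comp j (f * b) \<in> I"
    using homog_comp[OF assms(1)] by (metis hom_comp_diff mult.commute)
  then show ?thesis
    using assms(4) hom_comp_forms[of "j - a" b] unfolding hom_comp_form_mult[OF assms(2)]
    by (cases "a \<le> j") (auto simp: hom_comp_form mult.commute intro: bexI[of _ 0])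
qed

lemma homog_adjoin_list: "homog I \<Longrightarrow> set fs \<subseteq> (\<Union>a. forms a) \<Longrightarrow> homog (adjoin_list I fs)"
  by (induction fs arbitrary: I) (auto intro: homog_adjoin)

lemma homog_colon: assumes "homog I" "f \<in> forms a" shows "homog (colon I f)"
  unfolding homog_def
proof (intro conjI ballI allI)
  show "is_ideal (colon I f)" using assms by (simp add: ideal_colon homog_ideal)
  fix p j assume "p \<in> colon I f"
  then have "hom_comp (j + a) (f * p) \<in> I" using assms by (simp add: colon_def homog_comp)
  then show "hom_comp j p \<in> colon I f"
    by (simp add: hom_comp_form_mult[OF assms(2)] colon_def)
qed

lemma homogeneous_ideal_iff:
  fixes I :: "('v::finite, 'k::comm_ring_1) mpoly set"
  shows "homogeneous_ideal I \<longleftrightarrow> homog I"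
proof
  assume "homogeneous_ideal I"
  then obtain S where S: "S \<subseteq> (\<Union>l. forms l)" "I = ideal_gen S" by (auto simp: homogeneous_ideal_def)
  have iI: "is_ideal I" using S by (simp add: ideal_ideal_gen)
  \<comment> \<open>The elements with all components in \<open>I\<close> form an ideal that contains
    the generators, hence all of \<open>I\<close>.\<close>
  have "is_ideal {x. \<forall>j. hom_comp j x \<in> I}"
    unfolding is_ideal_iff
  proof (safe)
    fix a x :: "('v, 'k) mpoly" and j assume x: "\<forall>j. hom_comp j x \<in> I"
    obtain n where n: "a = (\<Sum>i<n. hom_comp i a)" using hom_comp_decompose by blast
    have "hom_comp j (a * x) = (\<Sum>i<n. hom_comp j (hom_comp i a * x))"
      by (subst n) (simp add: sum_distrib_right hom_comp_sum)
    also have "\<dots> \<in> I"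
      using x by (intro ideal_sum[OF iI]) (auto simp: hom_comp_form_mult[OF hom_comp_forms] ideal_0[OF iI] intro: ideal_mult[OF iI])
    finally show "hom_comp j (a * x) \<in> I" .
  qed (auto simp: hom_comp_add intro: ideal_0[OF iI] ideal_add[OF iI])
  moreover have "S \<subseteq> {x. \<forall>j. hom_comp j x \<in> I}"
  proof (safe)
    fix x j assume x: "x \<in> S"
    then obtain l where "x \<in> forms l" using S by auto
    moreover have "x \<in> I" using x S ideal_gen_superset by auto
    ultimately show "hom_comp j x \<in> I" by (simp add: hom_comp_form ideal_0[OF iI])
  qed
  ultimately have "I \<subseteq> {x. \<forall>j. hom_comp j x \<in> I}" unfolding S(2) using ideal_gen_minimal by blast
  then show "homog I" using iI by (auto simp: homog_def)
next
  assume h: "homog I"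
  have "I = ideal_gen (I \<inter> (\<Union>l. forms l))"
  proof
    show "I \<subseteq> ideal_gen (I \<inter> (\<Union>l. forms l))"
      by (rule homog_subset[OF h ideal_ideal_gen]) (auto intro: ideal_gen_superset[THEN subsetD])
    show "ideal_gen (I \<inter> (\<Union>l. forms l)) \<subseteq> I" by (rule ideal_gen_minimal) (auto simp: homog_ideal[OF h])
  qed
  then show "homogeneous_ideal I" unfolding homogeneous_ideal_def by blast
qed


section \<open>Dimensions of quotients\<close>

context vector_space begin

lemma finite_basis_exists:
  assumes "V \<subseteq> span A" "finite A"
  obtains B where "B \<subseteq> V" "independent B" "finite B" "V \<subseteq> span B" "card B = dim V"
  by (metis assms basis_exists independent_span_bound order_trans)

lemma dim_mono_finite:
  assumes "V \<subseteq> W" "W \<subseteq> span A" "finite A" shows "dim V \<le> dim W"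
  by (metis assms dim_le_card finite_basis_exists order_trans)

lemma subspace_eq_if_dim_eq:
  assumes "U \<subseteq> V" "V \<subseteq> span A" "finite A" "subspace U" "dim U = dim V" shows "U = V"
proof -
  obtain B where B: "B \<subseteq> U" "independent B" "finite B" "U \<subseteq> span B" "card B = dim U"
    using finite_basis_exists[of U A] assms by blast
  obtain C where C: "B \<subseteq> C" "C \<subseteq> V" "independent C" "V \<subseteq> span C"
    using maximal_independent_subset_extend[of B V] B assms(1) by blast
  have "finite C" using independent_span_bound[OF assms(3) C(3)] C(2) assms(2) by auto
  moreover have "card C = dim V" using basis_card_eq_dim C by blast
  ultimately have "B = C" using C(1) B(5) assms(5) by (simp add: card_subset_eq)
  then show ?thesis using B(1) C(4) assms(1,4) span_minimal by blast
qed

text \<open>\<open>T\<close> is injective on the span of \<open>D\<close> modulo the span of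
  \<open>E\<close>, so each new vector \<open>T d\<close> stays outside the span of \<open>E\<close>
  and the previous images.\<close>

lemma independent_image_mod:
  assumes T: "Vector_Spaces.linear scale scale T" and E: "independent E" "finite E"
    and D: "finite D" "independent D" "\<And>x. x \<in> span D \<Longrightarrow> T x \<in> span E \<Longrightarrow> x = 0"
  shows "independent (E \<union> T ` D) \<and> card (E \<union> T ` D) = card E + card D"
  using D
proof (induction D rule: finite_induct)
  case (insert d D)
  interpret T: Vector_Spaces.linear scale scale T by (rule T)
  have D: "independent D" "d \<notin> span D"
    using insert.prems(1) insert.hyps by (simp_all add: independent_insert)
  have IH: "independent (E \<union> T ` D)" "card (E \<union> T ` D) = card E + card D"
    using insert.IH D(1) insert.prems(2) span_mono[of D "insert d D"] by blast+
  have new: "T d \<notin> span (E \<union> T ` D)"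
  proof
    assume "T d \<in> span (E \<union> T ` D)"
    then obtain e y where "T d = e + y" "e \<in> span E" "y \<in> span (T ` D)" by (auto simp: span_Un)
    moreover from this obtain x where x: "x \<in> span D" "y = T x" by (auto simp: T.span_image)
    ultimately have "T (d - x) \<in> span E" by (simp add: T.diff)
    moreover have "d - x \<in> span (insert d D)"
      using span_diff[of d "insert d D" x] span_base[of d "insert d D"]
        subsetD[OF span_mono[OF subset_insertI], OF x(1)] by simp
    ultimately have "d - x = 0" using insert.prems(2) by blast
    then show False using x(1) D(2) by simp
  qed
  then have nin: "T d \<notin> E \<union> T ` D" using span_base[of "T d"] by metis
  have eq: "E \<union> T ` insert d D = insert (T d) (E \<union> T ` D)" by auto
  have "finite (E \<union> T ` D)" using E(2) insert.hyps(1) by simp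
  then have "card (insert (T d) (E \<union> T ` D)) = Suc (card E + card D)"
    using card_insert_disjoint[OF _ nin] IH(2) by metis
  then show ?case
    unfolding eq using independent_insertI[OF new IH(1)] insert.hyps by simp
qed (use E in auto)

text \<open>Rank and nullity of the map that \<open>T\<close> induces from \<open>V\<close> to the
  quotient by \<open>W\<close>, written with subspaces only: the image is the first set modulo
  \<open>W\<close>, the kernel is the second set.\<close>

lemma dim_image_plus:
  assumes T: "Vector_Spaces.linear scale scale T" and V: "subspace V" "V \<subseteq> span A" "finite A"
    and W: "subspace W" "W \<subseteq> span A'" "finite A'"
  shows "dim {T v + w | v w. v \<in> V \<and> w \<in> W} + dim {v \<in> V. T v \<in> W} = dim V + dim W"
proof -
  interpret T: Vector_Spaces.linear scale scale T by (rule T)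
  define K where "K = {v \<in> V. T v \<in> W}"
  have "subspace K"
    using V(1) W(1) unfolding K_def subspace_def by (auto simp: T.add T.scale)
  obtain B where B: "B \<subseteq> K" "independent B" "finite B" "K \<subseteq> span B" "card B = dim K"
    using finite_basis_exists[of K A] V by (auto simp: K_def)
  obtain C where C: "B \<subseteq> C" "C \<subseteq> V" "independent C" "V \<subseteq> span C"
    using maximal_independent_subset_extend[of B V] B by (auto simp: K_def)
  have finC: "finite C" using independent_span_bound[OF V(3) C(3)] C(2) V(2) by auto
  have cC: "card C = dim V" using basis_card_eq_dim C by blast
  obtain E where E: "E \<subseteq> W" "independent E" "finite E" "W \<subseteq> span E" "card E = dim W"
    using finite_basis_exists[of W A'] W by blast
  have spE: "span E = W" using E W(1) span_minimal by blast
  have spB: "span B = K" using B \<open>subspace K\<close> span_minimal by blast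
  \<comment> \<open>A vector of the complement of the kernel that \<open>T\<close> sends into
    \<open>W\<close> lies in the kernel too, so it is represented over two disjoint parts of the
    basis \<open>C\<close>.\<close>
  have key: "x = 0" if x: "x \<in> span (C - B)" "T x \<in> span E" for x
  proof -
    have "x \<in> V" using x(1) C(2) V(1) span_minimal[of "C - B" V] by blast
    then have "x \<in> span B" using x(2) by (simp add: spB spE K_def)
    moreover have "independent (B \<union> (C - B))" using C by (simp add: Un_absorb1)
    ultimately have "x \<in> span B \<inter> span (C - B)" using x by blast
    show "x = 0"
    proof (rule ccontr)
      assume "x \<noteq> 0"
      have r1: "representation C x = representation B x"
        using representation_extend[OF C(3) \<open>x \<in> span B\<close> C(1)] .
      have r2: "representation C x = representation (C - B) x"
        using representation_extend[OF C(3) x(1)] by blast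
      have "representation C x b = 0" for b
        using r1 r2 representation_ne_zero[of B x b] representation_ne_zero[of "C - B" x b] by fastforce
      moreover have "x \<in> span C" using x(1) span_mono[of "C - B" C] by blast
      ultimately have "x = 0"
        using sum_nonzero_representation_eq[OF C(3)] by fastforce
      then show False using \<open>x \<noteq> 0\<close> by simp
    qed
  qed
  have "independent (C - B)" using C(3) independent_mono by blast
  then have ind: "independent (E \<union> T ` (C - B))" "card (E \<union> T ` (C - B)) = card E + card (C - B)"
    using independent_image_mod[OF T E(2,3), of "C - B"] key finC by blast+
  have "dim {T v + w | v w. v \<in> V \<and> w \<in> W} = card E + card (C - B)"
  proof (rule dim_unique[OF _ _ ind])
    have "0 \<in> V" "0 \<in> W" using V(1) W(1) subspace_0 by auto
    show "E \<union> T ` (C - B) \<subseteq> {T v + w | v w. v \<in> V \<and> w \<in> W}"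
    proof
      fix x assume "x \<in> E \<union> T ` (C - B)"
      then consider "x \<in> W" | v where "v \<in> V" "x = T v" using E(1) C(2) by blast
      then show "x \<in> {T v + w | v w. v \<in> V \<and> w \<in> W}"
        using \<open>0 \<in> V\<close> \<open>0 \<in> W\<close> by cases (metis (mono_tags, lifting) T.zero add_0 mem_Collect_eq, force)
    qed
    show "{T v + w | v w. v \<in> V \<and> w \<in> W} \<subseteq> span (E \<union> T ` (C - B))"
    proof clarify
      fix v w assume vw: "v \<in> V" "w \<in> W"
      have CB: "B \<union> (C - B) = C" using C(1) by blast
      have "v \<in> {b + c | b c. b \<in> span B \<and> c \<in> span (C - B)}"
        using vw(1) C(4) span_Un[of B "C - B"] unfolding CB by auto
      then obtain b c where bc: "v = b + c" "b \<in> span B" "c \<in> span (C - B)" by blast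
      have "T b + w \<in> span E" using bc(2) vw(2) W(1) by (simp add: spB spE K_def subspace_add)
      moreover have "T c \<in> span (T ` (C - B))" using bc(3) by (simp add: T.span_image)
      moreover have "T v + w = (T b + w) + T c" using bc(1) by (simp add: T.add)
      ultimately show "T v + w \<in> span (E \<union> T ` (C - B))" unfolding span_Un by blast
    qed
  qed
  moreover have "card (C - B) = card C - card B" "card B \<le> card C"
    using C(1) finC B(3) by (simp_all add: card_Diff_subset card_mono)
  ultimately show ?thesis using B(5) E(5) cC by (simp add: K_def)
qed

end

interpretation mpoly: vector_space "mpoly_scale :: 'k::field \<Rightarrow> ('v, 'k) mpoly \<Rightarrow> _"
  by (rule vector_space_mpoly_scale)

lemma coeff_single_times:
  fixes p :: "('v, 'k::comm_ring_1) mpoly"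
  shows "coeff_at (Poly_Mapping.single a c * p) (a + m) = c * coeff_at p m"
  by (simp add: lookup_mult lookup_single when_mult)

lemma coeff_scale: "coeff_at (mpoly_scale c p) m = c * coeff_at p m"
  using coeff_single_times[of 0 c p m] by (simp add: mpoly_scale_def)

lemma ideal_subspace: "is_ideal I \<Longrightarrow> mpoly.subspace I"
  by (simp add: mpoly.subspace_def mpoly_scale_def ideal_0 ideal_add ideal_mult)

lemma forms_subspace: "mpoly.subspace (forms j)"
  by (auto simp: mpoly.subspace_def forms_add) (auto simp: forms_iff coeff_scale)

lemma finite_monom_deg: "finite {m :: 'v::finite \<Rightarrow>\<^sub>0 nat. monom_deg m = j}"
proof (rule finite_imageD)
  have "Poly_Mapping.lookup ` {m :: 'v \<Rightarrow>\<^sub>0 nat. monom_deg m = j} \<subseteq> (UNIV \<rightarrow>\<^sub>E {..j})"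
    by (auto simp: monom_deg_def intro: member_le_sum)
  then show "finite (Poly_Mapping.lookup ` {m :: 'v \<Rightarrow>\<^sub>0 nat. monom_deg m = j})"
    by (rule finite_subset) (intro finite_PiE, simp_all)
  show "inj_on Poly_Mapping.lookup {m :: 'v \<Rightarrow>\<^sub>0 nat. monom_deg m = j}"
    by (simp add: inj_on_def poly_mapping.lookup_inject)
qed

lemma mpoly_sum_monomials: "p = (\<Sum>m\<in>Poly_Mapping.keys p. mpoly_scale (coeff_at p m) (Poly_Mapping.single m 1))"
proof (rule poly_mapping_eqI)
  fix n
  have "coeff_at (\<Sum>m\<in>Poly_Mapping.keys p. mpoly_scale (coeff_at p m) (Poly_Mapping.single m 1)) n =
      (\<Sum>m\<in>Poly_Mapping.keys p. if m = n then coeff_at p m else 0)"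
    unfolding lookup_sum by (intro sum.cong) (auto simp: coeff_scale lookup_single when_def)
  also have "\<dots> = coeff_at p n" by (simp add: not_in_keys_iff_lookup_eq_zero)
  finally show "coeff_at p n = coeff_at (\<Sum>m\<in>Poly_Mapping.keys p. mpoly_scale (coeff_at p m) (Poly_Mapping.single m 1)) n"
    by simp
qed

lemma forms_finite_dim: "\<exists>A. finite A \<and> forms j \<subseteq> mpoly.span A"
proof (intro exI conjI subsetI)
  show "finite ((\<lambda>m. Poly_Mapping.single m 1) ` {m :: 'v::finite \<Rightarrow>\<^sub>0 nat. monom_deg m = j})"
    by (intro finite_imageI finite_monom_deg)
  fix p :: "('v::finite, 'k::field) mpoly" assume "p \<in> forms j"
  then show "p \<in> mpoly.span ((\<lambda>m. Poly_Mapping.single m 1) ` {m. monom_deg m = j})"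
    by (subst mpoly_sum_monomials, intro mpoly.span_sum mpoly.span_scale mpoly.span_base)
      (auto simp: forms_def)
qed

lemma linear_times: "Vector_Spaces.linear mpoly_scale mpoly_scale ((*) f)"
  for f :: "('v, 'k::field) mpoly"
  by unfold_locales (simp_all add: algebra_simps mpoly_scale_def)

section \<open>Hilbert functions and the adjunction of a form\<close>

definition "form_dim j I = mpoly.dim (forms j \<inter> I)"

lemma hilbert_fun_dim:
  fixes I :: "('v::finite, 'k::field) mpoly set"
  shows "hilbert_fun I j = form_dim j (UNIV :: ('v, 'k) mpoly set) - form_dim j I"
  by (simp add: hilbert_fun_def form_dim_def)

lemma form_dim_mono:
  fixes I J :: "('v::finite, 'k::field) mpoly set"
  assumes "I \<subseteq> J" shows "form_dim j I \<le> form_dim j J"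
proof -
  obtain A :: "('v, 'k) mpoly set" where "finite A" "forms j \<subseteq> mpoly.span A" using forms_finite_dim by blast
  then show ?thesis
    unfolding form_dim_def using assms by (intro mpoly.dim_mono_finite[of _ _ A]) auto
qed

lemma hilbert_fun_int:
  fixes I :: "('v::finite, 'k::field) mpoly set"
  shows "int (hilbert_fun I j) = int (form_dim j (UNIV :: ('v, 'k) mpoly set)) - int (form_dim j I)"
  using form_dim_mono[of I UNIV j] by (simp add: hilbert_fun_dim)

lemma form_dim_eq_imp:
  fixes I J :: "('v::finite, 'k::field) mpoly set"
  assumes "I \<subseteq> J" "is_ideal I" "form_dim j I = form_dim j J"
  shows "forms j \<inter> I = forms j \<inter> J"
proof -
  obtain A :: "('v, 'k) mpoly set" where "finite A" "forms j \<subseteq> mpoly.span A" using forms_finite_dim by blast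
  then show ?thesis
    using assms unfolding form_dim_def
    by (intro mpoly.subspace_eq_if_dim_eq[of _ _ A] mpoly.subspace_inter forms_subspace ideal_subspace) auto
qed

text \<open>Rank and nullity for multiplication by \<open>f\<close> from degree \<open>j\<close> to
  degree \<open>j + a\<close> modulo \<open>I\<close>; the kernel is the degree \<open>j\<close>
  part of \<open>colon I f\<close>.\<close>

lemma form_dim_adjoin:
  fixes I :: "('v::finite, 'k::field) mpoly set"
  assumes I: "homog I" and f: "f \<in> forms a"
  shows "form_dim (j + a) (adjoin I f) + form_dim j (colon I f) =
    form_dim j (UNIV :: ('v, 'k) mpoly set) + form_dim (j + a) I"
proof -
  obtain A :: "('v, 'k) mpoly set" where A: "finite A" "forms j \<subseteq> mpoly.span A"
    using forms_finite_dim by blast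
  obtain B :: "('v, 'k) mpoly set" where B: "finite B" "forms (j + a) \<subseteq> mpoly.span B"
    using forms_finite_dim by blast
  have "{f * v + w | v w. v \<in> forms j \<and> w \<in> forms (j + a) \<inter> I} = forms (j + a) \<inter> adjoin I f"
  proof (safe)
    fix v w :: "('v, 'k) mpoly" assume "v \<in> forms j" "w \<in> forms (j + a)" "w \<in> I"
    then show "f * v + w \<in> forms (j + a)" "f * v + w \<in> adjoin I f"
      using forms_mult[OF f, of v j]
      by (auto simp: forms_add add.commute adjoin_def mult.commute intro: exI[of _ v])
  next
    fix p :: "('v, 'k) mpoly" assume p: "p \<in> forms (j + a)" "p \<in> adjoin I f"
    then obtain w where w: "w \<in> forms j" "p - w * f \<in> I" using adjoin_form[OF I f p(2,1)] by auto
    have "p - w * f \<in> forms (j + a)" using forms_diff[OF p(1) forms_mult[OF w(1) f]] .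
    then show "\<exists>v w. p = f * v + w \<and> v \<in> forms j \<and> w \<in> forms (j + a) \<inter> I"
      using w by (intro exI[of _ w] exI[of _ "p - w * f"]) (simp add: mult.commute)
  qed
  moreover have "{v \<in> forms j. f * v \<in> forms (j + a) \<inter> I} = forms j \<inter> colon I f"
    using forms_mult[OF f, of _ j] by (auto simp: colon_def add.commute)
  moreover have "mpoly.dim {f * v + w | v w. v \<in> forms j \<and> w \<in> forms (j + a) \<inter> I} +
      mpoly.dim {v \<in> forms j. f * v \<in> forms (j + a) \<inter> I} =
      mpoly.dim (forms j :: ('v, 'k) mpoly set) + mpoly.dim (forms (j + a) \<inter> I)"
    using mpoly.dim_image_plus[OF linear_times[of f] forms_subspace[of j] A(2,1),
        OF mpoly.subspace_inter[OF forms_subspace ideal_subspace[OF homog_ideal[OF I]], of "j + a"]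
          order_trans[OF Int_lower1 B(2)] B(1)] .
  ultimately show ?thesis by (simp add: form_dim_def)
qed

lemma form_dim_adjoin_low:
  assumes "homog I" "f \<in> forms a" "j < a" shows "form_dim j (adjoin I f) = form_dim j I"
proof -
  have "forms j \<inter> adjoin I f = forms j \<inter> I"
    using adjoin_form[OF assms(1,2)] assms(3) adjoin_superset[of I f] by fastforce
  then show ?thesis by (simp add: form_dim_def)
qed

definition hilbert_series :: "('v::finite, 'k::field) mpoly set \<Rightarrow> int fps"
  where "hilbert_series I = Abs_fps (\<lambda>j. int (hilbert_fun I j))"

lemma nth_hilbert_series [simp]: "fps_nth (hilbert_series I) j = int (hilbert_fun I j)"
  by (simp add: hilbert_series_def)

text \<open>The exact sequence with the terms A / (I : f), shifted by \<open>a\<close>, A / I and A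
  / (I + (f)).\<close>

lemma hilbert_series_adjoin:
  assumes "homog I" "f \<in> forms a"
  shows "hilbert_series (adjoin I f) = hilbert_series I - fps_X ^ a * hilbert_series (colon I f)"
proof (rule fps_ext)
  fix n
  show "fps_nth (hilbert_series (adjoin I f)) n =
    fps_nth (hilbert_series I - fps_X ^ a * hilbert_series (colon I f)) n"
  proof (cases "n < a")
    case True then show ?thesis
      using form_dim_adjoin_low[OF assms True] by (simp add: fps_X_power_mult_nth hilbert_fun_dim)
  next
    case False
    then show ?thesis
      using form_dim_adjoin[OF assms, of "n - a"] by (simp add: fps_X_power_mult_nth hilbert_fun_int)
  qed
qed

lemma hilbert_series_adjoin_nzd:
  assumes "homog I" "f \<in> forms a" "nzd I f"
  shows "hilbert_series (adjoin I f) = (1 - fps_X ^ a) * hilbert_series I"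
  using hilbert_series_adjoin[OF assms(1,2)] nzd_iff_colon[of I f] assms
  by (simp add: homog_ideal algebra_simps)

lemma hilbert_fun_mono: "I \<subseteq> J \<Longrightarrow> hilbert_fun J j \<le> hilbert_fun I j"
  using form_dim_mono[of I J j] by (simp add: hilbert_fun_dim)

lemma hilbert_fun_eq_imp:
  assumes "I \<subseteq> J" "is_ideal I" "hilbert_fun I j = hilbert_fun J j"
  shows "forms j \<inter> I = forms j \<inter> J"
proof (rule form_dim_eq_imp[OF assms(1,2)])
  have "int (hilbert_fun I j) = int (hilbert_fun J j)" using assms(3) by simp
  then show "form_dim j I = form_dim j J" unfolding hilbert_fun_int by simp
qed

lemma hilbert_fun_cong: "forms j \<inter> I = forms j \<inter> J \<Longrightarrow> hilbert_fun I j = hilbert_fun J j"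
  by (simp add: hilbert_fun_dim form_dim_def)

lemma hilbert_fun_eq_0: assumes "is_ideal I" shows "hilbert_fun I j = 0 \<longleftrightarrow> forms j \<subseteq> I"
proof
  assume "hilbert_fun I j = 0"
  then have "hilbert_fun I j = hilbert_fun UNIV j" by (simp add: hilbert_fun_dim)
  then show "forms j \<subseteq> I" using hilbert_fun_eq_imp[OF subset_UNIV assms] by auto
next
  assume "forms j \<subseteq> I"
  then have "forms j \<inter> I = forms j \<inter> UNIV" by auto
  then show "hilbert_fun I j = 0" using hilbert_fun_cong[of j I UNIV] by (simp add: hilbert_fun_dim)
qed

text \<open>The way ideals are identified later: one inclusion is shown directly, the other follows
  by counting dimensions.\<close>

lemma hilbert_series_eq_imp:
  assumes "I \<subseteq> J" "is_ideal I" "homog J" "hilbert_series I = hilbert_series J"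
  shows "I = J"
proof
  show "J \<subseteq> I"
  proof (rule homog_subset[OF assms(3,2)])
    fix j p assume "p \<in> J" "p \<in> forms j"
    moreover have "hilbert_fun I j = hilbert_fun J j"
      using arg_cong[OF assms(4), of "\<lambda>h. fps_nth h j"] by simp
    ultimately show "p \<in> I" using hilbert_fun_eq_imp[OF assms(1,2)] by blast
  qed
qed (rule assms(1))


section \<open>Leading monomials and Noetherianity\<close>

definition var_prime :: "'v::finite \<Rightarrow> nat"
  where "var_prime = (SOME f. inj f \<and> range f \<subseteq> {p. prime p})"

lemma var_prime: "inj (var_prime :: 'v::finite \<Rightarrow> nat)" "prime (var_prime (i :: 'v))"
proof -
  obtain g :: "nat \<Rightarrow> nat" where g: "inj g" "range g \<subseteq> {p. prime p}"
    using infinite_countable_subset[OF primes_infinite] by blast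
  obtain h :: "'v \<Rightarrow> nat" where "inj h"
    using finite_imp_inj_to_nat_seg[of "UNIV :: 'v set"] by auto
  then have "inj (g \<circ> h) \<and> range (g \<circ> h) \<subseteq> {p. prime p}" using g inj_compose by auto
  then have "inj (var_prime :: 'v \<Rightarrow> nat) \<and> range (var_prime :: 'v \<Rightarrow> nat) \<subseteq> {p. prime p}"
    unfolding var_prime_def by (rule someI[where P = "\<lambda>f. inj f \<and> range f \<subseteq> {p. prime p}"])
  then show "inj (var_prime :: 'v \<Rightarrow> nat)" "prime (var_prime (i :: 'v))" by auto
qed

text \<open>A Goedel numbering turns the comparison of numbers into a monomial order.\<close>

definition godel :: "('v::finite \<Rightarrow>\<^sub>0 nat) \<Rightarrow> nat"
  where "godel m = (\<Prod>i\<in>UNIV. var_prime i ^ Poly_Mapping.lookup m i)"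

lemma godel_add: "godel (m + n) = godel m * godel n"
  by (simp add: godel_def lookup_add power_add prod.distrib)

lemma godel_pos: "godel m > 0"
  unfolding godel_def by (intro prod_pos ballI zero_less_power prime_gt_0_nat var_prime(2))

text \<open>The exponent of a variable is the multiplicity of its prime in the Goedel
  number.\<close>

lemma godel_inject: fixes m n :: "'v::finite \<Rightarrow>\<^sub>0 nat" assumes "godel m = godel n" shows "m = n"
proof (rule poly_mapping_eqI)
  fix i
  have "multiplicity (var_prime i) (godel m) = Poly_Mapping.lookup m i" for m :: "'v \<Rightarrow>\<^sub>0 nat"
  proof -
    let ?r = "the_inv var_prime :: nat \<Rightarrow> 'v"
    have "godel m = (\<Prod>p\<in>range (var_prime :: 'v \<Rightarrow> nat). p ^ Poly_Mapping.lookup m (?r p))"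
      unfolding godel_def by (subst prod.reindex) (simp_all add: var_prime the_inv_f_f[OF var_prime(1)])
    moreover have "prime p" if "p \<in> range (var_prime :: 'v \<Rightarrow> nat)" for p
      using that var_prime(2) by blast
    ultimately show ?thesis
      using multiplicity_prod_prime_powers[of "range (var_prime :: 'v \<Rightarrow> nat)" "var_prime i" "\<lambda>p. Poly_Mapping.lookup m (?r p)"]
      by (auto simp: var_prime the_inv_f_f[OF var_prime(1)])
  qed
  then show "Poly_Mapping.lookup m i = Poly_Mapping.lookup n i" using assms by metis
qed

definition lead_monom :: "('v::finite, 'k::zero) mpoly \<Rightarrow> ('v \<Rightarrow>\<^sub>0 nat)"
  where "lead_monom p = (SOME m. m \<in> Poly_Mapping.keys p \<and> (\<forall>n\<in>Poly_Mapping.keys p. godel n \<le> godel m))"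

lemma lead_monom:
  assumes "p \<noteq> 0"
  shows "lead_monom p \<in> Poly_Mapping.keys p" "\<And>n. n \<in> Poly_Mapping.keys p \<Longrightarrow> godel n \<le> godel (lead_monom p)"
proof -
  have ne: "finite (Poly_Mapping.keys p)" "Poly_Mapping.keys p \<noteq> {}"
    using assms by (auto simp: keys_eq_empty)
  then have "Max (godel ` Poly_Mapping.keys p) \<in> godel ` Poly_Mapping.keys p" by simp
  then have "\<exists>m. m \<in> Poly_Mapping.keys p \<and> (\<forall>n\<in>Poly_Mapping.keys p. godel n \<le> godel m)"
    using ne(1) by (metis (no_types, lifting) Max_ge finite_imageI image_iff)
  then have "lead_monom p \<in> Poly_Mapping.keys p \<and> (\<forall>n\<in>Poly_Mapping.keys p. godel n \<le> godel (lead_monom p))"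
    unfolding lead_monom_def by (rule someI_ex)
  then show "lead_monom p \<in> Poly_Mapping.keys p" "\<And>n. n \<in> Poly_Mapping.keys p \<Longrightarrow> godel n \<le> godel (lead_monom p)"
    by auto
qed

lemma lead_monom_eqI:
  assumes "m \<in> Poly_Mapping.keys p" "\<And>n. n \<in> Poly_Mapping.keys p \<Longrightarrow> godel n \<le> godel m"
  shows "lead_monom p = m"
proof -
  have "p \<noteq> 0" using assms(1) by auto
  then show ?thesis using lead_monom[of p] assms by (intro godel_inject order_antisym) auto
qed

text \<open>Only the pair of leading monomials contributes, because any other pair has a smaller
  product of Goedel numbers.\<close>

lemma coeff_lead_mult:
  fixes p q :: "('v::finite, 'k::field) mpoly"
  assumes "p \<noteq> 0" "q \<noteq> 0"
  shows "coeff_at (p * q) (lead_monom p + lead_monom q) = coeff_at p (lead_monom p) * coeff_at q (lead_monom q)"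
proof -
  define s where "s = Poly_Mapping.single (lead_monom p) (coeff_at p (lead_monom p))"
  have "coeff_at ((p - s) * q) (lead_monom p + lead_monom q) = 0"
  proof (rule ccontr)
    assume "coeff_at ((p - s) * q) (lead_monom p + lead_monom q) \<noteq> 0"
    then have "lead_monom p + lead_monom q \<in> Poly_Mapping.keys ((p - s) * q)" by (simp add: in_keys_iff)
    then obtain a b where ab: "lead_monom p + lead_monom q = a + b" "a \<in> Poly_Mapping.keys (p - s)" "b \<in> Poly_Mapping.keys q"
      using keys_mult[of "p - s" q] by blast
    have "a \<noteq> lead_monom p" using ab(2) by (auto simp: s_def in_keys_iff lookup_minus)
    moreover from this have "a \<in> Poly_Mapping.keys p"
      using ab(2) by (auto simp: s_def in_keys_iff lookup_minus lookup_single when_def)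
    ultimately have "godel a < godel (lead_monom p)"
      using lead_monom(2)[OF assms(1)] godel_inject by (metis order_le_imp_less_or_eq)
    moreover have "godel b \<le> godel (lead_monom q)" using lead_monom(2)[OF assms(2) ab(3)] .
    ultimately have "godel a * godel b < godel (lead_monom p) * godel (lead_monom q)"
      using godel_pos[of b] by (meson less_le_trans mult_le_mono2 mult_less_mono1)
    then show False using arg_cong[OF ab(1), of godel] by (simp add: godel_add)
  qed
  moreover have "p * q = s * q + (p - s) * q" by (simp add: algebra_simps)
  ultimately show ?thesis by (simp add: lookup_add s_def coeff_single_times)
qed

lemma coeff_lead_nonzero: "p \<noteq> 0 \<Longrightarrow> coeff_at p (lead_monom p) \<noteq> 0"
  using lead_monom(1)[of p] by (simp add: in_keys_iff)

lemma mpoly_no_zero_divisors: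
  fixes p q :: "('v::finite, 'k::field) mpoly"
  assumes "p * q = 0" shows "p = 0 \<or> q = 0"
  using coeff_lead_mult[of p q] assms coeff_lead_nonzero[of p] coeff_lead_nonzero[of q] by auto

lemma mpoly_mult_eq_0_iff [simp]:
  fixes p q :: "('v::finite, 'k::field) mpoly"
  shows "p * q = 0 \<longleftrightarrow> p = 0 \<or> q = 0"
  using mpoly_no_zero_divisors[of p q] by auto

lemma mpoly_mult_cancel:
  fixes p q r :: "('v::finite, 'k::field) mpoly"
  shows "p * q = p * r \<longleftrightarrow> p = 0 \<or> q = r"
  using mpoly_mult_eq_0_iff[of p "q - r"] by (auto simp: right_diff_distrib)

lemma lead_monom_mult:
  fixes p q :: "('v::finite, 'k::field) mpoly"
  assumes "p \<noteq> 0" "q \<noteq> 0"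
  shows "lead_monom (p * q) = lead_monom p + lead_monom q"
proof (rule lead_monom_eqI)
  show "lead_monom p + lead_monom q \<in> Poly_Mapping.keys (p * q)"
    using coeff_lead_mult[OF assms] assms by (simp add: in_keys_iff coeff_lead_nonzero)
  fix n assume "n \<in> Poly_Mapping.keys (p * q)"
  then obtain a b where "n = a + b" "a \<in> Poly_Mapping.keys p" "b \<in> Poly_Mapping.keys q"
    using keys_mult[of p q] by blast
  then show "godel n \<le> godel (lead_monom p + lead_monom q)"
    using lead_monom(2)[OF assms(1)] lead_monom(2)[OF assms(2)] by (simp add: godel_add mult_le_mono)
qed

text \<open>Division with remainder: subtracting a scalar multiple of an element of \<open>I\<close>
  with the same leading monomial lowers the Goedel number, which is a natural number, so the process
  ends.\<close>

lemma ideal_eq_if_lead_monoms: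
  fixes I J :: "('v::finite, 'k::field) mpoly set"
  assumes "is_ideal I" "is_ideal J" "I \<subseteq> J" and lead: "lead_monom ` (J - {0}) \<subseteq> lead_monom ` (I - {0})"
  shows "J \<subseteq> I"
proof
  fix p assume "p \<in> J"
  then show "p \<in> I"
  proof (induction "godel (lead_monom p)" arbitrary: p rule: less_induct)
    case less
    show ?case
    proof (cases "p = 0")
      case True then show ?thesis using ideal_0[OF assms(1)] by simp
    next
      case False
      then obtain q where q: "q \<in> I" "q \<noteq> 0" "lead_monom q = lead_monom p" using less.prems lead by force
      define c where "c = coeff_at p (lead_monom p) / coeff_at q (lead_monom q)"
      define r where "r = p - mpoly_scale c q"
      have cq: "mpoly_scale c q \<in> I" using q(1) assms(1) by (simp add: mpoly_scale_def ideal_mult)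
      have rJ: "r \<in> J" unfolding r_def using less.prems cq assms(2,3) by (auto intro: ideal_diff)
      have "r \<in> I"
      proof (cases "r = 0")
        case True then show ?thesis using ideal_0[OF assms(1)] by simp
      next
        case r0: False
        have "coeff_at r (lead_monom p) = 0"
          using q coeff_lead_nonzero[of q] by (simp add: r_def lookup_minus coeff_scale c_def)
        then have "lead_monom r \<noteq> lead_monom p" using coeff_lead_nonzero[OF r0] by auto
        moreover have "lead_monom r \<in> Poly_Mapping.keys p \<union> Poly_Mapping.keys q"
          using lead_monom(1)[OF r0] by (auto simp: r_def in_keys_iff lookup_minus coeff_scale)
        then have "godel (lead_monom r) \<le> godel (lead_monom p)"
          using lead_monom(2)[OF False] lead_monom(2)[OF q(2)] q(3) by auto
        ultimately have "godel (lead_monom r) < godel (lead_monom p)"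
          using godel_inject by (metis order_le_imp_less_or_eq)
        then show ?thesis using less.hyps rJ by blast
      qed
      then have "r + mpoly_scale c q \<in> I" using cq ideal_add[OF assms(1)] by blast
      then show ?thesis by (simp add: r_def)
    qed
  qed
qed

section \<open>Dickson's lemma and the ascending chain condition\<close>

lemma nat_seq_incseq_subseq: "\<exists>r :: nat \<Rightarrow> nat. strict_mono r \<and> incseq (\<lambda>n. f (r n))" for f :: "nat \<Rightarrow> nat"
proof -
  obtain g where g: "strict_mono g" "monoseq (f \<circ> g)"
    using seq_monosub[of f] by (auto simp: o_def)
  from g(2) consider "incseq (f \<circ> g)" | "decseq (f \<circ> g)" by (auto simp: monoseq_iff)
  then show ?thesis
  proof cases
    case 1 then show ?thesis using g(1) by (auto simp: o_def)
  next
    case 2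
    \<comment> \<open>A decreasing sequence of natural numbers is constant once it reaches its
      minimum, hence also increasing from there on.\<close>
    obtain n where n: "\<And>k. f (g n) \<le> f (g k)"
      using ex_has_least_nat[of "\<lambda>_. True" 0 "\<lambda>n. f (g n)"] by auto
    have "f (g (n + k)) = f (g n)" for k
      using n[of "n + k"] 2 by (auto simp: decseq_def intro: antisym)
    then have "incseq (\<lambda>k. f (g (n + k)))" by (simp add: incseq_def)
    moreover have "strict_mono (\<lambda>k. g (n + k))" using g(1) by (simp add: strict_mono_def)
    ultimately show ?thesis by blast
  qed
qed

text \<open>The subsequence is refined once per coordinate; passing to a further subsequence keeps
  the coordinates already treated increasing.\<close>

lemma dickson_subseq:
  fixes g :: "nat \<Rightarrow> 'v \<Rightarrow> nat"
  assumes "finite S"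
  shows "\<exists>r :: nat \<Rightarrow> nat. strict_mono r \<and> (\<forall>x\<in>S. incseq (\<lambda>n. g (r n) x))"
  using assms
proof (induction S rule: finite_induct)
  case empty show ?case by (auto intro: exI[of _ id] simp: strict_mono_def)
next
  case (insert x S)
  then obtain r where r: "strict_mono r" "\<And>y. y \<in> S \<Longrightarrow> incseq (\<lambda>n. g (r n) y)" by blast
  obtain t where t: "strict_mono t" "incseq (\<lambda>n. g (r (t n)) x)"
    using nat_seq_incseq_subseq[of "\<lambda>n. g (r n) x"] by blast
  have "strict_mono (\<lambda>n. r (t n))" using r(1) t(1) by (auto simp: strict_mono_def)
  moreover have "incseq (\<lambda>n. g (r (t n)) y)" if "y \<in> S" for y
    using r(2)[OF that] t(1) by (simp add: incseq_def strict_mono_less_eq)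
  ultimately show ?case using t(2) by (intro exI[of _ "\<lambda>n. r (t n)"]) auto
qed

lemma dickson:
  fixes f :: "nat \<Rightarrow> ('v::finite \<Rightarrow>\<^sub>0 nat)"
  shows "\<exists>i j d. i < j \<and> f j = f i + d"
proof -
  obtain r :: "nat \<Rightarrow> nat" where r: "strict_mono r" "\<And>x. incseq (\<lambda>n. Poly_Mapping.lookup (f (r n)) x)"
    using dickson_subseq[of UNIV "\<lambda>n. Poly_Mapping.lookup (f n)"] by auto
  have "Poly_Mapping.lookup (f (r 0)) x \<le> Poly_Mapping.lookup (f (r 1)) x" for x
    using r(2)[of x] by (simp add: incseq_def)
  then have "f (r 1) = f (r 0) + (f (r 1) - f (r 0))"
    by (intro poly_mapping_eqI) (simp add: lookup_add lookup_minus)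
  moreover have "r 0 < r 1" using r(1) by (simp add: strict_mono_def)
  ultimately show ?thesis by blast
qed

text \<open>Well-foundedness yields both maximal elements of families of ideals and induction from
  larger ideals to smaller ones.\<close>

definition noetherian :: "'a::comm_ring_1 itself \<Rightarrow> bool"
  where "noetherian _ \<longleftrightarrow> wf {(J, I :: 'a set). is_ideal I \<and> is_ideal J \<and> I \<subset> J}"

text \<open>Each strict inclusion gives a new leading monomial. By Dickson one of them is a multiple
  of an earlier one, but such multiples are leading monomials already.\<close>

lemma mpoly_noetherian: "noetherian TYPE(('v::finite, 'k::field) mpoly)"
  unfolding noetherian_def wf_iff_no_infinite_down_chain
proof
  assume "\<exists>I :: nat \<Rightarrow> ('v, 'k) mpoly set. \<forall>i. (I (Suc i), I i) \<in> {(J, I). is_ideal I \<and> is_ideal J \<and> I \<subset> J}"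
  then obtain I :: "nat \<Rightarrow> ('v, 'k) mpoly set" where I: "\<And>i. is_ideal (I i)" "\<And>i. I i \<subset> I (Suc i)" by blast
  have mono: "I i \<subseteq> I j" if "i \<le> j" for i j
    using that
  proof (induction rule: dec_induct)
    case (step n) then show ?case using I(2)[of n] by blast
  qed simp
  have "\<exists>m. m \<in> lead_monom ` (I (Suc i) - {0}) - lead_monom ` (I i - {0})" for i
  proof -
    have "\<not> lead_monom ` (I (Suc i) - {0}) \<subseteq> lead_monom ` (I i - {0})"
      using ideal_eq_if_lead_monoms[OF I(1)[of i] I(1)[of "Suc i"] psubset_imp_subset[OF I(2)]] I(2)[of i]
      by (meson psubsetE)
    then show ?thesis by (meson DiffI subsetI)
  qed
  then obtain m where m: "\<And>i. m i \<in> lead_monom ` (I (Suc i) - {0}) - lead_monom ` (I i - {0})" by metis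
  obtain i j d where ij: "i < j" "m j = m i + d" using dickson[of m] by blast
  have "m i \<in> lead_monom ` (I (Suc i) - {0})" using m[of i] by (rule DiffD1)
  then obtain q where "m i = lead_monom q" "q \<in> I (Suc i) - {0}" by (rule imageE)
  then have q: "q \<in> I (Suc i)" "q \<noteq> 0" "lead_monom q = m i" by simp_all
  define t :: "('v, 'k) mpoly" where "t = Poly_Mapping.single d 1"
  have kt: "Poly_Mapping.keys t = {d}" by (simp add: t_def)
  have t: "t \<noteq> 0" "lead_monom t = d"
    using kt by force (rule lead_monom_eqI, simp_all add: kt)
  have "q \<in> I j" using q(1) mono[of "Suc i" j] ij(1) by auto
  then have "t * q \<in> I j" by (rule ideal_mult[OF I(1)])
  moreover have "lead_monom (t * q) = m j"
    using lead_monom_mult[OF t(1) q(2)] by (simp add: t(2) q(3) ij(2) add.commute)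
  moreover have "t * q \<noteq> 0" using t(1) q(2) by simp
  ultimately have "m j \<in> lead_monom ` (I j - {0})" by (metis DiffI imageI singletonD)
  then show False using m[of j] by simp
qed


section \<open>Associated primes\<close>

definition assoc_primes :: "'a::comm_ring_1 set \<Rightarrow> 'a set set"
  where "assoc_primes I = {P. prime_ideal P \<and> (\<exists>z. P = colon I z)}"

lemma colon_mult: "is_ideal I \<Longrightarrow> colon I w \<subseteq> colon I (w * a)"
  by (auto simp: colon_def) (metis ideal_mult mult.assoc mult.commute)

text \<open>A maximal proper colon ideal above \<open>colon I z\<close> is prime: if
  \<open>a * b\<close> lies in \<open>colon I w\<close> and \<open>a\<close> does not, then
  \<open>colon I (w * a)\<close> is no larger than \<open>colon I w\<close>, and it contains
  \<open>b\<close>.\<close>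

lemma prime_colon_exists:
  fixes I :: "'a::comm_ring_1 set"
  assumes "noetherian TYPE('a)" "is_ideal I" "z \<notin> I"
  shows "\<exists>P\<in>assoc_primes I. colon I z \<subseteq> P"
proof -
  define Q where "Q = {colon I w | w. w \<notin> I \<and> colon I z \<subseteq> colon I w}"
  have "colon I z \<in> Q" using assms(3) by (auto simp: Q_def)
  then obtain P where P: "P \<in> Q" "\<And>J. (J, P) \<in> {(J, I). is_ideal I \<and> is_ideal J \<and> I \<subset> J} \<Longrightarrow> J \<notin> Q"
    using wfE_min[OF assms(1)[unfolded noetherian_def], of "colon I z" Q thesis] by simp
  obtain w where w: "P = colon I w" "w \<notin> I" "colon I z \<subseteq> P" using P(1) by (auto simp: Q_def)
  have "prime_ideal P"
    unfolding prime_ideal_def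
  proof (intro conjI allI impI)
    show "is_ideal P" using w assms(2) by (simp add: ideal_colon)
    have "1 \<notin> P" using w(1,2) by (simp add: colon_def)
    then show "P \<noteq> UNIV" by blast
    fix a b assume ab: "a * b \<in> P"
    show "a \<in> P \<or> b \<in> P"
    proof (cases "a \<in> P")
      case False
      then have "w * a \<notin> I" by (simp add: w(1) colon_def)
      moreover have sub: "P \<subseteq> colon I (w * a)" using colon_mult[OF assms(2)] w(1) by blast
      ultimately have "colon I (w * a) \<in> Q" using w(3) by (auto simp: Q_def)
      then have "\<not> P \<subset> colon I (w * a)" using P(2) w(1) ideal_colon[OF assms(2)] by blast
      then have "colon I (w * a) = P" using sub by blast
      moreover have "b \<in> colon I (w * a)" using ab by (simp add: w(1) colon_def mult.assoc)
      ultimately show ?thesis by simp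
    qed simp
  qed
  then show ?thesis using w(1,3) by (auto simp: assoc_primes_def)
qed

text \<open>Noetherian induction. Fix one associated prime P = I : a. Another prime I : z is
  associated to I + (a) as well, unless some multiple of \<open>z\<close>, nonzero modulo
  \<open>I\<close>, is a multiple of \<open>a\<close>; then both primes are the annihilator of that
  element.\<close>

lemma assoc_primes_finite:
  fixes I :: "'a::comm_ring_1 set"
  assumes noeth: "noetherian TYPE('a)" and "is_ideal I"
  shows "finite (assoc_primes I)"
  using assms(2)
proof (induction I rule: wf_induct_rule[OF noeth[unfolded noetherian_def]])
  case (1 I)
  show ?case
  proof (cases "I = UNIV")
    case True
    then have "assoc_primes I = {}" by (auto simp: assoc_primes_def colon_def prime_ideal_def)
    then show ?thesis by simp
  next
    case False
    then obtain z where "z \<notin> I" by blast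
    then obtain P a where P: "prime_ideal P" "P = colon I a"
      using prime_colon_exists[OF noeth 1(2)] unfolding assoc_primes_def by blast
    have "a \<notin> I" using P 1(2) by (auto simp: prime_ideal_def colon_def ideal_mult_right)
    then have "I \<subset> adjoin I a" using adjoin_superset[of I a] adjoin_mem[OF 1(2)] by blast
    then have fin: "finite (assoc_primes (adjoin I a))"
      using 1 by (simp add: ideal_adjoin)
    have "assoc_primes I \<subseteq> insert P (assoc_primes (adjoin I a))"
    proof
      fix Q assume "Q \<in> assoc_primes I"
      then obtain z where Q: "prime_ideal Q" "Q = colon I z" by (auto simp: assoc_primes_def)
      show "Q \<in> insert P (assoc_primes (adjoin I a))"
      proof (cases "\<exists>b. z * b \<in> adjoin I a \<and> z * b \<notin> I")
        case True
        then obtain b c where b: "z * b \<notin> I" "z * b - c * a \<in> I" by (auto simp: adjoin_def)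
        have eq: "z * b * x \<in> I \<longleftrightarrow> c * a * x \<in> I" for x
          using ideal_cong[OF 1(2), of "z * b * x" "c * a * x"] ideal_mult_right[OF 1(2) b(2), of x]
          by (simp add: left_diff_distrib)
        have "c * a \<notin> I" using eq[of 1] b(1) by simp
        then have "c \<notin> P" "b \<notin> Q" using P(2) Q(2) b(1) by (auto simp: colon_def mult.commute)
        \<comment> \<open>A nonzero multiple of \<open>z\<close> modulo \<open>I\<close> has the
          same annihilator as \<open>z\<close>, because that annihilator is prime.\<close>
        have "Q = colon I (z * b)"
          using Q(1) \<open>b \<notin> Q\<close> ideal_mult[of Q _ b] unfolding prime_ideal_def
          by (auto simp: Q(2) colon_def mult.assoc)
        moreover have "P = colon I (c * a)"
          using P(1) \<open>c \<notin> P\<close> ideal_mult[of P _ c] unfolding prime_ideal_def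
          by (auto simp: P(2) colon_def mult.assoc mult.left_commute[of a])
        ultimately show ?thesis using eq by (auto simp: colon_def)
      next
        case False
        \<comment> \<open>No multiple of \<open>z\<close> outside \<open>I\<close> falls into I +
          (a), so enlarging \<open>I\<close> does not change the colon ideal.\<close>
        then have "Q = colon (adjoin I a) z"
          using adjoin_superset[of I a] by (auto simp: Q(2) colon_def)
        then show ?thesis using Q(1) by (auto simp: assoc_primes_def)
      qed
    qed
    then show ?thesis using fin finite_subset by blast
  qed
qed


section \<open>Depth and generic linear forms\<close>

lemma single_eq_var_times:
  assumes "Poly_Mapping.lookup m i > 0"
  shows "Poly_Mapping.single m (c :: 'k::comm_ring_1) = Poly_Mapping.single (m - Poly_Mapping.single i 1) c * mpoly_var i"
proof -
  have "m = (m - Poly_Mapping.single i 1) + Poly_Mapping.single i 1"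
    using assms by (intro poly_mapping_eqI) (auto simp: lookup_add lookup_minus lookup_single when_def)
  then show ?thesis by (simp add: mpoly_var_def mult_single)
qed

lemma mpoly_mem_if_monomials:
  fixes p :: "('v::finite, 'k::field) mpoly"
  assumes "is_ideal I" "\<And>m. m \<in> Poly_Mapping.keys p \<Longrightarrow> Poly_Mapping.single m 1 \<in> I"
  shows "p \<in> I"
proof -
  have "(\<Sum>m\<in>Poly_Mapping.keys p. mpoly_scale (coeff_at p m) (Poly_Mapping.single m 1)) \<in> I"
    using assms by (intro ideal_sum) (auto simp: mpoly_scale_def intro: ideal_mult)
  then show ?thesis using mpoly_sum_monomials[of p] by simp
qed

lemma pos_form_mem:
  fixes f :: "('v::finite, 'k::field) mpoly"
  assumes I: "is_ideal I" "\<And>i. mpoly_var i \<in> I" and f: "f \<in> forms (Suc a)"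
  shows "f \<in> I"
proof (rule mpoly_mem_if_monomials[OF I(1)])
  fix m assume "m \<in> Poly_Mapping.keys f"
  then have "monom_deg m \<noteq> 0" using f by (auto simp: forms_def)
  then obtain i where "Poly_Mapping.lookup m i > 0" by (auto simp: monom_deg_def)
  then show "Poly_Mapping.single m 1 \<in> I" by (simp add: single_eq_var_times ideal_mult[OF I(1) I(2)])
qed

definition pos_form :: "('v::finite, 'k::comm_ring_1) mpoly \<Rightarrow> bool"
  where "pos_form f \<longleftrightarrow> (\<exists>a. f \<in> forms (Suc a))"

lemma pos_form_linear: "f \<in> forms 1 \<Longrightarrow> pos_form f"
  by (auto simp: pos_form_def)

lemma homog_adjoin_pos: "homog I \<Longrightarrow> pos_form f \<Longrightarrow> homog (adjoin I f)"
  by (auto simp: pos_form_def intro: homog_adjoin)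

text \<open>In characteristic 0 this means that some linear form is a nonzerodivisor modulo
  \<open>I\<close>, by \<open>socle_free_if_nzd\<close> and
  \<open>linear_nzd_exists\<close>.\<close>

definition socle_free :: "('v::finite, 'k::field) mpoly set \<Rightarrow> bool"
  where "socle_free I \<longleftrightarrow> (\<forall>z. (\<forall>i. mpoly_var i * z \<in> I) \<longrightarrow> z \<in> I)"

lemma pos_form_times_mem:
  fixes f z :: "('v::finite, 'k::field) mpoly"
  assumes "is_ideal I" "\<And>i. mpoly_var i * z \<in> I" "pos_form f"
  shows "f * z \<in> I"
proof -
  obtain a where "f \<in> forms (Suc a)" using assms(3) unfolding pos_form_def by blast
  moreover have "mpoly_var i \<in> colon I z" for i
    using assms(2)[of i] by (simp add: colon_def mult.commute)
  ultimately have "f \<in> colon I z" using pos_form_mem[OF ideal_colon[OF assms(1)]] by blast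
  then show ?thesis by (simp add: colon_def mult.commute)
qed

lemma socle_free_if_nzd: "is_ideal I \<Longrightarrow> nzd I f \<Longrightarrow> pos_form f \<Longrightarrow> socle_free I"
  using pos_form_times_mem by (auto simp: socle_free_def nzd_def)

lemma scale_mem_ideal_iff:
  fixes w :: "('v, 'k::field) mpoly"
  assumes "is_ideal P" "c \<noteq> 0" shows "mpoly_scale c w \<in> P \<longleftrightarrow> w \<in> P"
proof
  assume "mpoly_scale c w \<in> P"
  then have "mpoly_scale (1 / c) (mpoly_scale c w) \<in> P"
    by (rule mpoly.subspace_scale[OF ideal_subspace[OF assms(1)]])
  then show "w \<in> P" using assms(2) by simp
qed (rule mpoly.subspace_scale[OF ideal_subspace[OF assms(1)]])

lemma forms_scale: "p \<in> forms j \<Longrightarrow> mpoly_scale c p \<in> forms j"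
  using forms_mult[OF forms_const, of p j c] by (simp add: mpoly_scale_def)

text \<open>On the line of forms u + c x, with a variable x outside the new ideal, each ideal
  excludes at most one scalar c, and the field is infinite.\<close>

lemma linear_form_avoidance:
  fixes Q :: "('v::finite, 'k::field_char_0) mpoly set set"
  assumes "finite Q" "\<And>P. P \<in> Q \<Longrightarrow> is_ideal P \<and> (\<exists>i. mpoly_var i \<notin> P)"
  shows "\<exists>u\<in>forms 1. \<forall>P\<in>Q. u \<notin> P"
  using assms
proof (induction Q rule: finite_induct)
  case empty
  show ?case by (rule bexI[of _ 0]) auto
next
  case (insert P Q)
  then obtain u where u: "u \<in> forms 1" "\<And>P'. P' \<in> Q \<Longrightarrow> u \<notin> P'" by auto
  obtain i where i: "mpoly_var i \<notin> P" "is_ideal P" using insert.prems by auto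
  let ?w = "mpoly_var i :: ('v, 'k) mpoly"
  define v where "v c = u + mpoly_scale c ?w" for c
  have diff: "v c - v c' = mpoly_scale (c - c') ?w" for c c'
    by (simp add: v_def mpoly.scale_left_diff_distrib)
  have "finite {c. v c \<in> P'}" if P': "P' \<in> insert P Q" for P'
  proof -
    have idl: "is_ideal P'" using insert.prems P' by auto
    have "c = c'" if c: "v c \<in> P'" "v c' \<in> P'" for c c'
    proof (rule ccontr)
      assume "c \<noteq> c'"
      moreover have "mpoly_scale (c - c') ?w \<in> P'" using ideal_diff[OF idl c] by (simp add: diff)
      ultimately have w: "?w \<in> P'" using scale_mem_ideal_iff[OF idl] by simp
      then have "P' \<in> Q" using P' i(1) by auto
      moreover have "mpoly_scale c ?w \<in> P'" using w mpoly.subspace_scale[OF ideal_subspace[OF idl]] by blast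
      then have "u \<in> P'" using c(1) ideal_diff[OF idl, of "v c" "mpoly_scale c ?w"] by (simp add: v_def)
      ultimately show False using u(2) by blast
    qed
    then have "{c. v c \<in> P'} \<subseteq> {SOME c. v c \<in> P'}" by (metis (mono_tags, lifting) mem_Collect_eq singletonI someI subsetI)
    then show ?thesis using finite_subset by blast
  qed
  then have "finite (\<Union>P'\<in>insert P Q. {c. v c \<in> P'})" using insert.hyps(1) by blast
  then have "(\<Union>P'\<in>insert P Q. {c. v c \<in> P'}) \<noteq> UNIV" using infinite_UNIV_char_0 by metis
  then obtain c where "\<And>P'. P' \<in> insert P Q \<Longrightarrow> v c \<notin> P'" by auto
  moreover have "v c \<in> forms 1" unfolding v_def using u(1) forms_var by (intro forms_add forms_scale)
  ultimately show ?case by blast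
qed

text \<open>Zero divisors modulo \<open>I\<close> lie in its finitely many associated primes, and an
  associated prime with all variables in it would be the annihilator of a socle element.\<close>

lemma linear_nzd_exists:
  fixes \<I> :: "('v::finite, 'k::field_char_0) mpoly set set"
  assumes "finite \<I>" "\<And>I. I \<in> \<I> \<Longrightarrow> is_ideal I \<and> socle_free I"
  shows "\<exists>u\<in>forms 1. \<forall>I\<in>\<I>. nzd I u"
proof -
  have "is_ideal P \<and> (\<exists>i. mpoly_var i \<notin> P)" if I: "I \<in> \<I>" and P: "P \<in> assoc_primes I" for I P
  proof -
    obtain z where z: "prime_ideal P" "P = colon I z" using P by (auto simp: assoc_primes_def)
    have "\<exists>i. mpoly_var i \<notin> P"
    proof (rule ccontr)
      assume "\<nexists>i. mpoly_var i \<notin> P"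
      then have "\<And>i. mpoly_var i * z \<in> I" by (auto simp: z(2) colon_def mult.commute)
      then have "z \<in> I" using assms(2)[OF I] by (auto simp: socle_free_def)
      then have "P = UNIV" using assms(2)[OF I] by (auto simp: z(2) colon_def ideal_mult_right)
      then show False using z(1) by (simp add: prime_ideal_def)
    qed
    then show ?thesis using z(1) by (simp add: prime_ideal_def)
  qed
  then have ass: "is_ideal P \<and> (\<exists>i. mpoly_var i \<notin> P)" if "P \<in> (\<Union>I\<in>\<I>. assoc_primes I)" for P
    using that by (metis UN_E)
  have "finite (assoc_primes I)" if "I \<in> \<I>" for I
    using assms(2)[OF that] assoc_primes_finite[OF mpoly_noetherian] by metis
  then have "finite (\<Union>I\<in>\<I>. assoc_primes I)" using assms(1) by (intro finite_UN_I)
  then have "\<exists>u\<in>forms 1. \<forall>P\<in>(\<Union>I\<in>\<I>. assoc_primes I). u \<notin> P"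
    by (rule linear_form_avoidance) (rule ass)
  then obtain u where u0: "u \<in> forms 1" "\<forall>P\<in>(\<Union>I\<in>\<I>. assoc_primes I). u \<notin> P" by (elim bexE)
  then have u: "u \<in> forms 1" "\<And>I P. I \<in> \<I> \<Longrightarrow> P \<in> assoc_primes I \<Longrightarrow> u \<notin> P" by auto
  have "nzd I u" if I: "I \<in> \<I>" for I
    unfolding nzd_def
  proof (intro allI impI)
    fix g assume g: "u * g \<in> I"
    show "g \<in> I"
    proof (rule ccontr)
      assume "g \<notin> I"
      then obtain P where "P \<in> assoc_primes I" "colon I g \<subseteq> P"
        using prime_colon_exists[OF mpoly_noetherian, of I g] assms(2)[OF I] by blast
      then show False using u(2)[OF I] g by (auto simp: colon_def mult.commute)
    qed
  qed
  then show ?thesis using u(1) by blast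
qed

lemma nzd_if_forms:
  assumes "homog I" "g \<in> forms b" "\<And>j z. z \<in> forms j \<Longrightarrow> g * z \<in> I \<Longrightarrow> z \<in> I"
  shows "nzd I g"
  unfolding nzd_def
proof (intro allI impI)
  fix z assume z: "g * z \<in> I"
  have "hom_comp j z \<in> I" for j
    using homog_comp[OF assms(1) z, of "j + b"] assms(3)[OF hom_comp_forms]
    by (simp add: hom_comp_form_mult[OF assms(2)])
  then show "z \<in> I" using homog_iff_forms[OF assms(1)] by blast
qed

text \<open>Graded Nakayama: the kernel of multiplication by \<open>g\<close> is divisible by \<open>f\<close>, hence zero.\<close>

lemma regular_swap:
  assumes I: "homog I" and f: "pos_form f" and g: "pos_form g" and reg: "regular I (f # g # fs)"
  shows "regular I (g # f # fs)"
proof -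
  have idl: "is_ideal I" using homog_ideal[OF I] .
  obtain a b where a: "f \<in> forms (Suc a)" and b: "g \<in> forms b" using f g by (auto simp: pos_form_def)
  have nf: "nzd I f" and ng: "nzd (adjoin I f) g" using reg by auto
  have "nzd I g"
  proof (rule nzd_if_forms[OF I b])
    fix j z assume "z \<in> forms j" "g * z \<in> I"
    then show "z \<in> I"
    proof (induction j arbitrary: z rule: less_induct)
      case (less j)
      then have "z \<in> adjoin I f" using ng adjoin_superset[of I f] by (auto simp: nzd_def)
      then obtain w where w: "w \<in> forms (j - Suc a)" "z - w * f \<in> I" "j < Suc a \<longrightarrow> w = 0"
        using adjoin_form[OF I a _ less.prems(1)] by blast
      have "g * z - f * (g * w) \<in> I" using ideal_mult[OF idl w(2), of g] by (simp add: algebra_simps)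
      then have "f * (g * w) \<in> I" using less.prems(2) ideal_cong[OF idl] by blast
      then have gw: "g * w \<in> I" using nf by (auto simp: nzd_def)
      have "w \<in> I"
      proof (cases "j < Suc a")
        case True then show ?thesis using w(3) ideal_0[OF idl] by simp
      next
        case False
        then have "j - Suc a < j" by simp
        then show ?thesis using less.IH[OF _ w(1) gw] by blast
      qed
      then show "z \<in> I" using w(2) ideal_cong[OF idl] ideal_mult_right[OF idl] by blast
    qed
  qed
  moreover have "nzd (adjoin I g) f"
    unfolding nzd_def
  proof (intro allI impI)
    fix x assume "f * x \<in> adjoin I g"
    then obtain c where c: "f * x - c * g \<in> I" by (auto simp: adjoin_def)
    then have "g * c - x * f \<in> I" using ideal_uminus[OF idl c] by (simp add: algebra_simps)
    then have "g * c \<in> adjoin I f" by (auto simp: adjoin_def)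
    then have "c \<in> adjoin I f" using ng by (auto simp: nzd_def)
    then obtain e where "c - e * f \<in> I" by (auto simp: adjoin_def)
    then have "(f * x - c * g) + (c - e * f) * g \<in> I" using ideal_add[OF idl c ideal_mult_right[OF idl]] by blast
    moreover have "(f * x - c * g) + (c - e * f) * g = f * (x - e * g)" by (simp add: algebra_simps)
    ultimately have "x - e * g \<in> I" using nf by (auto simp: nzd_def)
    then show "x \<in> adjoin I g" by (auto simp: adjoin_def)
  qed
  ultimately show ?thesis using reg by (simp add: adjoin_commute[OF idl])
qed

lemma regular_rotate:
  assumes "homog I" "pos_form u" "\<And>f. f \<in> set fs \<Longrightarrow> pos_form f"
  shows "regular I (u # fs) \<longleftrightarrow> regular I (fs @ [u])"
  using assms(1,3)
proof (induction fs arbitrary: I)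
  case (Cons f fs)
  have f: "pos_form f" using Cons.prems(2) by simp
  have "regular I (u # f # fs) \<longleftrightarrow> regular I (f # u # fs)"
    using regular_swap[OF Cons.prems(1) assms(2) f, of fs] regular_swap[OF Cons.prems(1) f assms(2), of fs]
    by (rule iffI)
  also have "\<dots> \<longleftrightarrow> regular I (f # (fs @ [u]))"
    using Cons.IH[OF homog_adjoin_pos[OF Cons.prems(1) f]] Cons.prems(2) by simp
  finally show ?case by simp
qed simp

section \<open>Depth under cutting by generic linear forms\<close>

definition depth_ge :: "('v::finite, 'k::field) mpoly set \<Rightarrow> nat \<Rightarrow> bool"
  where "depth_ge I p \<longleftrightarrow> (\<exists>fs. length fs = p \<and> (\<forall>f\<in>set fs. pos_form f) \<and> regular I fs)"

lemma depth_ge_0 [simp]: "depth_ge I 0"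
  by (simp add: depth_ge_def)

lemma depth_ge_Suc_adjoin:
  "nzd I u \<Longrightarrow> pos_form u \<Longrightarrow> depth_ge (adjoin I u) p \<Longrightarrow> depth_ge I (Suc p)"
  unfolding depth_ge_def by (elim exE, rule exI[of _ "u # _"]) auto

text \<open>\<open>J\<close> is the ideal reached before the last form of a regular sequence. A
  linear form regular on \<open>J\<close> may replace that last form and then move to the front. So
  the condition on \<open>u\<close> is regularity on one fixed ideal, and such conditions for
  several ideals can be combined.\<close>

lemma depth_ge_socle:
  assumes I: "homog I" and d: "depth_ge I (Suc p)"
  obtains J where "is_ideal J" "socle_free J"
    "\<And>u. u \<in> forms 1 \<Longrightarrow> nzd J u \<Longrightarrow> nzd I u \<and> depth_ge (adjoin I u) p"
proof -
  obtain fs where fs: "length fs = Suc p" "\<forall>f\<in>set fs. pos_form f" "regular I fs"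
    using d by (auto simp: depth_ge_def)
  obtain gs f where gs: "fs = gs @ [f]" using fs(1) by (metis append_butlast_last_id list.size(3) nat.distinct(1))
  define J where "J = adjoin_list I gs"
  have J: "is_ideal J" using homog_ideal[OF I] by (simp add: J_def ideal_adjoin_list)
  have "nzd J f" "pos_form f" using fs gs by (auto simp: J_def regular_append)
  then have "socle_free J" by (rule socle_free_if_nzd[OF J])
  moreover have "nzd I u \<and> depth_ge (adjoin I u) p" if u: "u \<in> forms 1" "nzd J u" for u
  proof -
    have "regular I (gs @ [u])" using fs(3) gs u(2) by (simp add: regular_append J_def)
    then have "regular I (u # gs)"
      using regular_rotate[OF I pos_form_linear[OF u(1)], of gs] fs(2) gs by auto
    moreover have "length gs = p" "\<forall>f\<in>set gs. pos_form f" using fs gs by auto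
    ultimately show ?thesis by (auto simp: depth_ge_def)
  qed
  ultimately show thesis using that J by blast
qed

text \<open>The number in a pair is the depth that has to survive the cut; one linear form serves
  all pairs.\<close>

lemma generic_linear_form:
  fixes \<D> :: "(('v::finite, 'k::field_char_0) mpoly set \<times> nat) set"
  assumes "finite \<D>" "\<And>I q. (I, q) \<in> \<D> \<Longrightarrow> homog I \<and> depth_ge I (Suc q)"
  shows "\<exists>u\<in>forms 1. \<forall>(I, q)\<in>\<D>. nzd I u \<and> depth_ge (adjoin I u) q"
proof -
  have "\<forall>D\<in>\<D>. \<exists>J. is_ideal J \<and> socle_free J \<and>
      (\<forall>u\<in>forms 1. nzd J u \<longrightarrow> nzd (fst D) u \<and> depth_ge (adjoin (fst D) u) (snd D))"
    using assms(2) by (metis depth_ge_socle prod.collapse)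
  then obtain J where J: "\<And>D. D \<in> \<D> \<Longrightarrow> is_ideal (J D) \<and> socle_free (J D)"
      "\<And>D u. D \<in> \<D> \<Longrightarrow> u \<in> forms 1 \<Longrightarrow> nzd (J D) u \<Longrightarrow> nzd (fst D) u \<and> depth_ge (adjoin (fst D) u) (snd D)"
    by metis
  have "is_ideal I \<and> socle_free I" if "I \<in> J ` \<D>" for I using that J(1) by blast
  then obtain u where u: "u \<in> forms 1" "\<And>D. D \<in> \<D> \<Longrightarrow> nzd (J D) u"
    using linear_nzd_exists[OF finite_imageI[OF assms(1)], of J] by blast
  then have "nzd (fst D) u \<and> depth_ge (adjoin (fst D) u) (snd D)" if "D \<in> \<D>" for D
    using J(2)[OF that u(1)] that by blast
  then show ?thesis using u(1) by fastforce
qed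

lemma generic_linear_forms:
  fixes \<D> :: "(('v::finite, 'k::field_char_0) mpoly set \<times> nat) set"
  assumes "finite \<D>" "\<And>I q. (I, q) \<in> \<D> \<Longrightarrow> homog I \<and> depth_ge I (p + q)"
  shows "\<exists>us. length us = p \<and> set us \<subseteq> forms 1 \<and>
    (\<forall>(I, q)\<in>\<D>. regular I us \<and> depth_ge (adjoin_list I us) q)"
  using assms
proof (induction p arbitrary: \<D>)
  case 0 then show ?case by auto
next
  case (Suc p)
  let ?D1 = "(\<lambda>(I, q). (I, p + q)) ` \<D>" and ?D2 = "\<lambda>u. (\<lambda>(I, q). (adjoin I u, q)) ` \<D>"
  have "finite ?D1" using Suc.prems(1) by simp
  moreover have "homog I \<and> depth_ge I (Suc q)" if "(I, q) \<in> ?D1" for I q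
    using that Suc.prems(2) by auto
  ultimately obtain u where u: "u \<in> forms 1" "\<forall>(I, q)\<in>?D1. nzd I u \<and> depth_ge (adjoin I u) q"
    using generic_linear_form[of ?D1] by blast
  have "finite (?D2 u)" using Suc.prems(1) by simp
  moreover have "homog I \<and> depth_ge I (p + q)" if "(I, q) \<in> ?D2 u" for I q
    using that u Suc.prems(2) homog_adjoin[OF _ u(1)] by auto
  ultimately obtain us where us: "length us = p" "set us \<subseteq> forms 1"
    "\<forall>(I, q)\<in>?D2 u. regular I us \<and> depth_ge (adjoin_list I us) q"
    using Suc.IH[of "?D2 u"] by blast
  show ?case using u us by (intro exI[of _ "u # us"]) auto
qed

text \<open>The sequence that witnesses the depth need not contain \<open>g\<close>. A linear form
  \<open>u\<close> regular on \<open>I\<close> and on I + (g) can be swapped with \<open>g\<close>,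
  which reduces the claim to I + (u). Such a \<open>u\<close> exists once I + (g) has no
  socle.\<close>

lemma depth_ge_adjoin:
  fixes I :: "('v::finite, 'k::field_char_0) mpoly set"
  assumes "homog I" "depth_ge I (Suc p)" "pos_form g" "nzd I g"
  shows "depth_ge (adjoin I g) p"
  using assms(1,2,4)
proof (induction p arbitrary: I)
  case (Suc p)
  have idl: "is_ideal I" using homog_ideal Suc.prems(1) by blast
  obtain fs where fs: "length fs = Suc (Suc p)" "\<forall>f\<in>set fs. pos_form f" "regular I fs"
    using Suc.prems(2) by (auto simp: depth_ge_def)
  then obtain f f' rest where fs_eq: "fs = f # f' # rest" by (metis length_Suc_conv)
  then have reg: "nzd I f" "nzd (adjoin I f) f'" "pos_form f" "pos_form f'" using fs by auto
  \<comment> \<open>All modulo \<open>I\<close>: if \<open>f * z = a * g\<close> and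
    \<open>f' * z = b * g\<close>, then \<open>f' * a = b * f\<close> because \<open>g\<close> is
    regular, so \<open>f\<close> divides \<open>a\<close>, and cancelling \<open>f\<close> makes
    \<open>z\<close> a multiple of \<open>g\<close>.\<close>
  have "socle_free (adjoin I g)"
    unfolding socle_free_def
  proof (intro allI impI)
    fix z assume "\<forall>i. mpoly_var i * z \<in> adjoin I g"
    then have "f * z \<in> adjoin I g" "f' * z \<in> adjoin I g"
      using pos_form_times_mem[OF ideal_adjoin[OF idl]] reg(3,4) by blast+
    then obtain a b where ab: "f * z - a * g \<in> I" "f' * z - b * g \<in> I" by (auto simp: adjoin_def)
    have "f * (f' * z - b * g) - f' * (f * z - a * g) \<in> I"
      using ideal_diff[OF idl ideal_mult[OF idl ab(2)] ideal_mult[OF idl ab(1)]] .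
    moreover have "f * (f' * z - b * g) - f' * (f * z - a * g) = g * (f' * a - b * f)"
      by (simp add: algebra_simps)
    ultimately have "f' * a - b * f \<in> I" using Suc.prems(3) by (auto simp: nzd_def)
    then have "f' * a \<in> adjoin I f" by (auto simp: adjoin_def)
    then have "a \<in> adjoin I f" using reg(2) by (auto simp: nzd_def)
    then obtain c where c: "a - c * f \<in> I" by (auto simp: adjoin_def)
    have "(f * z - a * g) + g * (a - c * f) \<in> I" using ideal_add[OF idl ab(1) ideal_mult[OF idl c]] .
    moreover have "(f * z - a * g) + g * (a - c * f) = f * (z - c * g)" by (simp add: algebra_simps)
    ultimately have "z - c * g \<in> I" using reg(1) by (auto simp: nzd_def)
    then show "z \<in> adjoin I g" by (auto simp: adjoin_def)
  qed
  obtain J where J: "is_ideal J" "socle_free J"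
    "\<And>u. u \<in> forms 1 \<Longrightarrow> nzd J u \<Longrightarrow> nzd I u \<and> depth_ge (adjoin I u) (Suc p)"
    using depth_ge_socle[OF Suc.prems(1,2)] by blast
  obtain u where u: "u \<in> forms 1" "nzd (adjoin I g) u" "nzd J u"
    using linear_nzd_exists[of "{adjoin I g, J}"] J(1,2) \<open>socle_free (adjoin I g)\<close> ideal_adjoin[OF idl, of g] by auto
  have Iu: "nzd I u" "depth_ge (adjoin I u) (Suc p)" using J(3)[OF u(1,3)] by auto
  have "regular I [g, u]" using Suc.prems(3) u(2) by simp
  then have "regular I [u, g]"
    by (rule regular_swap[OF Suc.prems(1) assms(3) pos_form_linear[OF u(1)]])
  then have "depth_ge (adjoin (adjoin I u) g) p"
    using Suc.IH[of "adjoin I u"] Iu homog_adjoin[OF Suc.prems(1) u(1)] by simp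
  then show ?case
    using depth_ge_Suc_adjoin[OF u(2) pos_form_linear[OF u(1)]] by (simp add: adjoin_commute[OF idl])
qed simp

text \<open>A form of \<open>I\<close> is \<open>w * u\<close> modulo \<open>J\<close>; regularity
  puts \<open>w\<close> into \<open>I\<close> again, in lower degree, so induction on the degree
  applies.\<close>

lemma nakayama_adjoin:
  assumes I: "homog I" and J: "homog J" and "J \<subseteq> I" and u: "pos_form u" "nzd I u"
    and sub: "I \<subseteq> adjoin J u"
  shows "I = J"
proof
  obtain a where a: "u \<in> forms (Suc a)" using u(1) by (auto simp: pos_form_def)
  note iI = homog_ideal[OF I] and iJ = homog_ideal[OF J]
  show "I \<subseteq> J"
  proof (rule homog_subset[OF I iJ])
    fix j p assume "p \<in> I" "p \<in> forms j"
    then show "p \<in> J"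
    proof (induction j arbitrary: p rule: less_induct)
      case (less j)
      obtain w where w: "w \<in> forms (j - Suc a)" "p - w * u \<in> J" "j < Suc a \<longrightarrow> w = 0"
        using adjoin_form[OF J a _ less.prems(2)] less.prems(1) sub by blast
      then have "w * u \<in> I" using less.prems(1) \<open>J \<subseteq> I\<close> ideal_cong[OF iI] by blast
      then have wI: "w \<in> I" using u(2) by (auto simp: nzd_def mult.commute)
      have "w \<in> J"
      proof (cases "j < Suc a")
        case True then show ?thesis using w(3) ideal_0[OF iJ] by simp
      next
        case False then show ?thesis using less.IH[OF _ wI w(1)] by simp
      qed
      then show "p \<in> J" using w(2) ideal_cong[OF iJ] ideal_mult_right[OF iJ] by blast
    qed
  qed
qed (rule \<open>J \<subseteq> I\<close>)

lemma nakayama_adjoin_list: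
  assumes "homog I" "homog J" "J \<subseteq> I" "\<And>u. u \<in> set us \<Longrightarrow> pos_form u" "regular I us"
    "adjoin_list I us = adjoin_list J us"
  shows "I = J"
  using assms
proof (induction us arbitrary: I J)
  case (Cons u us)
  have u: "pos_form u" "nzd I u" using Cons.prems by auto
  have "adjoin I u = adjoin J u"
  proof (rule Cons.IH)
    show "homog (adjoin I u)" "homog (adjoin J u)"
      using homog_adjoin_pos u(1) Cons.prems(1,2) by blast+
    show "adjoin J u \<subseteq> adjoin I u" by (rule adjoin_mono[OF Cons.prems(3)])
  qed (use Cons.prems in auto)
  then have "I \<subseteq> adjoin J u" using adjoin_superset[of I u] by simp
  then show ?case by (rule nakayama_adjoin[OF Cons.prems(1-3) u])
qed simp

lemma hilbert_series_adjoin_list: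
  assumes "homog I" "set us \<subseteq> forms 1" "regular I us"
  shows "hilbert_series (adjoin_list I us) = (1 - fps_X) ^ length us * hilbert_series I"
  using assms
proof (induction us arbitrary: I)
  case (Cons u us)
  have u: "u \<in> forms 1" "nzd I u" using Cons.prems by auto
  have "hilbert_series (adjoin_list (adjoin I u) us) = (1 - fps_X) ^ length us * hilbert_series (adjoin I u)"
    using Cons.prems homog_adjoin[OF Cons.prems(1) u(1)] by (intro Cons.IH) auto
  then show ?case
    using hilbert_series_adjoin_nzd[OF Cons.prems(1) u] by (simp add: mult_ac)
qed simp


section \<open>The polynomial ring\<close>

text \<open>The ideal generated by the variables in \<open>S\<close>, described through monomials so
  that regularity of a further variable can be read off the exponents.\<close>

definition var_ideal :: "'v set \<Rightarrow> ('v::finite, 'k::field) mpoly set"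
  where "var_ideal S = {p. \<forall>m\<in>Poly_Mapping.keys p. \<exists>i\<in>S. Poly_Mapping.lookup m i > 0}"

lemma ideal_var_ideal: "is_ideal (var_ideal S)"
  unfolding is_ideal_iff
proof (intro conjI ballI allI)
  fix x y :: "('a, 'b) mpoly" assume "x \<in> var_ideal S" "y \<in> var_ideal S"
  then show "x + y \<in> var_ideal S" using keys_add[of x y] unfolding var_ideal_def by blast
next
  fix a x :: "('a, 'b) mpoly" assume x: "x \<in> var_ideal S"
  show "a * x \<in> var_ideal S"
    unfolding var_ideal_def
  proof (clarify)
    fix m assume "m \<in> Poly_Mapping.keys (a * x)"
    then obtain b c where "m = b + c" "c \<in> Poly_Mapping.keys x" using keys_mult[of a x] by blast
    moreover from this obtain i where "i \<in> S" "Poly_Mapping.lookup c i > 0" using x by (auto simp: var_ideal_def)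
    ultimately show "\<exists>i\<in>S. Poly_Mapping.lookup m i > 0" by (auto simp: lookup_add)
  qed
qed (simp add: var_ideal_def)

lemma adjoin_var_ideal: "adjoin (var_ideal S) (mpoly_var i) = var_ideal (insert i S)"
proof
  show "adjoin (var_ideal S) (mpoly_var i) \<subseteq> (var_ideal (insert i S) :: ('a, 'b) mpoly set)"
    by (rule adjoin_minimal[OF _ _ ideal_var_ideal]) (auto simp: var_ideal_def mpoly_var_def)
  show "(var_ideal (insert i S) :: ('a, 'b) mpoly set) \<subseteq> adjoin (var_ideal S) (mpoly_var i)"
  proof
    fix p :: "('a, 'b) mpoly" assume p: "p \<in> var_ideal (insert i S)"
    show "p \<in> adjoin (var_ideal S) (mpoly_var i)"
    proof (rule mpoly_mem_if_monomials[OF ideal_adjoin[OF ideal_var_ideal]])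
      fix m assume "m \<in> Poly_Mapping.keys p"
      then obtain j where j: "j \<in> insert i S" "Poly_Mapping.lookup m j > 0" using p by (auto simp: var_ideal_def)
      show "Poly_Mapping.single m 1 \<in> adjoin (var_ideal S) (mpoly_var i)"
      proof (cases "j = i")
        case True
        then show ?thesis
          using j(2) by (simp add: single_eq_var_times ideal_mult ideal_adjoin ideal_var_ideal adjoin_mem)
      next
        case False
        then have "Poly_Mapping.single m 1 \<in> var_ideal S" using j by (auto simp: var_ideal_def)
        then show ?thesis using adjoin_superset by blast
      qed
    qed
  qed
qed

lemma nzd_var_ideal: assumes "i \<notin> S" shows "nzd (var_ideal S) (mpoly_var i)"
  unfolding nzd_def
proof (intro allI impI)
  fix p assume p: "mpoly_var i * p \<in> var_ideal S"
  show "p \<in> var_ideal S"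
    unfolding var_ideal_def
  proof (clarify)
    fix m assume "m \<in> Poly_Mapping.keys p"
    then have "Poly_Mapping.single i 1 + m \<in> Poly_Mapping.keys (mpoly_var i * p)"
      by (simp add: mpoly_var_def in_keys_iff coeff_single_times)
    then obtain j where "j \<in> S" "Poly_Mapping.lookup (Poly_Mapping.single i 1 + m) j > 0"
      using p by (auto simp: var_ideal_def)
    moreover from this have "j \<noteq> i" using assms by blast
    ultimately show "\<exists>j\<in>S. Poly_Mapping.lookup m j > 0" by (auto simp: lookup_add lookup_single)
  qed
qed

lemma var_ideal_empty: "var_ideal {} = {0}"
  by (auto simp: var_ideal_def keys_eq_empty)

lemma regular_vars:
  "distinct xs \<Longrightarrow> set xs \<inter> S = {} \<Longrightarrow>
    regular (var_ideal S) (map mpoly_var xs) \<and> adjoin_list (var_ideal S) (map mpoly_var xs) = var_ideal (S \<union> set xs)"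
  by (induction xs arbitrary: S) (auto simp: nzd_var_ideal adjoin_var_ideal)

lemma hilbert_series_var_ideal_UNIV: "hilbert_series (var_ideal (UNIV :: 'v::finite set) :: ('v, 'k::field) mpoly set) = 1"
proof (rule fps_ext)
  fix n
  let ?I = "var_ideal (UNIV :: 'v set) :: ('v, 'k) mpoly set"
  show "fps_nth (hilbert_series ?I) n = fps_nth 1 n"
  proof (cases n)
    case 0
    have "forms 0 \<inter> ?I \<subseteq> {0}"
    proof
      fix p assume p: "p \<in> forms 0 \<inter> ?I"
      have "m \<notin> Poly_Mapping.keys p" for m
        using p by (auto simp: forms_def var_ideal_def monom_deg_eq_0) fastforce
      then show "p \<in> {0}" by (metis equals0I keys_eq_empty singletonI)
    qed
    then have "mpoly.dim (forms 0 \<inter> ?I) \<le> card ({} :: ('v, 'k) mpoly set)"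
      by (intro mpoly.dim_le_card) auto
    then have "form_dim 0 ?I = 0" by (simp add: form_dim_def)
    moreover have "mpoly.dim (forms 0 :: ('v, 'k) mpoly set) = 1"
    proof (rule mpoly.dim_unique[of "{1}"])
      show "(forms 0 :: ('v, 'k) mpoly set) \<subseteq> mpoly.span {1}"
      proof
        fix p :: "('v, 'k) mpoly" assume "p \<in> forms 0"
        then have "p = mpoly_scale (coeff_at p 0) 1"
          using forms_zero_const by (simp add: mpoly_scale_def)
        then show "p \<in> mpoly.span {1}" by (metis mpoly.span_base mpoly.span_scale singletonI)
      qed
    qed auto
    ultimately show ?thesis using 0 by (simp add: hilbert_fun_dim form_dim_def)
  next
    case (Suc j)
    have "mpoly_var i \<in> ?I" for i
      by (auto simp: var_ideal_def mpoly_var_def intro!: exI[of _ i])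
    then have "forms n \<subseteq> ?I" using pos_form_mem[OF ideal_var_ideal] Suc by blast
    then show ?thesis using Suc hilbert_fun_eq_0[of ?I n] ideal_var_ideal by auto
  qed
qed

text \<open>The variables form a regular sequence whose quotient is the field, with Hilbert series
  1.\<close>

lemma depth_ge_zero: "depth_ge ({0} :: ('v::finite, 'k::field) mpoly set) CARD('v)"
  and hilbert_series_zero: "(1 - fps_X) ^ CARD('v) * hilbert_series ({0} :: ('v::finite, 'k::field) mpoly set) = 1"
proof -
  obtain xs where xs: "set xs = (UNIV :: 'v set)" "distinct xs" using finite_distinct_list[OF finite[of "UNIV :: 'v set"]] by (elim exE conjE)
  then have len: "length (map mpoly_var xs) = CARD('v)" by (metis distinct_card length_map)
  let ?fs = "map mpoly_var xs :: ('v, 'k) mpoly list"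
  have reg: "regular {0} ?fs" "adjoin_list {0} ?fs = var_ideal UNIV"
    using regular_vars[OF xs(2), of "{}"] xs(1) by (auto simp: var_ideal_empty)
  have lin: "set ?fs \<subseteq> forms 1" using forms_var by auto
  have "\<forall>f\<in>set ?fs. pos_form f" using lin pos_form_linear by blast
  then show "depth_ge ({0} :: ('v, 'k) mpoly set) CARD('v)"
    using reg(1) len unfolding depth_ge_def by (intro exI[of _ ?fs]) simp
  show "(1 - fps_X) ^ CARD('v) * hilbert_series ({0} :: ('v, 'k) mpoly set) = 1"
    using hilbert_series_adjoin_list[OF homog_zero lin reg(1)] len
    by (simp add: reg(2) hilbert_series_var_ideal_UNIV)
qed


section \<open>Unique factorization\<close>

definition poly_in :: "'v set \<Rightarrow> ('v, 'k::zero) mpoly set"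
  where "poly_in S = {p. \<forall>m\<in>Poly_Mapping.keys p. \<forall>i. Poly_Mapping.lookup m i > 0 \<longrightarrow> i \<in> S}"

lemma poly_in_0 [simp]: "0 \<in> poly_in S"
  and poly_in_1 [simp]: "(1 :: ('v, 'k::field) mpoly) \<in> poly_in S"
  by (simp_all add: poly_in_def)

lemma poly_in_add: "p \<in> poly_in S \<Longrightarrow> q \<in> poly_in S \<Longrightarrow> p + q \<in> poly_in S"
  using keys_add[of p q] unfolding poly_in_def by blast

lemma poly_in_uminus: "p \<in> poly_in S \<Longrightarrow> - p \<in> poly_in S"
  for p :: "('v, 'k::field) mpoly"
  by (simp add: poly_in_def in_keys_iff)

lemma poly_in_diff: "p \<in> poly_in S \<Longrightarrow> q \<in> poly_in S \<Longrightarrow> p - q \<in> poly_in S"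
  for p :: "('v, 'k::field) mpoly"
  using poly_in_add[of p S "- q"] poly_in_uminus[of q S] by simp

lemma poly_in_mult:
  fixes p q :: "('v, 'k::field) mpoly"
  assumes "p \<in> poly_in S" "q \<in> poly_in S" shows "p * q \<in> poly_in S"
  unfolding poly_in_def
proof (clarify)
  fix m i assume "m \<in> Poly_Mapping.keys (p * q)" and i: "Poly_Mapping.lookup m i > 0"
  then obtain a b where "m = a + b" "a \<in> Poly_Mapping.keys p" "b \<in> Poly_Mapping.keys q"
    using keys_mult[of p q] by blast
  then show "i \<in> S" using assms i unfolding poly_in_def by (auto simp: lookup_add)
qed

lemma poly_in_sum: "(\<And>a. a \<in> A \<Longrightarrow> f a \<in> poly_in S) \<Longrightarrow> sum f A \<in> poly_in S"
  by (induction A rule: infinite_finite_induct) (auto simp: poly_in_add)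

lemma poly_in_mono: "S \<subseteq> S' \<Longrightarrow> poly_in S \<subseteq> poly_in S'"
  unfolding poly_in_def by blast

lemma poly_in_UNIV: "poly_in UNIV = UNIV" by (simp add: poly_in_def)

lemma var_power: "mpoly_var x ^ n = Poly_Mapping.single (Poly_Mapping.single x n) (1 :: 'k::field)"
  by (induction n) (simp_all add: mpoly_var_def mult_single flip: single_add)

lemma poly_in_var: "mpoly_var x ^ n \<in> (poly_in (insert x S) :: ('v, 'k::field) mpoly set)"
  by (auto simp: var_power poly_in_def lookup_single when_def split: if_splits)

lemma poly_eval_in:
  fixes P :: "('v, 'k::field) mpoly poly"
  assumes "\<And>j. coeff P j \<in> poly_in S" shows "poly P (mpoly_var x) \<in> poly_in (insert x S)"
  unfolding poly_altdef
  using assms poly_in_mono[of S "insert x S"] by (intro poly_in_sum poly_in_mult poly_in_var) blast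

text \<open>Univariate polynomials with coefficients restricted to \<open>poly_in S\<close> stand
  for the polynomial ring in one more variable, so degree arguments become available without a
  change of the ring.\<close>

lemma poly_rep_exists:
  fixes p :: "('v, 'k::field) mpoly"
  assumes "p \<in> poly_in (insert x S)" "x \<notin> S"
  shows "\<exists>P. (\<forall>j. coeff P j \<in> poly_in S) \<and> poly P (mpoly_var x) = p"
proof -
  have "\<exists>P. (\<forall>j. coeff P j \<in> poly_in S) \<and>
      poly P (mpoly_var x) = (\<Sum>m\<in>M. mpoly_scale (coeff_at p m) (Poly_Mapping.single m 1))"
    if "finite M" "M \<subseteq> Poly_Mapping.keys p" for M
    using that
  proof (induction M rule: finite_induct)
    case empty show ?case by (intro exI[of _ 0]) simp
  next
    case (insert m M)
    then obtain P where P: "\<And>j. coeff P j \<in> poly_in S"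
      "poly P (mpoly_var x) = (\<Sum>m\<in>M. mpoly_scale (coeff_at p m) (Poly_Mapping.single m 1))" by auto
    define k where "k = Poly_Mapping.lookup m x"
    define m' where "m' = m - Poly_Mapping.single x k"
    define c where "c = mpoly_scale (coeff_at p m) (Poly_Mapping.single m' 1)"
    have m: "m = m' + Poly_Mapping.single x k"
      by (intro poly_mapping_eqI) (auto simp: m'_def k_def lookup_add lookup_minus lookup_single when_def)
    have "i \<in> S" if "Poly_Mapping.lookup m' i > 0" for i
    proof -
      have "i \<noteq> x" using that by (auto simp: m'_def k_def lookup_minus)
      moreover have "Poly_Mapping.lookup m i > 0" using that by (simp add: m'_def lookup_minus)
      ultimately show ?thesis using insert.prems assms(1) by (auto simp: poly_in_def)
    qed
    then have "c \<in> poly_in S"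
      by (auto simp: c_def mpoly_scale_def mult_single poly_in_def split: if_splits)
    moreover have "c * mpoly_var x ^ k = mpoly_scale (coeff_at p m) (Poly_Mapping.single m 1)"
      by (simp add: c_def var_power mpoly_scale_def mult_single m[symmetric])
    ultimately show ?case
      using P insert.hyps
      by (intro exI[of _ "P + monom c k"]) (auto simp: poly_monom poly_in_add add.commute)
  qed
  from this[of "Poly_Mapping.keys p"] show ?thesis using mpoly_sum_monomials[of p] by simp
qed

text \<open>No monomial of a coefficient contains \<open>x\<close>, so different powers of
  \<open>x\<close> cannot cancel.\<close>

lemma poly_rep_zero:
  fixes P :: "('v, 'k::field) mpoly poly"
  assumes P: "\<And>j. coeff P j \<in> poly_in S" and x: "x \<notin> S" and eval: "poly P (mpoly_var x) = 0"
  shows "P = 0"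
proof (rule poly_eqI)
  fix k
  have key: "coeff_at (coeff P k) m = 0" if m: "Poly_Mapping.lookup m x = 0" for m
  proof (cases "k \<le> degree P")
    case False then show ?thesis by (simp add: coeff_eq_0)
  next
    case True
    let ?m = "Poly_Mapping.single x k + m"
    have "coeff_at (coeff P i * mpoly_var x ^ i) ?m = (if i = k then coeff_at (coeff P k) m else 0)" for i
    proof (cases "i = k")
      case True then show ?thesis by (simp add: var_power mult.commute[of "coeff P k"] coeff_single_times)
    next
      case False
      have "?m \<notin> Poly_Mapping.keys (coeff P i * mpoly_var x ^ i)"
      proof
        assume "?m \<in> Poly_Mapping.keys (coeff P i * mpoly_var x ^ i)"
        then obtain b where b: "?m = b + Poly_Mapping.single x i" "b \<in> Poly_Mapping.keys (coeff P i)"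
          using keys_mult[of "coeff P i" "mpoly_var x ^ i"] by (auto simp: var_power)
        then have "Poly_Mapping.lookup b x = 0" using P[of i] x by (auto simp: poly_in_def)
        then show False using arg_cong[OF b(1), of "\<lambda>m. Poly_Mapping.lookup m x"] m False by (simp add: lookup_add)
      qed
      then show ?thesis using False by (simp add: in_keys_iff)
    qed
    then have "coeff_at (poly P (mpoly_var x)) ?m = coeff_at (coeff P k) m"
      using True by (simp add: poly_altdef lookup_sum)
    then show ?thesis using eval by simp
  qed
  have "coeff P k = 0"
  proof (rule poly_mapping_eqI)
    fix m
    show "coeff_at (coeff P k) m = coeff_at 0 m"
    proof (cases "Poly_Mapping.lookup m x = 0")
      case False
      then have "m \<notin> Poly_Mapping.keys (coeff P k)" using P[of k] x by (auto simp: poly_in_def)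
      then show ?thesis by (simp add: in_keys_iff)
    qed (use key in simp)
  qed
  then show "coeff P k = coeff 0 k" by simp
qed

lemma poly_rep_unique:
  fixes P Q :: "('v, 'k::field) mpoly poly"
  assumes "\<And>j. coeff P j \<in> poly_in S" "\<And>j. coeff Q j \<in> poly_in S" "x \<notin> S"
    "poly P (mpoly_var x) = poly Q (mpoly_var x)"
  shows "P = Q"
  using poly_rep_zero[of "P - Q" S x] assms by (simp add: poly_in_diff)

lemma poly_in_coeff_mult:
  fixes P Q :: "('v, 'k::field) mpoly poly"
  assumes "\<And>j. coeff P j \<in> poly_in S" "\<And>j. coeff Q j \<in> poly_in S"
  shows "coeff (P * Q) j \<in> poly_in S"
  unfolding coeff_mult by (intro poly_in_sum poly_in_mult assms)

text \<open>Degrees in a variable outside \<open>S\<close> add up in a product, so a factor of a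
  nonzero polynomial without that variable does not contain it either.\<close>

lemma poly_in_factor:
  fixes a b :: "('v::finite, 'k::field) mpoly"
  assumes ab: "a * b \<in> poly_in S" "a \<noteq> 0" "b \<noteq> 0"
  shows "a \<in> poly_in S"
proof -
  have "a \<in> poly_in (UNIV - {x})" if x: "x \<notin> S" for x
  proof -
    let ?S = "UNIV - {x} :: 'v set"
    have "insert x ?S = UNIV" by auto
    then obtain P Q where P: "\<And>j. coeff P j \<in> poly_in ?S" "poly P (mpoly_var x) = a"
      and Q: "\<And>j. coeff Q j \<in> poly_in ?S" "poly Q (mpoly_var x) = b"
      using poly_rep_exists[of a x ?S] poly_rep_exists[of b x ?S] by (auto simp: poly_in_UNIV)
    have "a * b \<in> poly_in ?S" using ab(1) x poly_in_mono[of S ?S] by blast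
    then have "coeff [:a * b:] j \<in> poly_in ?S" for j by (cases j) auto
    then have "P * Q = [:a * b:]"
      using P Q by (intro poly_rep_unique[of _ ?S _ x] poly_in_coeff_mult) auto
    moreover have "P \<noteq> 0" "Q \<noteq> 0" using P(2) Q(2) ab by auto
    then have "coeff (P * Q) (degree P + degree Q) \<noteq> 0" by (simp add: coeff_mult_degree_sum)
    ultimately have "degree P = 0" by (cases "degree P + degree Q") auto
    then obtain c where "P = [:c:]" by (rule degree_eq_zeroE)
    then show ?thesis using P(1)[of 0] P(2) by simp
  qed
  then show ?thesis unfolding poly_in_def by blast
qed

text \<open>An additive size of nonzero elements that vanishes exactly on the units; the inductions
  over factorizations run on it.\<close>

definition lead_deg :: "('v::finite, 'k::field) mpoly \<Rightarrow> nat"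
  where "lead_deg p = monom_deg (lead_monom p)"

lemma lead_deg_mult: "p \<noteq> 0 \<Longrightarrow> q \<noteq> 0 \<Longrightarrow> lead_deg (p * q) = lead_deg p + lead_deg q"
  by (simp add: lead_deg_def lead_monom_mult monom_deg_add)

text \<open>The monomial 1 has the least possible Goedel number, so a polynomial with this leading
  monomial is constant.\<close>

lemma lead_deg_unit_iff:
  fixes p :: "('v::finite, 'k::field) mpoly"
  assumes "p \<noteq> 0" shows "lead_deg p = 0 \<longleftrightarrow> p dvd 1"
proof
  assume "lead_deg p = 0"
  then have "lead_monom p = 0" by (simp add: lead_deg_def monom_deg_eq_0)
  then have "godel m \<le> godel (0 :: 'v \<Rightarrow>\<^sub>0 nat)" if "m \<in> Poly_Mapping.keys p" for m
    using lead_monom(2)[OF assms that] by simp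
  moreover have "godel (0 :: 'v \<Rightarrow>\<^sub>0 nat) = 1" by (simp add: godel_def)
  ultimately have "m = 0" if "m \<in> Poly_Mapping.keys p" for m
    using that godel_pos[of m] godel_inject[of m 0] by (metis One_nat_def Suc_leI order_antisym)
  then have p: "p = Poly_Mapping.single 0 (coeff_at p 0)"
    by (intro poly_mapping_eqI) (auto simp: lookup_single when_def in_keys_iff)
  then have "coeff_at p 0 \<noteq> 0" using assms by (metis single_zero)
  then have "p * Poly_Mapping.single 0 (1 / coeff_at p 0) = 1" by (subst p) (simp add: mult_single)
  then show "p dvd 1" by (metis dvd_triv_left)
next
  assume "p dvd 1"
  then obtain q where q: "1 = p * q" by (auto simp: dvd_def)
  then have "q \<noteq> 0" by auto
  have "lead_monom (1 :: ('v, 'k) mpoly) = 0" by (rule lead_monom_eqI) auto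
  then have "lead_deg (1 :: ('v, 'k) mpoly) = 0" by (simp add: lead_deg_def)
  then show "lead_deg p = 0" using lead_deg_mult[OF assms \<open>q \<noteq> 0\<close>] q by simp
qed

section \<open>Euclid's lemma passes to one more variable\<close>

definition coprime_elems :: "'a::comm_ring_1 \<Rightarrow> 'a \<Rightarrow> bool"
  where "coprime_elems f g \<longleftrightarrow> (\<forall>h. h dvd f \<longrightarrow> h dvd g \<longrightarrow> h dvd 1)"

text \<open>Unique factorization in the form of Euclid's lemma. Divisibility is meant in the full
  ring; for \<open>R = poly_in S\<close> this makes no difference, by
  \<open>poly_in_factor\<close>.\<close>

definition gauss_ring :: "('v::finite, 'k::field) mpoly set \<Rightarrow> bool"
  where "gauss_ring R \<longleftrightarrow> (\<forall>f\<in>R. \<forall>g\<in>R. \<forall>v\<in>R. f \<noteq> 0 \<longrightarrow> coprime_elems f g \<longrightarrow> f dvd g * v \<longrightarrow> f dvd v)"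

lemma irreducible_factor_exists:
  fixes c :: "('v::finite, 'k::field) mpoly"
  assumes "c \<noteq> 0" "\<not> c dvd 1"
  shows "\<exists>\<pi>. irreducible \<pi> \<and> \<pi> dvd c"
  using assms
proof (induction "lead_deg c" arbitrary: c rule: less_induct)
  case less
  show ?case
  proof (cases "irreducible c")
    case False
    then obtain a b where ab: "c = a * b" "\<not> a dvd 1" "\<not> b dvd 1"
      using less.prems by (auto simp: irreducible_def)
    then have ne: "a \<noteq> 0" "b \<noteq> 0" using less.prems by auto
    then have "lead_deg a < lead_deg c"
      using ab lead_deg_mult[OF ne] lead_deg_unit_iff[OF ne(2)] by simp
    then obtain \<pi> where "irreducible \<pi>" "\<pi> dvd a" using less.hyps ne(1) ab(2) by blast
    then show ?thesis using ab(1) by (meson dvd_mult2)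
  qed auto
qed

lemma gauss_ring_prime:
  fixes \<pi> :: "('v::finite, 'k::field) mpoly"
  assumes R: "gauss_ring R" and \<pi>: "irreducible \<pi>" "\<pi> \<in> R"
    and ab: "a \<in> R" "b \<in> R" "\<pi> dvd a * b"
  shows "\<pi> dvd a \<or> \<pi> dvd b"
proof (cases "\<pi> dvd a")
  case False
  have "coprime_elems \<pi> a"
    unfolding coprime_elems_def
  proof (intro allI impI)
    fix h assume h: "h dvd \<pi>" "h dvd a"
    then obtain t where t: "\<pi> = h * t" by (auto simp: dvd_def)
    show "h dvd 1"
    proof (rule ccontr)
      assume "\<not> h dvd 1"
      then have "t dvd 1" using \<pi>(1) t by (auto simp: irreducible_def)
      then obtain t' where "1 = t * t'" by (auto simp: dvd_def)
      then have "h = \<pi> * t'" using t by (metis mult.assoc mult.right_neutral)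
      then show False using h(2) False by (metis dvd_mult_left)
    qed
  qed
  moreover have "\<pi> \<noteq> 0" using \<pi>(1) by auto
  ultimately show ?thesis using R \<pi>(2) ab unfolding gauss_ring_def by blast
qed simp

lemma const_dvd_eval_iff:
  fixes P :: "('v::finite, 'k::field) mpoly poly"
  assumes P: "\<And>j. coeff P j \<in> poly_in S" and x: "x \<notin> S" and \<pi>: "\<pi> \<in> poly_in S" "\<pi> \<noteq> 0"
  shows "\<pi> dvd poly P (mpoly_var x) \<longleftrightarrow> (\<forall>j. \<pi> dvd coeff P j)"
proof
  assume "\<pi> dvd poly P (mpoly_var x)"
  then obtain h where h: "poly P (mpoly_var x) = h * \<pi>" by (metis dvdE mult.commute)
  have hT: "h \<in> poly_in (insert x S)"
  proof (cases "h = 0")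
    case False
    then show ?thesis
      using poly_in_factor[of h \<pi>] \<pi>(2) poly_eval_in[of P S x] P h by simp
  qed simp
  then obtain H where H: "\<And>j. coeff H j \<in> poly_in S" "poly H (mpoly_var x) = h"
    using poly_rep_exists[OF hT x] by blast
  have "P = smult \<pi> H"
    using P H x h \<pi> by (intro poly_rep_unique[of _ S _ x]) (auto intro: poly_in_mult simp: mult.commute)
  then show "\<forall>j. \<pi> dvd coeff P j" by simp
next
  assume "\<forall>j. \<pi> dvd coeff P j"
  then show "\<pi> dvd poly P (mpoly_var x)" unfolding poly_altdef by (intro dvd_sum dvd_mult2) blast
qed

text \<open>Gauss's lemma: take the first coefficients of both factors that \<pi> does not divide;
  modulo \<pi> their product is a coefficient of the product.\<close>

lemma gauss_prime_lift:
  fixes \<pi> :: "('v::finite, 'k::field) mpoly"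
  assumes R: "gauss_ring (poly_in S :: ('v, 'k) mpoly set)" and x: "x \<notin> S" and \<pi>: "irreducible \<pi>" "\<pi> \<in> poly_in S"
    and st: "s \<in> poly_in (insert x S)" "t \<in> poly_in (insert x S)" "\<pi> dvd s * t"
  shows "\<pi> dvd s \<or> \<pi> dvd t"
proof (rule ccontr)
  assume "\<not> (\<pi> dvd s \<or> \<pi> dvd t)"
  then have nd: "\<not> \<pi> dvd s" "\<not> \<pi> dvd t" by auto
  have p0: "\<pi> \<noteq> 0" using \<pi>(1) by auto
  obtain P where P: "\<And>j. coeff P j \<in> poly_in S" "poly P (mpoly_var x) = s"
    using poly_rep_exists[OF st(1) x] by blast
  obtain Q where Q: "\<And>j. coeff Q j \<in> poly_in S" "poly Q (mpoly_var x) = t"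
    using poly_rep_exists[OF st(2) x] by blast
  have exP: "\<exists>i. \<not> \<pi> dvd coeff P i" using const_dvd_eval_iff[of P S x \<pi>] P x \<pi> p0 nd by simp
  have exQ: "\<exists>i. \<not> \<pi> dvd coeff Q i" using const_dvd_eval_iff[of Q S x \<pi>] Q x \<pi> p0 nd by simp
  define i where "i = (LEAST i. \<not> \<pi> dvd coeff P i)"
  define j where "j = (LEAST j. \<not> \<pi> dvd coeff Q j)"
  have i: "\<not> \<pi> dvd coeff P i" "\<And>k. k < i \<Longrightarrow> \<pi> dvd coeff P k"
    unfolding i_def using LeastI_ex[OF exP] not_less_Least by blast+
  have j: "\<not> \<pi> dvd coeff Q j" "\<And>k. k < j \<Longrightarrow> \<pi> dvd coeff Q k"
    unfolding j_def using LeastI_ex[OF exQ] not_less_Least by blast+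
  have "\<pi> dvd coeff (P * Q) (i + j)"
    using const_dvd_eval_iff[of "P * Q" S x \<pi>] poly_in_coeff_mult[of P S Q] P Q x \<pi> p0 st(3) by simp
  moreover have "coeff (P * Q) (i + j) =
      coeff P i * coeff Q j + (\<Sum>k\<in>{..i+j} - {i}. coeff P k * coeff Q (i + j - k))"
    unfolding coeff_mult by (subst sum.remove[of _ i]) auto
  moreover have "\<pi> dvd (\<Sum>k\<in>{..i+j} - {i}. coeff P k * coeff Q (i + j - k))"
  proof (rule dvd_sum)
    fix k assume "k \<in> {..i+j} - {i}"
    then consider "k < i" | "i + j - k < j" by force
    then show "\<pi> dvd coeff P k * coeff Q (i + j - k)"
      by cases (simp_all add: i(2) j(2))
  qed
  ultimately have "\<pi> dvd coeff P i * coeff Q j" by (simp add: dvd_add_left_iff)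
  then show False using gauss_ring_prime[OF R \<pi> P(1) Q(1)] i(1) j(1) by blast
qed

text \<open>Elimination of \<open>x\<close>. A combination of \<open>f\<close> and \<open>g\<close>
  of least degree in \<open>x\<close> divides, by pseudodivision, every other combination up to a
  factor from the smaller ring. Its primitive part therefore divides \<open>f\<close> and
  \<open>g\<close> and is a unit, so some nonzero \<gamma> free of \<open>x\<close> is a combination
  of \<open>f\<close> and \<open>g\<close>. Then \<open>f\<close> divides
  \<open>\<gamma> * v\<close>, and the irreducible factors of \<gamma> are removed one at a
  time.\<close>

lemma gauss_ring_insert:
  fixes S :: "'v::finite set"
  assumes R: "gauss_ring (poly_in S :: ('v, 'k::field) mpoly set)" and x: "x \<notin> S"
  shows "gauss_ring (poly_in (insert x S) :: ('v, 'k) mpoly set)"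
proof -
  let ?R = "poly_in S :: ('v, 'k) mpoly set" and ?T = "poly_in (insert x S) :: ('v, 'k) mpoly set"
  let ?X = "mpoly_var x :: ('v, 'k) mpoly"
  have RT: "?R \<subseteq> ?T" using poly_in_mono[of S "insert x S"] by blast
  have factor: "\<exists>\<pi> c'. irreducible \<pi> \<and> \<pi> \<in> ?R \<and> c = \<pi> * c' \<and> c' \<in> ?R \<and> c' \<noteq> 0 \<and> lead_deg c' < lead_deg c"
    if c: "c \<in> ?R" "c \<noteq> 0" "\<not> c dvd 1" for c
  proof -
    obtain \<pi> c' where \<pi>: "irreducible \<pi>" "c = \<pi> * c'" using irreducible_factor_exists[OF c(2,3)] by (auto simp: dvd_def)
    then have ne: "\<pi> \<noteq> 0" "c' \<noteq> 0" using c(2) by auto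
    have "\<pi> \<in> ?R" "c' \<in> ?R"
      using poly_in_factor[of \<pi> c' S] poly_in_factor[of c' \<pi> S] \<pi>(2) c(1) ne by (simp_all add: mult.commute)
    moreover have "\<not> \<pi> dvd 1" using \<pi>(1) by (simp add: irreducible_def)
    then have "lead_deg c' < lead_deg c" using \<pi>(2) lead_deg_mult[OF ne] lead_deg_unit_iff[OF ne(1)] by simp
    ultimately show ?thesis using \<pi> ne by blast
  qed
  \<comment> \<open>Every irreducible factor of \<open>c\<close> divides \<open>q\<close>, since it
    cannot divide \<open>w0\<close>; all of \<open>c\<close> is cancelled in this way.\<close>
  have primitive: "w0 dvd f"
    if c: "c \<in> ?R" "c \<noteq> 0" and w0: "w0 \<in> ?T" "\<And>\<pi>. \<pi> \<in> ?R \<Longrightarrow> irreducible \<pi> \<Longrightarrow> \<not> \<pi> dvd w0"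
      and q: "q \<in> ?T" "c * f = q * w0" for c w0 f q
    using c q
  proof (induction "lead_deg c" arbitrary: c q rule: less_induct)
    case less
    show ?case
    proof (cases "c dvd 1")
      case True
      then obtain c' where "1 = c * c'" by (auto simp: dvd_def)
      then have "f = c' * (c * f)" by (simp add: mult.assoc[symmetric] mult.commute)
      then show ?thesis using less.prems(4) by (simp add: mult.assoc[symmetric])
    next
      case False
      then obtain \<pi> c' where \<pi>: "irreducible \<pi>" "\<pi> \<in> ?R" "c = \<pi> * c'" "c' \<in> ?R" "c' \<noteq> 0" "lead_deg c' < lead_deg c"
        using factor less.prems(1,2) by blast
      then have p0: "\<pi> \<noteq> 0" by auto
      have "\<pi> dvd q * w0" using less.prems(4) \<pi>(3) by (metis dvd_triv_left mult.assoc)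
      then have "\<pi> dvd q" using gauss_prime_lift[OF R x \<pi>(1,2) less.prems(3) w0(1)] w0(2)[OF \<pi>(2,1)] by blast
      then obtain q' where q': "q = \<pi> * q'" by (auto simp: dvd_def)
      have "\<pi> * (c' * f) = \<pi> * (q' * w0)" using less.prems(4) \<pi>(3) q' by (simp add: mult.assoc)
      then have eq: "c' * f = q' * w0" using p0 by (simp add: mpoly_mult_cancel)
      have "q' \<in> ?T"
      proof (cases "q' = 0")
        case False then show ?thesis
          using poly_in_factor[of q' \<pi>] p0 less.prems(3) q' by (simp add: mult.commute)
      qed simp
      then show ?thesis using less.hyps[OF \<pi>(6,4,5) _ eq] by blast
    qed
  qed
  \<comment> \<open>An irreducible factor of \<gamma> divides the cofactor of \<open>f\<close> in
    \<open>\<gamma> * v\<close>, and is dropped from \<gamma>, or it divides \<open>f\<close>. In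
    the second case coprimality forces it into \<open>v\<close>, and it is dropped from
    \<open>f\<close> and \<open>v\<close>.\<close>
  have cancel: "f dvd v"
    if "\<gamma> \<in> ?R" "\<gamma> \<noteq> 0" "f \<in> ?T" "f \<noteq> 0" "g \<in> ?T" "v \<in> ?T" "coprime_elems f g" "f dvd g * v" "f dvd \<gamma> * v"
    for \<gamma> f g v
    using that
  proof (induction "lead_deg \<gamma> + lead_deg f" arbitrary: \<gamma> f v rule: less_induct)
    case less
    show ?case
    proof (cases "\<gamma> dvd 1 \<or> v = 0")
      case True
      then consider "v = 0" | "\<gamma> dvd 1" by blast
      then show ?thesis
      proof cases
        case 2
        then obtain c' where "1 = \<gamma> * c'" by (auto simp: dvd_def)
        then have "v = c' * (\<gamma> * v)" by (simp add: mult.assoc[symmetric] mult.commute)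
        then show ?thesis using less.prems(9) by (metis dvd_mult)
      qed simp
    next
      case False
      then obtain \<pi> c' where \<pi>: "irreducible \<pi>" "\<pi> \<in> ?R" "\<gamma> = \<pi> * c'" "c' \<in> ?R" "c' \<noteq> 0" "lead_deg c' < lead_deg \<gamma>"
        using factor less.prems(1,2) by blast
      then have p0: "\<pi> \<noteq> 0" and pu: "\<not> \<pi> dvd 1" by (auto simp: irreducible_def)
      obtain t where t: "\<gamma> * v = f * t" using less.prems(9) by (auto simp: dvd_def)
      then have t0: "t \<noteq> 0" using False less.prems(2) by auto
      have "\<gamma> * v \<in> ?T" using less.prems(1,6) RT by (intro poly_in_mult) auto
      then have tT: "t \<in> ?T" using poly_in_factor[of t f] t0 less.prems(4) t by (simp add: mult.commute)
      have "\<pi> dvd f * t" using t \<pi>(3) by (metis dvd_triv_left mult.assoc)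
      then consider "\<pi> dvd t" | "\<pi> dvd f" using gauss_prime_lift[OF R x \<pi>(1,2) less.prems(3) tT] by blast
      then show ?thesis
      proof cases
        case 1
        then obtain t' where "t = \<pi> * t'" by (auto simp: dvd_def)
        then have "\<pi> * (c' * v) = \<pi> * (f * t')" using t \<pi>(3) by (simp add: mult_ac)
        then have "f dvd c' * v" using p0 by (simp add: mpoly_mult_cancel)
        moreover have "lead_deg c' + lead_deg f < lead_deg \<gamma> + lead_deg f" using \<pi>(6) by simp
        ultimately show ?thesis using less.hyps[OF _ \<pi>(4,5)] less.prems by blast
      next
        case 2
        then obtain f' where f': "f = \<pi> * f'" by (auto simp: dvd_def)
        then have f0: "f' \<noteq> 0" using less.prems(4) by auto
        have fT: "f' \<in> ?T" using poly_in_factor[of f' \<pi>] f0 p0 f' less.prems(3) by (simp add: mult.commute)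
        have "\<not> \<pi> dvd g" using less.prems(7) 2 pu by (auto simp: coprime_elems_def)
        moreover have "\<pi> dvd g * v" using 2 less.prems(8) dvd_trans by blast
        ultimately have "\<pi> dvd v" using gauss_prime_lift[OF R x \<pi>(1,2) less.prems(5,6)] by blast
        then obtain v' where v': "v = \<pi> * v'" by (auto simp: dvd_def)
        then have v0: "v' \<noteq> 0" using False by auto
        have vT: "v' \<in> ?T" using poly_in_factor[of v' \<pi>] v0 p0 v' less.prems(6) by (simp add: mult.commute)
        obtain e where "g * v = f * e" using less.prems(8) by (auto simp: dvd_def)
        then have "\<pi> * (g * v') = \<pi> * (f' * e)" using f' v' by (simp add: mult_ac)
        then have d1: "f' dvd g * v'" using p0 by (simp add: mpoly_mult_cancel)
        have "\<pi> * (\<gamma> * v') = \<pi> * (f' * t)" using t f' v' by (simp add: mult_ac)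
        then have d2: "f' dvd \<gamma> * v'" using p0 by (simp add: mpoly_mult_cancel)
        have "coprime_elems f' g" using less.prems(7) f' by (auto simp: coprime_elems_def)
        moreover have "lead_deg \<gamma> + lead_deg f' < lead_deg \<gamma> + lead_deg f"
          using f' lead_deg_mult[OF p0 f0] lead_deg_unit_iff[OF p0] pu by simp
        ultimately have "f' dvd v'"
          using less.hyps[OF _ less.prems(1,2) fT f0 less.prems(5) vT] d1 d2 by blast
        then show ?thesis unfolding f' v' by (rule mult_dvd_mono[OF dvd_refl])
      qed
    qed
  qed
  show ?thesis
    unfolding gauss_ring_def
  proof (intro ballI impI)
    fix f g v assume fgv: "f \<in> ?T" "g \<in> ?T" "v \<in> ?T" and f0: "f \<noteq> 0" and cop: "coprime_elems f g" and dv: "f dvd g * v"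
    define W where "W = {P. (\<forall>j. coeff P j \<in> ?R) \<and> (\<exists>\<alpha> \<beta>. poly P ?X = \<alpha> * f + \<beta> * g)}"
    obtain Pf where Pf: "\<And>j. coeff Pf j \<in> ?R" "poly Pf ?X = f" using poly_rep_exists[OF fgv(1) x] by blast
    obtain Pg where Pg: "\<And>j. coeff Pg j \<in> ?R" "poly Pg ?X = g" using poly_rep_exists[OF fgv(2) x] by blast
    have "f = 1 * f + 0 * g" "g = 0 * f + 1 * g" by simp_all
    then have PW: "Pf \<in> W" "Pg \<in> W" using Pf Pg unfolding W_def by blast+
    have "Pf \<noteq> 0" using Pf(2) f0 by auto
    then obtain P0 where P0: "P0 \<in> W" "P0 \<noteq> 0" "\<And>Q. Q \<in> W \<Longrightarrow> Q \<noteq> 0 \<Longrightarrow> degree P0 \<le> degree Q"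
      using ex_has_least_nat[of "\<lambda>P. P \<in> W \<and> P \<noteq> 0" Pf degree] PW(1) by blast
    have P0R: "\<And>j. coeff P0 j \<in> ?R" using P0(1) by (auto simp: W_def)
    define w where "w = poly P0 ?X"
    have wT: "w \<in> ?T" unfolding w_def by (rule poly_eval_in[OF P0R])
    have w0: "w \<noteq> 0" using poly_rep_zero[OF P0R x] P0(2) by (auto simp: w_def)
    have pseudo: "\<exists>c q. c \<in> ?R \<and> c \<noteq> 0 \<and> q \<in> ?T \<and> c * poly Q ?X = q * w" if "Q \<in> W" for Q
      using that
    proof (induction "degree Q" arbitrary: Q rule: less_induct)
      case less
      have QR: "\<And>j. coeff Q j \<in> ?R" using less.prems by (auto simp: W_def)
      show ?case
      proof (cases "Q = 0")
        case True then show ?thesis by (intro exI[of _ 1] exI[of _ 0]) simp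
      next
        case False
        define a where "a = lead_coeff P0"
        define b where "b = lead_coeff Q"
        define k where "k = degree Q - degree P0"
        \<comment> \<open>Multiplication by both leading coefficients replaces division, which the
          coefficient ring does not allow; the leading terms cancel.\<close>
        define Q' where "Q' = smult a Q - smult b (monom 1 k * P0)"
        have dk: "degree Q = k + degree P0" using P0(3)[OF less.prems False] by (simp add: k_def)
        have ab: "a \<in> ?R" "b \<in> ?R" "a \<noteq> 0" using P0R QR P0(2) by (auto simp: a_def b_def)
        have Q'eval: "poly Q' ?X = a * poly Q ?X - b * (?X ^ k * w)"
          by (simp add: Q'_def poly_monom w_def)
        have Q'W: "Q' \<in> W"
        proof -
          have "coeff Q' j \<in> ?R" for j
            using QR P0R ab by (auto simp: Q'_def coeff_monom_mult intro!: poly_in_diff poly_in_mult)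
          moreover obtain \<alpha> \<beta> \<alpha>' \<beta>' where "poly Q ?X = \<alpha> * f + \<beta> * g" "w = \<alpha>' * f + \<beta>' * g"
            using less.prems P0(1) by (auto simp: W_def w_def)
          then have "poly Q' ?X = (a * \<alpha> - b * ?X ^ k * \<alpha>') * f + (a * \<beta> - b * ?X ^ k * \<beta>') * g"
            by (simp add: Q'eval algebra_simps)
          ultimately show ?thesis unfolding W_def by blast
        qed
        have Q'deg: "degree Q' < degree Q \<or> Q' = 0"
        proof -
          have "degree Q' \<le> degree Q"
            unfolding Q'_def dk
            by (intro degree_diff_le order_trans[OF degree_smult_le] order_trans[OF degree_mult_le])
              (auto simp: dk[symmetric] intro: order_trans[OF add_right_mono[OF degree_monom_le]])
          moreover have "coeff Q' (degree Q) = a * b - b * a"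
            by (simp add: Q'_def a_def b_def coeff_monom_mult dk)
          then have "coeff Q' (degree Q) = 0" by (simp add: mult.commute)
          ultimately show ?thesis
            by (metis leading_coeff_0_iff order_le_imp_less_or_eq)
        qed
        obtain c q where cq: "c \<in> ?R" "c \<noteq> 0" "q \<in> ?T" "c * poly Q' ?X = q * w"
        proof (cases "Q' = 0")
          case True then show ?thesis using that[of 1 0] by simp
        next
          case False then show ?thesis using less.hyps[OF _ Q'W] Q'deg that by blast
        qed
        have "(c * a) * poly Q ?X = (q + c * b * ?X ^ k) * w"
          using cq(4) unfolding Q'eval by (simp add: algebra_simps)
        moreover have "c * a \<in> ?R" "c * a \<noteq> 0" using cq ab by (auto intro: poly_in_mult)
        moreover have "q + c * b * ?X ^ k \<in> ?T"
          using cq ab RT by (intro poly_in_add poly_in_mult poly_in_var) auto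
        ultimately show ?thesis by blast
      qed
    qed
    \<comment> \<open>A factor of \<open>w\<close> with cofactor free of \<open>x\<close> and least
      \<open>lead_deg\<close> is primitive: an irreducible factor free of \<open>x\<close> could be
      moved into the cofactor.\<close>
    have "\<exists>\<gamma>. \<gamma> \<in> ?R \<and> w = \<gamma> * w" by (intro exI[of _ 1]) simp
    from ex_has_least_nat[of "\<lambda>y. \<exists>\<gamma>. \<gamma> \<in> ?R \<and> w = \<gamma> * y", OF this, of lead_deg]
    obtain z where "\<exists>\<gamma>. \<gamma> \<in> ?R \<and> w = \<gamma> * z"
      and least: "\<forall>y. (\<exists>\<gamma>. \<gamma> \<in> ?R \<and> w = \<gamma> * y) \<longrightarrow> lead_deg z \<le> lead_deg y"
      by - (erule exE, erule conjE, rule that)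
    then obtain \<gamma> where z: "\<gamma> \<in> ?R" "w = \<gamma> * z" by (elim exE conjE)
    have zmin: "lead_deg z \<le> lead_deg y" if "\<gamma>' \<in> ?R" "w = \<gamma>' * y" for \<gamma>' y
      using least that by blast
    have ne: "\<gamma> \<noteq> 0" "z \<noteq> 0" using w0 z(2) by auto
    have zT: "z \<in> ?T" using poly_in_factor[of z \<gamma>] ne wT z(2) by (simp add: mult.commute)
    have zprim: "\<not> \<pi> dvd z" if \<pi>: "\<pi> \<in> ?R" "irreducible \<pi>" for \<pi>
    proof
      assume "\<pi> dvd z"
      then obtain y where y: "z = \<pi> * y" by (auto simp: dvd_def)
      then have n2: "\<pi> \<noteq> 0" "y \<noteq> 0" using ne by auto
      have "w = (\<gamma> * \<pi>) * y" using z(2) y by (simp add: mult.assoc)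
      then have "lead_deg z \<le> lead_deg y" using zmin[OF poly_in_mult[OF z(1) \<pi>(1)]] by blast
      then have "\<pi> dvd 1" using y lead_deg_mult[OF n2] lead_deg_unit_iff[OF n2(1)] by simp
      then show False using \<pi>(2) by (simp add: irreducible_def)
    qed
    have zdvd: "z dvd poly Q ?X" if QW: "Q \<in> W" for Q
    proof -
      obtain c q where cq: "c \<in> ?R" "c \<noteq> 0" "q \<in> ?T" "c * poly Q ?X = q * w" using pseudo[OF QW] by blast
      have "q * \<gamma> \<in> ?T" using cq(3) z(1) RT by (intro poly_in_mult) auto
      moreover have "c * poly Q ?X = (q * \<gamma>) * z" using cq(4) z(2) by (simp add: mult.assoc)
      ultimately show ?thesis using primitive[OF cq(1,2) zT zprim] by blast
    qed
    have "z dvd 1" using zdvd[OF PW(1)] zdvd[OF PW(2)] Pf(2) Pg(2) cop by (auto simp: coprime_elems_def)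
    then obtain z' where z': "1 = z * z'" by (auto simp: dvd_def)
    obtain \<alpha> \<beta> where w\<alpha>: "w = \<alpha> * f + \<beta> * g" using P0(1) by (auto simp: W_def w_def)
    have "\<gamma> * (z * z') = z' * w" using z(2) by (simp add: mult_ac)
    then have "\<gamma> = z' * (\<alpha> * f + \<beta> * g)" using z' w\<alpha> by simp
    then have "\<gamma> * v = f * (z' * \<alpha> * v) + (z' * \<beta>) * (g * v)" by (simp add: algebra_simps)
    then have "f dvd \<gamma> * v" using dv by simp
    then show "f dvd v" using cancel[OF z(1) ne(1) fgv(1) f0 fgv(2,3) cop dv] by blast
  qed
qed

lemma gauss_ring_poly_in: "finite S \<Longrightarrow> gauss_ring (poly_in S :: ('v::finite, 'k::field) mpoly set)"
proof (induction S rule: finite_induct)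
  case empty
  show ?case
    unfolding gauss_ring_def
  proof (intro ballI impI)
    fix f g v :: "('v, 'k) mpoly" assume f: "f \<in> poly_in {}" "f \<noteq> 0"
    have "lead_monom f = 0"
      using lead_monom(1)[OF f(2)] f(1) by (intro poly_mapping_eqI) (auto simp: poly_in_def)
    then have "f dvd 1" using lead_deg_unit_iff[OF f(2)] by (simp add: lead_deg_def)
    then show "f dvd v" using dvd_trans one_dvd by blast
  qed
qed (rule gauss_ring_insert)

lemma coprime_imp_nzd:
  fixes f g :: "('v::finite, 'k::field) mpoly"
  assumes "f \<noteq> 0" "\<And>h. h dvd f \<Longrightarrow> h dvd g \<Longrightarrow> h dvd 1"
  shows "nzd (adjoin {0} f) g"
  using gauss_ring_poly_in[OF finite[of "UNIV :: 'v set"]] assms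
  unfolding gauss_ring_def poly_in_UNIV coprime_elems_def nzd_def adjoin_zero by blast

lemma nzd_zero: "f \<noteq> 0 \<Longrightarrow> nzd {0} f" for f :: "('v::finite, 'k::field) mpoly"
  by (auto simp: nzd_def)

text \<open>A linear form has \<open>lead_deg\<close> 1, so any factorization of it has a unit
  factor, and a common divisor with \<open>q\<close> is a unit or an associate of
  \<open>l\<close>.\<close>

lemma linear_form_nzd:
  fixes l q :: "('v::finite, 'k::field) mpoly"
  assumes l: "l \<in> forms 1" "l \<noteq> 0" and q: "\<not> l dvd q"
  shows "nzd (adjoin {0} l) q"
proof (rule coprime_imp_nzd[OF l(2)])
  fix h assume h: "h dvd l" "h dvd q"
  then obtain t where t: "l = h * t" by (auto simp: dvd_def)
  then have ne: "h \<noteq> 0" "t \<noteq> 0" using l(2) by auto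
  have "lead_deg l = 1" using l lead_monom(1)[OF l(2)] by (auto simp: lead_deg_def forms_def)
  then have "lead_deg h = 0 \<or> lead_deg t = 0" using t lead_deg_mult[OF ne] by auto
  then show "h dvd 1"
  proof
    assume "lead_deg t = 0"
    then obtain t' where "1 = t * t'" using lead_deg_unit_iff[OF ne(2)] by (auto simp: dvd_def)
    then have "h = l * t'" using t by (metis mult.assoc mult.right_neutral)
    then have "l dvd q" using h(2) by (metis dvd_mult_left)
    then show ?thesis using q by simp
  qed (use lead_deg_unit_iff[OF ne(1)] in simp)
qed


section \<open>Numerical functions\<close>

abbreviation fps_delta :: "int fps"
  where "fps_delta \<equiv> 1 - fps_X"

text \<open>The Hilbert series of a polynomial ring in one variable modulo a form of degree
  \<open>r\<close>.\<close>

definition fps_interval :: "nat \<Rightarrow> int fps"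
  where "fps_interval r = Abs_fps (\<lambda>i. if i < r then 1 else 0)"

text \<open>The Hilbert series of a polynomial ring in two variables modulo a form of degree
  \<open>r\<close>.\<close>

definition fps_ramp :: "nat \<Rightarrow> int fps"
  where "fps_ramp r = Abs_fps (\<lambda>i. int (min (i + 1) r))"

lemma nth_delta_mult: "fps_nth (fps_delta * F) n = fps_nth F n - (if n = 0 then 0 else fps_nth F (n - 1))"
  by (simp add: left_diff_distrib)

lemma nth_interval [simp]: "fps_nth (fps_interval r) i = (if i < r then 1 else 0)"
  by (simp add: fps_interval_def)

lemma nth_ramp [simp]: "fps_nth (fps_ramp r) i = int (min (i + 1) r)"
  by (simp add: fps_ramp_def)

lemma delta_interval: "fps_delta * fps_interval r = 1 - fps_X ^ r"
  by (rule fps_ext) (auto simp: nth_delta_mult fps_X_power_nth)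

lemma delta_ramp: "fps_delta * fps_ramp r = fps_interval r"
  by (rule fps_ext) (auto simp: nth_delta_mult min_def)

lemma delta_cancel: "fps_delta * F = fps_delta * G \<longleftrightarrow> F = G"
  using mult_cancel_left[of fps_delta F G] by simp

lemma delta_power_cancel: "fps_delta ^ n * F = fps_delta ^ n * G \<longleftrightarrow> F = G"
  using mult_cancel_left[of "fps_delta ^ n" F G] by simp

lemma nth_interval_mult:
  assumes "r \<le> n + 1" shows "fps_nth (fps_interval r * F) n = (\<Sum>i<r. fps_nth F (n - i))"
proof -
  have "fps_nth (fps_interval r * F) n = (\<Sum>i\<in>{0..n}. if i < r then fps_nth F (n - i) else 0)"
    by (auto simp: fps_mult_nth intro!: sum.cong)
  also have "\<dots> = (\<Sum>i\<in>{i\<in>{0..n}. i < r}. fps_nth F (n - i))"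
    by (rule sum.inter_filter[symmetric]) simp
  also have "{i\<in>{0..n}. i < r} = {..<r}" using assms by auto
  finally show ?thesis .
qed

text \<open>The ramp is constant from degree \<open>b - 1\<close> on. The eventual value is the
  degree of a complete intersection of type (a, b).\<close>

lemma interval_ramp_eventually:
  assumes "a + b \<le> n" shows "fps_nth (fps_interval a * fps_ramp b) n = int a * int b"
proof -
  have "fps_nth (fps_interval a * fps_ramp b) n = (\<Sum>i<a. int (min (n - i + 1) b))"
    using assms by (subst nth_interval_mult) auto
  also have "\<dots> = (\<Sum>i<a. int b)" using assms by (intro sum.cong) auto
  finally show ?thesis by simp
qed

section \<open>Backward differences and Hilbert polynomials\<close>

definition poly_diff :: "rat poly \<Rightarrow> rat poly"
  where "poly_diff P = P - pcompose P [:-1, 1:]"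

lemma poly_poly_diff: "poly (poly_diff P) x = poly P x - poly P (x - 1)"
  by (simp add: poly_diff_def poly_pcompose algebra_simps)

lemma poly_diff_add: "poly_diff (P + Q) = poly_diff P + poly_diff Q"
  by (simp add: poly_diff_def pcompose_add)

text \<open>A difference lowers the degree and multiplies the top coefficient by the old degree;
  iterated, this produces the factorial in the definition of degree.\<close>

lemma coeff_poly_diff:
  "degree P \<le> Suc n \<Longrightarrow> coeff (poly_diff P) (Suc n) = 0 \<and> coeff (poly_diff P) n = of_nat (Suc n) * coeff P (Suc n)"
proof (induction P arbitrary: n)
  case 0 show ?case by (simp add: poly_diff_def)
next
  case (pCons a P)
  \<comment> \<open>The product rule for differences, applied to the indeterminate times
    \<open>P\<close>.\<close>
  have eq: "poly_diff (pCons a P) = pCons 0 (poly_diff P) + P - poly_diff P"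
    by (simp add: poly_diff_def pcompose_pCons algebra_simps)
  have dP: "degree P \<le> n" using pCons.prems by (cases "P = 0") auto
  show ?case
  proof (cases n)
    case 0
    then obtain p where "P = [:p:]" using dP degree_eq_zeroE by blast
    then show ?thesis using 0 by (simp add: poly_diff_def pcompose_pCons)
  next
    case (Suc k)
    have "coeff (poly_diff P) n = 0" "coeff (poly_diff P) k = of_nat n * coeff P n"
      using pCons.IH[of k] dP Suc by auto
    moreover have "coeff (poly_diff P) (Suc n) = 0" using pCons.IH[of n] dP by auto
    moreover have "coeff P (Suc n) = 0" using dP by (simp add: coeff_eq_0)
    ultimately show ?thesis using Suc by (simp add: eq algebra_simps)
  qed
qed

lemma degree_poly_diff: assumes "degree P \<le> Suc n" shows "degree (poly_diff P) \<le> n"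
proof (rule degree_le, intro allI impI)
  fix k assume "n < k"
  then show "coeff (poly_diff P) k = 0" using coeff_poly_diff[of P "k - 1"] assms by simp
qed

text \<open>A multiple of the next monomial has a difference with the right top coefficient; what
  remains has smaller degree.\<close>

lemma poly_antidiff: "degree Q \<le> n \<Longrightarrow> \<exists>P. degree P \<le> Suc n \<and> poly_diff P = Q"
proof (induction n arbitrary: Q)
  case 0
  then obtain q where "Q = [:q:]" using degree_eq_zeroE by blast
  then show ?case by (intro exI[of _ "[:0, q:]"]) (simp add: poly_diff_def pcompose_pCons)
next
  case (Suc n)
  define P0 where "P0 = monom (coeff Q (Suc n) / of_nat (Suc (Suc n))) (Suc (Suc n))"
  have d0: "degree P0 \<le> Suc (Suc n)" by (simp add: P0_def degree_monom_le)
  have "coeff (poly_diff P0) (Suc n) = of_nat (Suc (Suc n)) * coeff P0 (Suc (Suc n))"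
    using coeff_poly_diff[OF d0] by blast
  also have "\<dots> = coeff Q (Suc n)"
    by (simp add: P0_def del: of_nat_Suc)
  finally have "coeff (poly_diff P0) (Suc n) = coeff Q (Suc n)" .
  then have c0: "coeff (Q - poly_diff P0) (Suc n) = 0" by simp
  have "degree (Q - poly_diff P0) \<le> n"
  proof (rule degree_le, intro allI impI)
    fix k assume k: "n < k"
    show "coeff (Q - poly_diff P0) k = 0"
    proof (cases "k = Suc n")
      case False
      then have "degree Q < k" "degree (poly_diff P0) < k"
        using k Suc.prems degree_poly_diff[OF d0] by auto
      then show ?thesis by (simp add: coeff_eq_0)
    qed (use c0 in simp)
  qed
  then obtain P where P: "degree P \<le> Suc n" "poly_diff P = Q - poly_diff P0" using Suc.IH by blast
  have "degree (P0 + P) \<le> Suc (Suc n)" using d0 P(1) by (intro degree_add_le) auto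
  moreover have "poly_diff (P0 + P) = Q" using P(2) by (simp add: poly_diff_add)
  ultimately show ?case by blast
qed

lemma delta_power_polynomial:
  assumes "\<forall>\<^sub>F n in sequentially. rat_of_int (fps_nth F n) = poly P (of_nat n)" "degree P \<le> m"
  shows "\<forall>\<^sub>F n in sequentially. rat_of_int (fps_nth (fps_delta ^ m * F) n) = fact m * coeff P m"
  using assms
proof (induction m arbitrary: F P)
  case 0
  then obtain p where "P = [:p:]" using degree_eq_zeroE by blast
  then show ?case using 0 by simp
next
  case (Suc m)
  have "\<forall>\<^sub>F n in sequentially. n \<ge> Suc 0" by (rule eventually_ge_at_top)
  moreover have "\<forall>\<^sub>F n in sequentially. rat_of_int (fps_nth F (n - 1)) = poly P (of_nat (n - 1))"
  proof -
    obtain N where "\<And>n. n \<ge> N \<Longrightarrow> rat_of_int (fps_nth F n) = poly P (of_nat n)"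
      using Suc.prems(1) by (auto simp: eventually_sequentially)
    then show ?thesis by (auto simp: eventually_sequentially intro!: exI[of _ "Suc N"])
  qed
  ultimately have "\<forall>\<^sub>F n in sequentially. rat_of_int (fps_nth (fps_delta * F) n) = poly (poly_diff P) (of_nat n)"
    using Suc.prems(1)
    by eventually_elim (simp add: nth_delta_mult poly_poly_diff of_nat_diff)
  then have "\<forall>\<^sub>F n in sequentially. rat_of_int (fps_nth (fps_delta ^ m * (fps_delta * F)) n) = fact m * coeff (poly_diff P) m"
    using degree_poly_diff[OF Suc.prems(2)] by (rule Suc.IH)
  then show ?case using coeff_poly_diff[OF Suc.prems(2)] by (simp add: mult_ac)
qed

lemma polynomial_if_delta_power:
  assumes "\<forall>\<^sub>F n in sequentially. rat_of_int (fps_nth (fps_delta ^ m * F) n) = c"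
  shows "\<exists>P. degree P \<le> m \<and> (\<forall>\<^sub>F n in sequentially. rat_of_int (fps_nth F n) = poly P (of_nat n))"
  using assms
proof (induction m arbitrary: F)
  case 0 then show ?case by (intro exI[of _ "[:c:]"]) simp
next
  case (Suc m)
  have "\<forall>\<^sub>F n in sequentially. rat_of_int (fps_nth (fps_delta ^ m * (fps_delta * F)) n) = c"
    using Suc.prems by (simp add: mult_ac)
  then obtain Q where Q: "degree Q \<le> m"
    "\<forall>\<^sub>F n in sequentially. rat_of_int (fps_nth (fps_delta * F) n) = poly Q (of_nat n)"
    using Suc.IH by blast
  obtain P where P: "degree P \<le> Suc m" "poly_diff P = Q" using poly_antidiff[OF Q(1)] by blast
  obtain N where N: "\<And>n. n \<ge> N \<Longrightarrow> rat_of_int (fps_nth (fps_delta * F) n) = poly Q (of_nat n)"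
    using Q(2) by (auto simp: eventually_sequentially)
  \<comment> \<open>The constant of summation, fixed by the value at \<open>N\<close>.\<close>
  define b where "b = rat_of_int (fps_nth F N) - poly P (of_nat N)"
  have "rat_of_int (fps_nth F n) = poly (P + [:b:]) (of_nat n)" if "n \<ge> N" for n
    using that
  proof (induction rule: dec_induct)
    case (step n)
    have "rat_of_int (fps_nth F (Suc n)) - rat_of_int (fps_nth F n) = poly P (of_nat (Suc n)) - poly P (of_nat n)"
      using N[of "Suc n"] step.hyps by (simp add: nth_delta_mult P(2)[symmetric] poly_poly_diff)
    then show ?case using step.IH by simp
  qed (simp add: b_def)
  moreover have "degree (P + [:b:]) \<le> Suc m" using P(1) by (intro degree_add_le) auto
  ultimately show ?case unfolding eventually_sequentially by blast
qed

lemma hilbert_poly_unique: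
  assumes "is_hilbert_poly I P" "is_hilbert_poly I Q" shows "P = Q"
proof -
  have "\<forall>\<^sub>F n in sequentially. poly (P - Q) (of_nat n) = 0"
    using assms unfolding is_hilbert_poly_def by eventually_elim simp
  then obtain N where N: "\<And>n. n \<ge> N \<Longrightarrow> poly (P - Q) (of_nat n) = 0" by (auto simp: eventually_sequentially)
  have "of_nat ` {N..} \<subseteq> {x. poly (P - Q) x = 0}" using N by auto
  moreover have "infinite (of_nat ` {N..} :: rat set)"
    by (simp add: finite_image_iff inj_on_def infinite_Ici)
  ultimately have "infinite {x. poly (P - Q) x = 0}" using finite_subset by blast
  then have "P - Q = 0" using poly_roots_finite by blast
  then show ?thesis by simp
qed

text \<open>Replaces Hilbert polynomials by eventual values of power series, the form in which the
  degree is used from here on.\<close>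

lemma has_dim_degree_imp:
  assumes "has_dim_degree I m e"
  shows "\<forall>\<^sub>F n in sequentially. fps_nth (fps_delta ^ m * hilbert_series I) n = int e"
proof -
  obtain P where P: "is_hilbert_poly I P" "degree P = m" "fact m * lead_coeff P = rat_of_nat e"
    using assms by (auto simp: has_dim_degree_def)
  have "\<forall>\<^sub>F n in sequentially. rat_of_int (fps_nth (fps_delta ^ m * hilbert_series I) n) = fact m * coeff P m"
    using P(1,2) by (intro delta_power_polynomial) (simp_all add: is_hilbert_poly_def)
  then show ?thesis
  proof eventually_elim
    case (elim n)
    then have "rat_of_int (fps_nth (fps_delta ^ m * hilbert_series I) n) = rat_of_int (int e)"
      using P(2,3) by simp
    then show ?case by (simp only: of_int_eq_iff)
  qed
qed

lemma has_dim_degreeI: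
  assumes "\<forall>\<^sub>F n in sequentially. fps_nth (fps_delta ^ m * hilbert_series I) n = int e" "e > 0"
  shows "has_dim_degree I m e"
proof -
  have ev: "\<forall>\<^sub>F n in sequentially. rat_of_int (fps_nth (fps_delta ^ m * hilbert_series I) n) = rat_of_nat e"
    using assms(1) by eventually_elim simp
  then obtain P where P: "degree P \<le> m"
    "\<forall>\<^sub>F n in sequentially. rat_of_int (fps_nth (hilbert_series I) n) = poly P (of_nat n)"
    using polynomial_if_delta_power by blast
  have "\<forall>\<^sub>F n in sequentially. fact m * coeff P m = rat_of_nat e"
    using ev delta_power_polynomial[OF P(2,1)] by eventually_elim simp
  then have c: "fact m * coeff P m = rat_of_nat e" by (auto simp: eventually_sequentially)
  then have "coeff P m \<noteq> 0" using assms(2) by auto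
  then have "degree P = m" "P \<noteq> 0" using P(1) le_degree[of P m] by auto
  then show ?thesis using P(2) c by (auto simp: has_dim_degree_def is_hilbert_poly_def)
qed


section \<open>Complete intersections and linkage\<close>

definition colon_ideal :: "'a::comm_ring_1 set \<Rightarrow> 'a set \<Rightarrow> 'a set"
  where "colon_ideal Z V = {h. \<forall>x\<in>V. h * x \<in> Z}"

lemma adjoinI: "x - a * f \<in> I \<Longrightarrow> x \<in> adjoin I f"
  by (auto simp: adjoin_def)

lemma adjoinE: "x \<in> adjoin I f \<Longrightarrow> (\<And>a. x - a * f \<in> I \<Longrightarrow> thesis) \<Longrightarrow> thesis"
  by (auto simp: adjoin_def)

lemma pair_mem_iff: "x \<in> adjoin (adjoin {0} f) g \<longleftrightarrow> (\<exists>p t. x = p * f + t * g)"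
proof
  assume "x \<in> adjoin (adjoin {0} f) g"
  then obtain t p where "x - t * g - p * f = 0" by (auto simp: adjoin_def)
  then have "x = p * f + t * g" by (simp add: algebra_simps)
  then show "\<exists>p t. x = p * f + t * g" by blast
next
  assume "\<exists>p t. x = p * f + t * g"
  then obtain p t where "x = p * f + t * g" by blast
  then have "x - t * g - p * f \<in> {0}" by (simp add: algebra_simps)
  then show "x \<in> adjoin (adjoin {0} f) g" by (intro adjoinI)
qed

lemma pair_mem: "f \<in> adjoin (adjoin {0} f) g" "g \<in> adjoin (adjoin {0} f) g"
proof -
  have "f = 1 * f + 0 * g" "g = 0 * f + 1 * g" by simp_all
  then show "f \<in> adjoin (adjoin {0} f) g" "g \<in> adjoin (adjoin {0} f) g"
    unfolding pair_mem_iff by blast+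
qed

lemma complete_intersection_regular:
  fixes I :: "('v::finite, 'k::field) mpoly set"
  assumes "complete_intersection a b I"
  obtains f g where "f \<in> forms a" "g \<in> forms b" "f \<noteq> 0" "nzd (adjoin {0} f) g" "I = adjoin (adjoin {0} f) g"
proof -
  obtain f g where fg: "f \<in> forms a" "g \<in> forms b" "f \<noteq> 0" "\<forall>h. h dvd f \<longrightarrow> h dvd g \<longrightarrow> h dvd 1" "I = ideal_gen {f, g}"
    using assms by (auto simp: complete_intersection_def)
  have "nzd (adjoin {0} f) g" using coprime_imp_nzd[OF fg(3)] fg(4) by blast
  then show thesis using fg that by (simp add: ideal_gen_pair)
qed

text \<open>A common divisor h with f = h u lies outside (f) because \<open>g\<close> does;
  primeness then puts u into (f), which makes h a unit.\<close>

lemma complete_intersectionI: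
  fixes f g :: "('v::finite, 'k::field) mpoly"
  assumes fg: "f \<in> forms a" "g \<in> forms b" "f \<noteq> 0" "g \<noteq> 0" and "prime_ideal (adjoin {0} f)" "g \<notin> adjoin {0} f"
  shows "complete_intersection a b (adjoin (adjoin {0} f) g)"
  unfolding complete_intersection_def
proof (intro bexI[OF _ fg(1)] bexI[OF _ fg(2)] conjI fg(3,4) allI impI)
  fix h assume h: "h dvd f" "h dvd g"
  then obtain u where u: "f = h * u" by (auto simp: dvd_def)
  then have "h * u \<in> adjoin {0} f" by (simp add: adjoin_zero)
  then have "h \<in> adjoin {0} f \<or> u \<in> adjoin {0} f" using assms(5) by (auto simp: prime_ideal_def)
  moreover have "h \<notin> adjoin {0} f" using h(2) assms(6) by (meson adjoin_zero dvd_trans)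
  ultimately obtain w where "u = f * w" by (auto simp: adjoin_zero dvd_def)
  then have "u * 1 = u * (h * w)" using u by (simp add: mult_ac)
  moreover have "u \<noteq> 0" using u fg(3) by auto
  ultimately have "1 = h * w" using mpoly_mult_cancel[of u 1] by simp
  then show "h dvd 1" by (metis dvd_triv_left)
qed (simp add: ideal_gen_pair)

lemma hilbert_series_pair:
  fixes f g :: "('v::finite, 'k::field) mpoly"
  assumes "f \<in> forms a" "g \<in> forms b" "f \<noteq> 0" "nzd (adjoin {0} f) g"
  shows "hilbert_series (adjoin (adjoin {0} f) g) = (1 - fps_X ^ a) * (1 - fps_X ^ b) * hilbert_series ({0} :: ('v, 'k) mpoly set)"
  using hilbert_series_adjoin_nzd[OF homog_zero assms(1) nzd_zero[OF assms(3)]]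
    hilbert_series_adjoin_nzd[OF homog_adjoin[OF homog_zero assms(1)] assms(2,4)] by (simp add: mult_ac)

lemma homog_pair: "f \<in> forms a \<Longrightarrow> g \<in> forms b \<Longrightarrow> homog (adjoin (adjoin {0} f) g)"
  by (intro homog_adjoin homog_zero)

text \<open>
  The determinant of the matrix expressing the generators of a complete intersection \<open>(f, g)\<close>
  in those of a larger one \<open>(l, q)\<close> generates the residual ideal modulo \<open>(f, g)\<close>.
\<close>

lemma colon_pair:
  fixes f g l q :: "'a::comm_ring_1"
  assumes reg: "nzd {0} f" "nzd (adjoin {0} f) g" "nzd {0} l" "nzd (adjoin {0} l) q"
    and f: "f = a * l + b * q" and g: "g = c * l + e * q"
  shows "h * l \<in> adjoin (adjoin {0} f) g \<and> h * q \<in> adjoin (adjoin {0} f) g \<longleftrightarrow>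
    h \<in> adjoin (adjoin (adjoin {0} f) g) (a * e - b * c)"
proof
  assume "h * l \<in> adjoin (adjoin {0} f) g \<and> h * q \<in> adjoin (adjoin {0} f) g"
  then obtain p t p' t' where hl: "h * l = p * f + t * g" and hq: "h * q = p' * f + t' * g"
    unfolding pair_mem_iff by blast
  \<comment> \<open>The two sides give two expressions of one element through \<open>f\<close> and
    \<open>g\<close>, hence a syzygy; by regularity it is a multiple, by \<open>w\<close>, of the
    Koszul syzygy.\<close>
  have "q * (h * l) = l * (h * q)" by (simp add: mult_ac)
  then have syz: "(p * q - p' * l) * f + (t * q - t' * l) * g = 0"
    unfolding hl hq by (simp add: algebra_simps)
  then have "g * (t * q - t' * l) = (p' * l - p * q) * f"
    by (simp add: algebra_simps)
  then have "g * (t * q - t' * l) \<in> adjoin {0} f" by (simp add: adjoin_zero)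
  then have "t * q - t' * l \<in> adjoin {0} f" using reg(2) by (auto simp: nzd_def)
  then obtain w where w: "t * q - t' * l = f * w" by (auto simp: adjoin_zero dvd_def)
  have "f * (p * q - p' * l + g * w) = 0" using syz unfolding w by (simp add: algebra_simps)
  then have pw: "p * q - p' * l + g * w = 0" using reg(1) by (auto simp: nzd_def)
  \<comment> \<open>Corrected by \<open>w\<close>, the coefficients become divisible by
    \<open>l\<close>, because \<open>q\<close> is regular modulo \<open>l\<close>. After cancelling
    \<open>l\<close>, what is left of \<open>h\<close> modulo (f, g) is \<open>- w\<close> times the
    determinant.\<close>
  have "q * (p + e * w) = l * (p' - c * w) + (p * q - p' * l + g * w)"
    unfolding g by (simp add: algebra_simps)
  then have "q * (p + e * w) \<in> adjoin {0} l" by (simp add: pw adjoin_zero)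
  then have "p + e * w \<in> adjoin {0} l" using reg(4) by (auto simp: nzd_def)
  then obtain v where v: "p + e * w = l * v" by (auto simp: adjoin_zero dvd_def)
  have "q * (t - b * w) = l * (t' + a * w) + (t * q - t' * l - f * w)"
    unfolding f by (simp add: algebra_simps)
  then have "q * (t - b * w) \<in> adjoin {0} l" by (simp add: w adjoin_zero)
  then have "t - b * w \<in> adjoin {0} l" using reg(4) by (auto simp: nzd_def)
  then obtain v' where v': "t - b * w = l * v'" by (auto simp: adjoin_zero dvd_def)
  have "h * l = (l * v - e * w) * f + (l * v' + b * w) * g"
    using hl v v' by (metis add_diff_cancel_right' diff_add_cancel)
  also have "\<dots> = l * (v * f + v' * g - w * (a * e - b * c))"
    unfolding f g by (simp add: algebra_simps)
  finally have "l * (h - (v * f + v' * g - w * (a * e - b * c))) = 0" by (simp add: algebra_simps)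
  then have "h - (v * f + v' * g - w * (a * e - b * c)) = 0" using reg(3) by (auto simp: nzd_def)
  then have "h - (- w) * (a * e - b * c) = v * f + v' * g" by (simp add: algebra_simps)
  then have "h - (- w) * (a * e - b * c) \<in> adjoin (adjoin {0} f) g" unfolding pair_mem_iff by blast
  then show "h \<in> adjoin (adjoin (adjoin {0} f) g) (a * e - b * c)" by (rule adjoinI)
next
  let ?Z = "adjoin (adjoin {0} f) g"
  have iZ: "is_ideal ?Z" by (intro ideal_adjoin ideal_zero)
  assume "h \<in> adjoin ?Z (a * e - b * c)"
  then obtain w where w: "h - w * (a * e - b * c) \<in> ?Z" by (rule adjoinE)
  \<comment> \<open>Cramer's rule.\<close>
  have "(a * e - b * c) * l = e * f + (- b) * g" "(a * e - b * c) * q = (- c) * f + a * g"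
    unfolding f g by (simp_all add: algebra_simps)
  then have D: "(a * e - b * c) * l \<in> ?Z" "(a * e - b * c) * q \<in> ?Z" unfolding pair_mem_iff by blast+
  have "h * x \<in> ?Z" if x: "(a * e - b * c) * x \<in> ?Z" for x
  proof -
    have "(h - w * (a * e - b * c)) * x + w * ((a * e - b * c) * x) \<in> ?Z"
      using ideal_add[OF iZ ideal_mult_right[OF iZ w] ideal_mult[OF iZ x]] .
    then show ?thesis by (simp add: algebra_simps)
  qed
  then show "h * l \<in> ?Z \<and> h * q \<in> ?Z" using D by blast
qed

lemma colon_ideal_pair:
  assumes "is_ideal Z"
  shows "h \<in> colon_ideal Z (adjoin (adjoin {0} l) q) \<longleftrightarrow> h * l \<in> Z \<and> h * q \<in> Z"
proof
  assume h: "h \<in> colon_ideal Z (adjoin (adjoin {0} l) q)"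
  then show "h * l \<in> Z \<and> h * q \<in> Z" using pair_mem[where f = l and g = q] by (auto simp: colon_ideal_def)
next
  assume h: "h * l \<in> Z \<and> h * q \<in> Z"
  show "h \<in> colon_ideal Z (adjoin (adjoin {0} l) q)"
    unfolding colon_ideal_def
  proof (clarify)
    fix x assume "x \<in> adjoin (adjoin {0} l) q"
    then obtain p t where x: "x = p * l + t * q" unfolding pair_mem_iff by blast
    have "p * (h * l) + t * (h * q) \<in> Z"
      using ideal_add[OF assms ideal_mult[OF assms] ideal_mult[OF assms]] h by blast
    then show "h * x \<in> Z" by (simp add: x algebra_simps)
  qed
qed

lemma colon_ideal_adjoin:
  assumes "is_ideal Z" shows "colon_ideal Z (adjoin Z D) = colon Z D"
proof
  show "colon_ideal Z (adjoin Z D) \<subseteq> colon Z D"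
    using adjoin_mem[OF assms] by (auto simp: colon_ideal_def colon_def mult.commute)
  show "colon Z D \<subseteq> colon_ideal Z (adjoin Z D)"
    unfolding colon_ideal_def
  proof (clarify)
    fix h x assume h: "h \<in> colon Z D" and "x \<in> adjoin Z D"
    then obtain a where "x - a * D \<in> Z" by (auto simp: adjoin_def)
    then have "h * (x - a * D) \<in> Z" by (rule ideal_mult[OF assms])
    moreover have "D * h \<in> Z" using h by (simp add: colon_def)
    then have "a * (D * h) \<in> Z" by (rule ideal_mult[OF assms])
    ultimately have "h * (x - a * D) + a * (D * h) \<in> Z" by (rule ideal_add[OF assms])
    then show "h * x \<in> Z" by (simp add: algebra_simps)
  qed
qed

text \<open>If \<open>h\<close> multiplies \<open>V\<close> into \<open>Z\<close>, this homomorphism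
  is also multiplication by some \<open>g\<close> in \<open>V'\<close>, and comparing both at the
  nonzero \<open>z\<close> gives h = g.\<close>

lemma residual_eq_colon:
  fixes Z V V' :: "('v::finite, 'k::field) mpoly set"
  assumes V: "is_ideal V" and prod: "\<forall>f\<in>V. \<forall>g\<in>V'. f * g \<in> Z" and bij: "bij_betw (\<lambda>g. \<lambda>f\<in>V. g * f) V' (ideal_hom V Z)"
    and z: "z \<in> V" "z \<noteq> 0"
  shows "V' = colon_ideal Z V"
proof
  show "V' \<subseteq> colon_ideal Z V"
  proof
    fix h assume h: "h \<in> V'"
    have "h * x \<in> Z" if "x \<in> V" for x
      using bspec[OF bspec[OF prod that] h] by (simp add: mult.commute)
    then show "h \<in> colon_ideal Z V" by (simp add: colon_ideal_def)
  qed
  show "colon_ideal Z V \<subseteq> V'"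
  proof
    fix h assume "h \<in> colon_ideal Z V"
    then have hV: "\<And>x. x \<in> V \<Longrightarrow> h * x \<in> Z" by (auto simp: colon_ideal_def)
    have "(\<lambda>f\<in>V. h * f) \<in> ideal_hom V Z"
      using hV V by (auto simp: ideal_hom_def ideal_add ideal_mult algebra_simps)
    then obtain g where g: "g \<in> V'" "(\<lambda>f\<in>V. h * f) = (\<lambda>f\<in>V. g * f)"
      using bij by (auto simp: bij_betw_def)
    have "h * z = g * z" using fun_cong[OF g(2), of z] z(1) by simp
    then have "z * h = z * g" by (simp add: mult.commute)
    then have "h = g" using z(2) by (simp add: mpoly_mult_cancel)
    then show "h \<in> V'" using g(1) by simp
  qed
qed

lemma linked_colon_ideal:
  fixes Z V V' :: "('v::finite, 'k::field) mpoly set"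
  assumes "linked Z V V'" "z \<in> Z" "z \<noteq> 0"
  shows "V' = colon_ideal Z V" "V = colon_ideal Z V'"
proof -
  have sub: "Z \<subseteq> V" "Z \<subseteq> V'" and prod: "\<forall>f\<in>V. \<forall>g\<in>V'. f * g \<in> Z"
    and bij: "bij_betw (\<lambda>g. \<lambda>f\<in>V. g * f) V' (ideal_hom V Z)" "bij_betw (\<lambda>f. \<lambda>g\<in>V'. f * g) V (ideal_hom V' Z)"
    using assms(1) unfolding linked_def by blast+
  have ideals: "is_ideal V" "is_ideal V'"
    using assms(1) by (simp_all add: linked_def proj_subscheme_def homogeneous_ideal_iff homog_ideal)
  show "V' = colon_ideal Z V"
    using residual_eq_colon[OF ideals(1) prod bij(1)] sub assms(2,3) by blast
  have "g * f \<in> Z" if "g \<in> V'" "f \<in> V" for f g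
    using bspec[OF bspec[OF prod that(2)] that(1)] by (simp add: mult.commute)
  then show "V = colon_ideal Z V'"
    using residual_eq_colon[OF ideals(2) _ bij(2)] sub assms(2,3) by blast
qed

text \<open>A homomorphism u satisfies g u(f) = f u(g). As \<open>g\<close> is regular modulo
  \<open>f\<close>, u(f) is a multiple f t, and cancelling \<open>f\<close> shows that u is
  multiplication by t.\<close>

lemma ideal_hom_colon_bij:
  fixes f g :: "('v::finite, 'k::field) mpoly"
  assumes P: "is_ideal P" and f: "f \<noteq> 0" and g: "nzd (adjoin {0} f) g" and Z: "Z = adjoin (adjoin {0} f) g" "Z \<subseteq> P"
  shows "bij_betw (\<lambda>t. \<lambda>x\<in>P. t * x) (colon_ideal Z P) (ideal_hom P Z)"
proof -
  have fgP: "f \<in> P" "g \<in> P" using Z pair_mem[where f = f and g = g] by auto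
  show ?thesis
    unfolding bij_betw_def
  proof (intro conjI)
    show "inj_on (\<lambda>t. \<lambda>x\<in>P. t * x) (colon_ideal Z P)"
    proof (rule inj_onI)
      fix s t assume "(\<lambda>x\<in>P. s * x) = (\<lambda>x\<in>P. t * x)"
      from fun_cong[OF this, of f] have "s * f = t * f" using fgP(1) by simp
      then have "f * s = f * t" by (simp add: mult.commute)
      then show "s = t" using f by (simp add: mpoly_mult_cancel)
    qed
    show "(\<lambda>t. \<lambda>x\<in>P. t * x) ` colon_ideal Z P = ideal_hom P Z"
    proof
      show "(\<lambda>t. \<lambda>x\<in>P. t * x) ` colon_ideal Z P \<subseteq> ideal_hom P Z"
        using P by (auto simp: ideal_hom_def colon_ideal_def ideal_add ideal_mult algebra_simps)
      show "ideal_hom P Z \<subseteq> (\<lambda>t. \<lambda>x\<in>P. t * x) ` colon_ideal Z P"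
      proof
        fix u assume u: "u \<in> ideal_hom P Z"
        have lin: "u (a * x) = a * u x" if "x \<in> P" for a x using u that by (auto simp: ideal_hom_def)
        have "g * u f = f * u g" using lin[OF fgP(1), of g] lin[OF fgP(2), of f] by (simp add: mult.commute)
        then have "g * u f \<in> adjoin {0} f" by (simp add: adjoin_zero)
        then have "u f \<in> adjoin {0} f" using g by (auto simp: nzd_def)
        then obtain t where t: "u f = f * t" by (auto simp: adjoin_zero dvd_def)
        have ux: "u x = t * x" if x: "x \<in> P" for x
        proof -
          have "f * u x = x * u f" using lin[OF fgP(1), of x] lin[OF x, of f] by (simp add: mult.commute)
          then have "f * u x = f * (t * x)" by (simp add: t mult_ac)
          then show ?thesis using f by (simp add: mpoly_mult_cancel)
        qed
        have "u = (\<lambda>x\<in>P. t * x)"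
          using u ux by (auto simp: ideal_hom_def fun_eq_iff PiE_def extensional_def)
        moreover have "u \<in> P \<rightarrow>\<^sub>E Z" using u by (simp add: ideal_hom_def)
        then have "u x \<in> Z" if "x \<in> P" for x using PiE_mem[OF _ that] by blast
        then have "t \<in> colon_ideal Z P" using ux by (simp add: colon_ideal_def)
        ultimately show "u \<in> (\<lambda>t. \<lambda>x\<in>P. t * x) ` colon_ideal Z P" by blast
      qed
    qed
  qed
qed

section \<open>The residual of a degenerate complete intersection\<close>

lemma pair_form_decompose:
  fixes l q :: "('v::finite, 'k::field) mpoly"
  assumes "l \<in> forms 1" "q \<in> forms r" "p \<in> forms n" "p \<in> adjoin (adjoin {0} l) q"
  shows "\<exists>a\<in>forms (n - 1). \<exists>b\<in>forms (n - r). p = a * l + b * q \<and> (n < r \<longrightarrow> b = 0)"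
proof -
  obtain b where b: "b \<in> forms (n - r)" "p - b * q \<in> adjoin {0} l" "n < r \<longrightarrow> b = 0"
    using adjoin_form[OF homog_adjoin[OF homog_zero assms(1)] assms(2,4,3)] by blast
  have "p - b * q \<in> forms n"
  proof (cases "n < r")
    case False
    then show ?thesis using forms_mult[OF b(1) assms(2)] assms(3) by (intro forms_diff) auto
  qed (use b(3) assms(3) in simp)
  then obtain a where "a \<in> forms (n - 1)" "p - b * q - a * l = 0"
    using adjoin_form[OF homog_zero assms(1) b(2)] by blast
  then show ?thesis using b by (intro bexI[of _ a] bexI[of _ b]) (auto simp: algebra_simps)
qed

lemma colon_ideal_degenerate_pair:
  fixes f g l q :: "('v::finite, 'k::field) mpoly"
  assumes fg: "f \<in> forms d" "g \<in> forms s" "f \<noteq> 0" "nzd (adjoin {0} f) g"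
    and lq: "l \<in> forms 1" "q \<in> forms r" "l \<noteq> 0" "nzd (adjoin {0} l) q"
    and sub: "f \<in> adjoin (adjoin {0} l) q" "g \<in> adjoin (adjoin {0} l) q" and r: "r < d" "s \<ge> 1"
  shows "\<exists>D\<in>forms (d + s - 1 - r).
    colon_ideal (adjoin (adjoin {0} f) g) (adjoin (adjoin {0} l) q) = adjoin (adjoin (adjoin {0} f) g) D"
proof -
  obtain a b where ab: "a \<in> forms (d - 1)" "b \<in> forms (d - r)" "f = a * l + b * q"
    using pair_form_decompose[OF lq(1,2) fg(1) sub(1)] by blast
  obtain c e where ce: "c \<in> forms (s - 1)" "e \<in> forms (s - r)" "g = c * l + e * q" "s < r \<longrightarrow> e = 0"
    using pair_form_decompose[OF lq(1,2) fg(2) sub(2)] by blast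
  \<comment> \<open>For \<open>s < r\<close> the truncated degree of \<open>e\<close> has no
    meaning, but \<open>e\<close> is zero in that case.\<close>
  have "a * e \<in> forms (d + s - 1 - r)"
  proof (cases "s < r")
    case False
    then have "d - 1 + (s - r) = d + s - 1 - r" using r by simp
    then show ?thesis using forms_mult[OF ab(1) ce(2)] by simp
  qed (use ce(4) in simp)
  moreover have "b * c \<in> forms (d + s - 1 - r)"
  proof -
    have "d - r + (s - 1) = d + s - 1 - r" using r by simp
    then show ?thesis using forms_mult[OF ab(2) ce(1)] by simp
  qed
  ultimately have D: "a * e - b * c \<in> forms (d + s - 1 - r)" by (rule forms_diff)
  have iZ: "is_ideal (adjoin (adjoin {0} f) g)" by (intro ideal_adjoin ideal_zero)
  have "colon_ideal (adjoin (adjoin {0} f) g) (adjoin (adjoin {0} l) q) =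
      adjoin (adjoin (adjoin {0} f) g) (a * e - b * c)"
    using colon_ideal_pair[OF iZ] colon_pair[OF nzd_zero[OF fg(3)] fg(4) nzd_zero[OF lq(3)] lq(4) ab(3) ce(3)]
    by blast
  then show ?thesis using D by blast
qed

text \<open>With D the determinant, \<Delta> is Z + (D) and L is Z : D, so the exact sequence of
  \<open>hilbert_series_adjoin\<close> gives the series.\<close>

lemma residual_hilbert_series:
  fixes Z L \<Delta> :: "('v::finite, 'k::field) mpoly set"
  assumes Z: "complete_intersection d s Z" and L: "complete_intersection 1 r L" and link: "linked Z L \<Delta>"
    and r: "r < d" "s \<ge> 1"
  shows "hilbert_series \<Delta> = ((1 - fps_X ^ d) * (1 - fps_X ^ s) - fps_X ^ (d + s - 1 - r) * (1 - fps_X) * (1 - fps_X ^ r))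
    * hilbert_series ({0} :: ('v, 'k) mpoly set)"
proof -
  obtain f g where fg: "f \<in> forms d" "g \<in> forms s" "f \<noteq> 0" "nzd (adjoin {0} f) g" "Z = adjoin (adjoin {0} f) g"
    using complete_intersection_regular[OF Z] by blast
  obtain l q where lq: "l \<in> forms 1" "q \<in> forms r" "l \<noteq> 0" "nzd (adjoin {0} l) q" "L = adjoin (adjoin {0} l) q"
    using complete_intersection_regular[OF L] by blast
  have hZ: "homog Z" using homog_pair[OF fg(1,2)] fg(5) by simp
  note iZ = homog_ideal[OF hZ]
  have fZ: "f \<in> Z" "g \<in> Z" unfolding fg(5) by (rule pair_mem)+
  have "Z \<subseteq> L" using link by (simp add: linked_def)
  have D1: "\<Delta> = colon_ideal Z L" and D2: "L = colon_ideal Z \<Delta>"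
    using linked_colon_ideal[OF link fZ(1) fg(3)] by simp_all
  obtain D where D: "D \<in> forms (d + s - 1 - r)" "colon_ideal Z L = adjoin Z D"
    using colon_ideal_degenerate_pair[OF fg(1-4) lq(1-4) _ _ r] fZ \<open>Z \<subseteq> L\<close> fg(5) lq(5) by blast
  have "L = colon Z D" using D2 D1 D(2) colon_ideal_adjoin[OF iZ] by simp
  then have "hilbert_series \<Delta> = hilbert_series Z - fps_X ^ (d + s - 1 - r) * hilbert_series L"
    using hilbert_series_adjoin[OF hZ D(1)] D1 D(2) by simp
  then show ?thesis
    using hilbert_series_pair[OF fg(1-4)] hilbert_series_pair[OF lq(1-4)] fg(5) lq(5)
    by (simp add: algebra_simps)
qed


section \<open>Growth of Hilbert functions of plane sections\<close>

text \<open>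
  \<open>K\<close> plays the role of the ideal of a line, so that \<open>A / K\<close> is a polynomial ring in two variables.
\<close>

locale line_ideal =
  fixes K :: "('v::finite, 'k::{alg_closed_field, field_char_0}) mpoly set"
  assumes homogK: "homog K" and seriesK: "fps_delta ^ 2 * hilbert_series K = 1"
begin

lemma idealK: "is_ideal K" by (rule homog_ideal[OF homogK])

lemma hilbertK: "hilbert_fun K i = i + 1"
proof -
  have "fps_delta * (fps_delta * hilbert_series K) = fps_delta * (fps_delta * Abs_fps (\<lambda>i. int i + 1))"
  proof -
    have "fps_delta * Abs_fps (\<lambda>i. int i + 1) = Abs_fps (\<lambda>i. 1)"
      by (rule fps_ext) (simp add: nth_delta_mult of_nat_diff)
    moreover have "fps_delta * Abs_fps (\<lambda>i. 1) = 1"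
      by (rule fps_ext) (simp add: nth_delta_mult)
    ultimately show ?thesis using seriesK by (simp add: power2_eq_square mult.assoc)
  qed
  then have "hilbert_series K = Abs_fps (\<lambda>i. int i + 1)" by (simp only: delta_cancel)
  then have "fps_nth (hilbert_series K) i = int i + 1" by simp
  then show ?thesis by simp
qed

lemma hilbert_fun_adjoin_linear:
  assumes I: "homog I" and u: "u \<in> forms 1"
  shows "hilbert_fun (adjoin I u) (Suc i) + hilbert_fun (colon I u) i = hilbert_fun I (Suc i)"
proof -
  have "fps_nth (hilbert_series (adjoin I u)) (Suc i) =
      fps_nth (hilbert_series I - fps_X ^ 1 * hilbert_series (colon I u)) (Suc i)"
    by (simp only: hilbert_series_adjoin[OF I u])
  then have "int (hilbert_fun (adjoin I u) (Suc i)) + int (hilbert_fun (colon I u) i) = int (hilbert_fun I (Suc i))"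
    by simp
  then show ?thesis by linarith
qed

text \<open>Multiplication by \<open>u\<close> goes from a space of dimension at most
  \<open>i\<close> to one of dimension \<open>i + 1\<close>, so it is not onto.\<close>

lemma hilbert_adjoin_pos: assumes u: "u \<in> forms 1" shows "hilbert_fun (adjoin K u) i \<noteq> 0"
proof (cases i)
  case 0
  have "hilbert_fun (adjoin K u) 0 = hilbert_fun K 0"
    using form_dim_adjoin_low[OF homogK u, of 0] by (simp add: hilbert_fun_dim)
  then show ?thesis using 0 hilbertK by simp
next
  case (Suc j)
  have "hilbert_fun (colon K u) j \<le> j + 1"
    using hilbert_fun_mono[OF colon_superset[OF idealK, of u], of j] hilbertK by simp
  then show ?thesis using hilbert_fun_adjoin_linear[OF homogK u, of j] hilbertK[of "Suc j"] Suc by simp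
qed

lemma hilbert_0_pos: assumes "is_ideal I" "1 \<notin> I" shows "hilbert_fun I 0 \<ge> 1"
  using hilbert_fun_eq_0[OF assms(1), of 0] assms(2) forms_one by (metis One_nat_def Suc_leI neq0_conv subsetD)

text \<open>K + (u) leaves dimension one in degree 1, and any linear form outside it spans the
  rest.\<close>

lemma complement_exists:
  assumes u: "u \<in> forms 1" "u \<notin> K"
  shows "\<exists>v\<in>forms 1. v \<notin> adjoin K u \<and> forms 1 \<subseteq> adjoin (adjoin K u) v"
proof -
  let ?I = "adjoin K u"
  have hI: "homog ?I" by (rule homog_adjoin[OF homogK u(1)])
  note iI = homog_ideal[OF hI]
  have "hilbert_fun (colon K u) 0 \<ge> 1"
    using u(2) by (intro hilbert_0_pos ideal_colon idealK) (simp add: colon_def)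
  then have I1: "hilbert_fun ?I 1 \<le> 1"
    using hilbert_fun_adjoin_linear[OF homogK u(1), of 0] hilbertK[of 1] by simp
  have "\<not> forms 1 \<subseteq> ?I" using hilbert_fun_eq_0[OF iI, of 1] hilbert_adjoin_pos[OF u(1), of 1] by simp
  then obtain v where v: "v \<in> forms 1" "v \<notin> ?I" by blast
  have "hilbert_fun (colon ?I v) 0 \<ge> 1"
    using v(2) by (intro hilbert_0_pos ideal_colon iI) (simp add: colon_def)
  then have "hilbert_fun (adjoin ?I v) 1 = 0"
    using hilbert_fun_adjoin_linear[OF hI v(1), of 0] I1 by simp
  then have "forms 1 \<subseteq> adjoin ?I v" using hilbert_fun_eq_0[OF ideal_adjoin[OF iI]] by blast
  then show ?thesis using v by blast
qed

lemma linear_form_exists: "\<exists>u\<in>forms 1. u \<notin> K"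
proof -
  have "\<not> forms 1 \<subseteq> K" using hilbert_fun_eq_0[OF idealK, of 1] hilbertK[of 1] by simp
  then show ?thesis by blast
qed

text \<open>Modulo K + (u) only the powers of \<open>v\<close> survive: every form of positive
  degree is a multiple of \<open>v\<close> there.\<close>

lemma form_eq_power:
  assumes u: "u \<in> forms 1" and v: "v \<in> forms 1" "forms 1 \<subseteq> adjoin (adjoin K u) v"
    and f: "f \<in> forms d"
  shows "\<exists>c. f - mpoly_scale c (v ^ d) \<in> adjoin K u"
  using f
proof (induction d arbitrary: f)
  case 0
  then have "f = mpoly_scale (coeff_at f 0) (v ^ 0)"
    using forms_zero_const[of f] by (simp add: mpoly_scale_def)
  then show ?case using ideal_0[OF ideal_adjoin[OF idealK]] by (metis diff_self)
next
  case (Suc d)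
  let ?I = "adjoin K u"
  have hI: "homog ?I" by (rule homog_adjoin[OF homogK u])
  note iI = homog_ideal[OF hI]
  have "mpoly_var i \<in> adjoin ?I v" for i using v(2) forms_var[of i] by (rule subsetD)
  then have "f \<in> adjoin ?I v" using pos_form_mem[OF ideal_adjoin[OF iI] _ Suc.prems] by blast
  then obtain w where w: "w \<in> forms d" "f - w * v \<in> ?I"
    using adjoin_form[OF hI v(1) _ Suc.prems] by auto
  obtain c where c: "w - mpoly_scale c (v ^ d) \<in> ?I" using Suc.IH[OF w(1)] by blast
  have "(f - w * v) + v * (w - mpoly_scale c (v ^ d)) \<in> ?I"
    using ideal_add[OF iI w(2) ideal_mult[OF iI c]] .
  moreover have "(f - w * v) + v * (w - mpoly_scale c (v ^ d)) = f - mpoly_scale c (v ^ Suc d)"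
    by (simp add: mpoly_scale_def algebra_simps)
  ultimately show ?case by metis
qed

text \<open>Modulo K + (u) the form \<open>f\<close> is a nonzero scalar times a power of a linear
  form, and that power divides every form of degree at least \<open>d\<close>.\<close>

lemma forms_subset_adjoin:
  assumes u: "u \<in> forms 1" "u \<notin> K" and f: "f \<in> forms d" "f \<notin> adjoin K u" and "d \<le> i"
  shows "forms i \<subseteq> adjoin (adjoin K u) f"
proof
  fix p :: "('v, 'k) mpoly" assume p: "p \<in> forms i"
  obtain v where v: "v \<in> forms 1" "forms 1 \<subseteq> adjoin (adjoin K u) v" using complement_exists[OF u] by blast
  let ?I = "adjoin K u" and ?J = "adjoin (adjoin K u) f"
  have iI: "is_ideal ?I" by (rule ideal_adjoin[OF idealK])
  have iJ: "is_ideal ?J" by (rule ideal_adjoin[OF iI])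
  have IJ: "?I \<subseteq> ?J" by (rule adjoin_superset)
  obtain c where c: "f - mpoly_scale c (v ^ d) \<in> ?I" using form_eq_power[OF u(1) v f(1)] by blast
  have "c \<noteq> 0" using c f(2) by auto
  have "f \<in> ?J" by (rule adjoin_mem[OF iI])
  then have "f - (f - mpoly_scale c (v ^ d)) \<in> ?J" using ideal_diff[OF iJ _ subsetD[OF IJ c]] by blast
  then have "v ^ d \<in> ?J" using scale_mem_ideal_iff[OF iJ \<open>c \<noteq> 0\<close>] by simp
  then have "v ^ (i - d) * v ^ d \<in> ?J" by (rule ideal_mult[OF iJ])
  then have vi: "v ^ i \<in> ?J" using \<open>d \<le> i\<close> by (simp add: power_add[symmetric])
  obtain b where "p - mpoly_scale b (v ^ i) \<in> ?I" using form_eq_power[OF u(1) v p] by blast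
  then have "(p - mpoly_scale b (v ^ i)) + mpoly_scale b (v ^ i) \<in> ?J"
    using IJ vi mpoly.subspace_scale[OF ideal_subspace[OF iJ]] by (intro ideal_add[OF iJ]) auto
  then show "p \<in> ?J" by simp
qed

text \<open>By assumption multiplication by \<open>u\<close> maps degree \<open>i\<close> of A / J
  onto degree \<open>i + 1\<close>. Equal dimensions make it bijective, whence the second
  claim.\<close>

lemma hilbert_decrease:
  assumes J: "homog J" and u: "u \<in> forms 1" and sur: "forms (Suc i) \<subseteq> adjoin J u"
  shows "hilbert_fun J (Suc i) \<le> hilbert_fun J i"
    and "hilbert_fun J (Suc i) = hilbert_fun J i \<Longrightarrow> z \<in> forms i \<Longrightarrow> u * z \<in> J \<Longrightarrow> z \<in> J"
proof -
  note iJ = homog_ideal[OF J]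
  have "hilbert_fun (adjoin J u) (Suc i) = 0" using hilbert_fun_eq_0[OF ideal_adjoin[OF iJ]] sur by blast
  then have eq: "hilbert_fun (colon J u) i = hilbert_fun J (Suc i)"
    using hilbert_fun_adjoin_linear[OF J u, of i] by simp
  then show "hilbert_fun J (Suc i) \<le> hilbert_fun J i"
    using hilbert_fun_mono[OF colon_superset[OF iJ, of u], of i] by simp
  assume "hilbert_fun J (Suc i) = hilbert_fun J i" "z \<in> forms i" "u * z \<in> J"
  then have "z \<in> forms i \<inter> colon J u" "hilbert_fun J i = hilbert_fun (colon J u) i"
    using eq by (simp_all add: colon_def)
  then show "z \<in> J" using hilbert_fun_eq_imp[OF colon_superset[OF iJ] iJ] by blast
qed

text \<open>There are infinitely many indices in a finite-dimensional space. Recording the relation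
  as a polynomial makes roots available; a repetition in the sequence is a case of its own, since
  the image set would forget it.\<close>

lemma exists_relation:
  fixes w :: "nat \<Rightarrow> ('v, 'k) mpoly"
  assumes w: "\<And>j. w j \<in> forms i"
  shows "\<exists>p :: 'k poly. p \<noteq> 0 \<and> (\<Sum>j\<le>degree p. mpoly_scale (coeff p j) (w j)) = 0"
proof -
  have trunc: "(\<Sum>j\<le>degree p. mpoly_scale (coeff p j) (w j)) = (\<Sum>j\<le>n. mpoly_scale (coeff p j) (w j))"
    if "degree p \<le> n" for p :: "'k poly" and n
    using that by (intro sum.mono_neutral_left) (auto simp: coeff_eq_0)
  obtain A where A: "finite A" "forms i \<subseteq> mpoly.span (A :: ('v, 'k) mpoly set)"
    using forms_finite_dim by blast
  define n where "n = card A"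
  show ?thesis
  proof (cases "inj_on w {..n}")
    case False
    then obtain a b where ab: "a < b" "w a = w b" unfolding inj_on_def by (metis nat_neq_iff)
    define p :: "'k poly" where "p = monom 1 b - monom 1 a"
    have "coeff p b = 1" using ab(1) by (simp add: p_def)
    then have "p \<noteq> 0" by auto
    moreover have "degree p \<le> b" unfolding p_def using ab(1)
      by (intro degree_diff_le) (auto intro: order_trans[OF degree_monom_le])
    then have "(\<Sum>j\<le>degree p. mpoly_scale (coeff p j) (w j)) = (\<Sum>j\<le>b. mpoly_scale (coeff p j) (w j))"
      by (rule trunc)
    moreover have "(\<Sum>j\<le>b. mpoly_scale (coeff p j) (w j)) =
        (\<Sum>j\<le>b. if j = b then w j else 0) - (\<Sum>j\<le>b. if j = a then w j else 0)"
      unfolding sum_subtractf[symmetric] using ab(1) by (intro sum.cong) (auto simp: p_def)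
    then have "(\<Sum>j\<le>b. mpoly_scale (coeff p j) (w j)) = 0" using ab by simp
    ultimately show ?thesis by metis
  next
    case True
    have "card (w ` {..n}) = Suc n" using True by (simp add: card_image)
    moreover have "w ` {..n} \<subseteq> mpoly.span A" using w A(2) by blast
    ultimately have "mpoly.dependent (w ` {..n})"
      using mpoly.independent_span_bound[OF A(1), of "w ` {..n}"] by (auto simp: n_def)
    then obtain c v where c: "v \<in> w ` {..n}" "c v \<noteq> 0" "(\<Sum>v\<in>w ` {..n}. mpoly_scale (c v) v) = 0"
      using mpoly.dependent_finite[of "w ` {..n}"] by auto
    define p where "p = (\<Sum>j\<le>n. monom (c (w j)) j)"
    have cp: "coeff p j = (if j \<le> n then c (w j) else 0)" for j
      by (simp add: p_def coeff_sum)
    obtain j where "j \<le> n" "v = w j" using c(1) by auto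
    then have "coeff p j \<noteq> 0" using c(2) cp by simp
    then have "p \<noteq> 0" by auto
    have "degree p \<le> n" using cp by (intro degree_le) auto
    then have "(\<Sum>j\<le>degree p. mpoly_scale (coeff p j) (w j)) = (\<Sum>j\<le>n. mpoly_scale (coeff p j) (w j))"
      by (rule trunc)
    moreover have "(\<Sum>j\<le>n. mpoly_scale (coeff p j) (w j)) = (\<Sum>j\<le>n. mpoly_scale (c (w j)) (w j))"
      by (intro sum.cong) (auto simp: cp)
    ultimately have "(\<Sum>j\<le>degree p. mpoly_scale (coeff p j) (w j)) = 0"
      using c(3) True by (simp add: sum.reindex)
    with \<open>p \<noteq> 0\<close> show ?thesis by blast
  qed
qed

text \<open>
  If multiplication by every linear form were bijective from degree \<open>i\<close> to degree \<open>i + 1\<close>, then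
  \<open>x / y\<close> would act on the degree \<open>i\<close> part without an eigenvalue.
\<close>

lemma hilbert_strict_decrease:
  assumes J: "homog J"
    and sur: "\<And>u. u \<in> forms 1 \<Longrightarrow> u \<notin> K \<Longrightarrow> forms (Suc i) \<subseteq> adjoin J u"
  shows "hilbert_fun J (Suc i) < hilbert_fun J i \<or> hilbert_fun J (Suc i) = 0"
proof (rule ccontr)
  note iJ = homog_ideal[OF J]
  assume "\<not> (hilbert_fun J (Suc i) < hilbert_fun J i \<or> hilbert_fun J (Suc i) = 0)"
  then have neg: "\<not> hilbert_fun J (Suc i) < hilbert_fun J i" "hilbert_fun J (Suc i) \<noteq> 0" by auto
  obtain y where y: "y \<in> forms 1" "y \<notin> K" using linear_form_exists by blast
  obtain x where x: "x \<in> forms 1" "x \<notin> adjoin K y" using complement_exists[OF y] by blast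
  have eq: "hilbert_fun J (Suc i) = hilbert_fun J i"
    using hilbert_decrease(1)[OF J y(1) sur[OF y]] neg by linarith
  have inj: "z \<in> J" if "u \<in> forms 1" "u \<notin> K" "z \<in> forms i" "u * z \<in> J" for u z
    using hilbert_decrease(2)[OF J that(1) sur[OF that(1,2)] eq that(3,4)] .
  have "\<not> forms i \<subseteq> J" using neg(2) eq hilbert_fun_eq_0[OF iJ, of i] by simp
  then obtain z0 where z0: "z0 \<in> forms i" "z0 \<notin> J" by blast
  have "\<forall>w. \<exists>w'. w \<in> forms i \<longrightarrow> w' \<in> forms i \<and> x * w - y * w' \<in> J"
  proof (intro allI)
    fix w :: "('v, 'k) mpoly"
    show "\<exists>w'. w \<in> forms i \<longrightarrow> w' \<in> forms i \<and> x * w - y * w' \<in> J"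
    proof (cases "w \<in> forms i")
      case True
      then have xw: "x * w \<in> forms (Suc i)" using forms_mult[OF x(1)] by fastforce
      then have "x * w \<in> adjoin J y" using sur[OF y] by blast
      then obtain w' where "w' \<in> forms (Suc i - 1)" "x * w - w' * y \<in> J"
        using adjoin_form[OF J y(1) _ xw] by blast
      then show ?thesis by (intro exI[of _ w']) (simp add: mult.commute)
    qed simp
  qed
  \<comment> \<open>\<open>st\<close> acts as x / y on degree \<open>i\<close> modulo
    \<open>J\<close>. It is only a choice of quotients and need not be linear; just its orbit
    through \<open>z0\<close> matters.\<close>
  then obtain st where st: "\<And>w. w \<in> forms i \<Longrightarrow> st w \<in> forms i \<and> x * w - y * st w \<in> J" by metis
  define w where "w j = (st ^^ j) z0" for j
  have wf: "w j \<in> forms i" for j by (induction j) (simp_all add: w_def z0 st)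
  have wS: "x * w j - y * w (Suc j) \<in> J" for j using st[OF wf[of j]] by (simp add: w_def)
  \<comment> \<open>The polynomial \<open>p\<close> evaluated at x / y and applied to
    \<open>z0\<close>.\<close>
  define \<Phi> where "\<Phi> p = (\<Sum>j\<le>degree p. mpoly_scale (coeff p j) (w j))" for p :: "'k poly"
  have \<Phi>_forms: "\<Phi> p \<in> forms i" for p
    unfolding \<Phi>_def by (intro forms_sum forms_scale wf)
  have "\<exists>p. p \<noteq> 0 \<and> \<Phi> p \<in> J"
    using exists_relation[of w i, OF wf] ideal_0[OF iJ] unfolding \<Phi>_def by metis
  then obtain p0 where p0: "p0 \<noteq> 0 \<and> \<Phi> p0 \<in> J" by blast
  \<comment> \<open>A minimal polynomial of \<open>z0\<close>. For a root \<mu> of it, x - \<mu> y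
    kills the value of the quotient by that root, which is nonzero modulo \<open>J\<close> by
    minimality.\<close>
  obtain p where p: "p \<noteq> 0" "\<Phi> p \<in> J" and min: "\<And>q. q \<noteq> 0 \<Longrightarrow> \<Phi> q \<in> J \<Longrightarrow> degree p \<le> degree q"
    using ex_has_least_nat[of "\<lambda>p. p \<noteq> 0 \<and> \<Phi> p \<in> J", OF p0, of degree] by blast
  have "degree p \<noteq> 0"
  proof
    assume "degree p = 0"
    then obtain c where c: "p = [:c:]" by (rule degree_eq_zeroE)
    then have "mpoly_scale c z0 \<in> J" using p(2) by (simp add: \<Phi>_def w_def)
    then show False using scale_mem_ideal_iff[OF iJ, of c z0] p(1) c z0(2) by simp
  qed
  then obtain \<mu> where "poly p \<mu> = 0" using alg_closed_imp_poly_has_root[of p] by auto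
  then obtain q where q: "p = [:- \<mu>, 1:] * q" by (metis dvdE poly_eq_0_iff_dvd)
  then have q0: "q \<noteq> 0" using p(1) by auto
  have dp: "degree p = Suc (degree q)" using q0 unfolding q by (subst degree_mult_eq) auto
  have "\<Phi> p = (\<Sum>j\<le>Suc (degree q). mpoly_scale (coeff (pCons 0 q) j) (w j)) -
      (\<Sum>j\<le>Suc (degree q). mpoly_scale (\<mu> * coeff q j) (w j))"
    unfolding \<Phi>_def dp sum_subtractf[symmetric] mpoly.scale_left_diff_distrib[symmetric] by (simp add: q)
  also have "(\<Sum>j\<le>Suc (degree q). mpoly_scale (coeff (pCons 0 q) j) (w j)) =
      (\<Sum>j\<le>degree q. mpoly_scale (coeff q j) (w (Suc j)))"
    by (subst sum.atMost_Suc_shift) simp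
  also have "(\<Sum>j\<le>Suc (degree q). mpoly_scale (\<mu> * coeff q j) (w j)) = mpoly_scale \<mu> (\<Phi> q)"
    by (simp add: \<Phi>_def mpoly.scale_sum_right coeff_eq_0)
  finally have \<Phi>p: "\<Phi> p = (\<Sum>j\<le>degree q. mpoly_scale (coeff q j) (w (Suc j))) - mpoly_scale \<mu> (\<Phi> q)" .
  define u where "u = x - mpoly_scale \<mu> y"
  have u: "u \<in> forms 1" unfolding u_def using x(1) y(1) by (intro forms_diff forms_scale)
  have "u \<notin> K"
  proof
    assume "u \<in> K"
    then have "x - Poly_Mapping.single 0 \<mu> * y \<in> K" by (simp add: u_def mpoly_scale_def)
    then show False using x(2) by (auto simp: adjoin_def)
  qed
  have "u * \<Phi> q - y * \<Phi> p = (\<Sum>j\<le>degree q. mpoly_scale (coeff q j) (x * w j - y * w (Suc j)))"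
  proof -
    have "u * \<Phi> q - y * \<Phi> p = x * \<Phi> q - y * (\<Sum>j\<le>degree q. mpoly_scale (coeff q j) (w (Suc j)))"
      unfolding \<Phi>p u_def by (simp add: mpoly_scale_def algebra_simps)
    then show ?thesis
      by (simp add: \<Phi>_def sum_distrib_left sum_subtractf mpoly_scale_def algebra_simps)
  qed
  also have "\<dots> \<in> J" by (intro ideal_sum[OF iJ] mpoly.subspace_scale[OF ideal_subspace[OF iJ]] wS)
  finally have "u * \<Phi> q \<in> J" using ideal_cong[OF iJ] ideal_mult[OF iJ p(2)] by blast
  then have "\<Phi> q \<in> J" using inj[OF u \<open>u \<notin> K\<close> \<Phi>_forms] by blast
  then show False using min[OF q0] dp by simp
qed

text \<open>\<open>f\<close> and \<open>g\<close> do not both vanish modulo K + (u), because that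
  quotient is nonzero in degree \<open>N\<close>. The one that survives makes multiplication by
  \<open>u\<close> onto in degree \<open>i + 1\<close>.\<close>

lemma hilbert_strict_decrease_pair:
  assumes J: "homog J" and KJ: "K \<subseteq> J"
    and f: "f \<in> forms d" "f \<in> J" and g: "g \<in> forms e" "g \<in> J" and N: "forms N \<subseteq> adjoin (adjoin K f) g"
    and i: "d \<le> Suc i" "e \<le> Suc i"
  shows "hilbert_fun J (Suc i) < hilbert_fun J i \<or> hilbert_fun J (Suc i) = 0"
proof (rule hilbert_strict_decrease[OF J])
  fix u :: "('v, 'k) mpoly" assume u: "u \<in> forms 1" "u \<notin> K"
  have iI: "is_ideal (adjoin K u)" by (rule ideal_adjoin[OF idealK])
  have iJ: "is_ideal (adjoin J u)" by (rule ideal_adjoin[OF homog_ideal[OF J]])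
  have "\<not> (f \<in> adjoin K u \<and> g \<in> adjoin K u)"
  proof
    assume "f \<in> adjoin K u \<and> g \<in> adjoin K u"
    then have "adjoin (adjoin K f) g \<subseteq> adjoin K u"
      using adjoin_superset[of K u] by (intro adjoin_minimal[OF adjoin_minimal] iI) auto
    then have "forms N \<subseteq> adjoin K u" using N by blast
    then show False using hilbert_fun_eq_0[OF iI] hilbert_adjoin_pos[OF u(1)] by blast
  qed
  then consider "f \<notin> adjoin K u" | "g \<notin> adjoin K u" by blast
  then obtain p n where p: "p \<in> forms n" "p \<in> J" "p \<notin> adjoin K u" "n \<le> Suc i"
    using f g i by metis
  have "adjoin (adjoin K u) p \<subseteq> adjoin J u"
    using adjoin_mono[OF KJ, of u] p(2) adjoin_superset[of J u] by (intro adjoin_minimal[of "adjoin K u"] iJ) auto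
  then show "forms (Suc i) \<subseteq> adjoin J u" using forms_subset_adjoin[OF u p(1,3,4)] by blast
qed

section \<open>Sections of hypersurfaces and complete intersections, and the socle\<close>

lemma hilbert_series_adjoin_ramp:
  assumes f: "f \<in> forms d" and nzd: "nzd K f"
  shows "hilbert_series (adjoin K f) = fps_ramp d"
proof -
  have "fps_delta * (fps_delta * hilbert_series (adjoin K f)) = (1 - fps_X ^ d) * (fps_delta ^ 2 * hilbert_series K)"
    using hilbert_series_adjoin_nzd[OF homogK f nzd] by (simp add: power2_eq_square mult_ac)
  also have "\<dots> = fps_delta * (fps_delta * fps_ramp d)" by (simp add: seriesK delta_interval delta_ramp)
  finally show ?thesis by (simp only: delta_cancel)
qed

text \<open>A generic \<open>u\<close> leaves the quotient by K + (f) only degrees below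
  \<open>d\<close>, so multiplication by \<open>u\<close> is onto in every degree from
  \<open>d\<close> on.\<close>

lemma hilbert_weak_decrease:
  assumes J: "homog J" and KJ: "K \<subseteq> J" and f: "f \<in> forms d" "f \<in> J" "nzd K f"
    and depth: "depth_ge (adjoin K f) 1" and i: "d \<le> Suc i"
  shows "hilbert_fun J (Suc i) \<le> hilbert_fun J i"
proof -
  have hI: "homog (adjoin K f)" by (rule homog_adjoin[OF homogK f(1)])
  obtain u where u: "u \<in> forms 1" "nzd (adjoin K f) u"
    using generic_linear_form[of "{(adjoin K f, 0)}"] hI depth by auto
  have "hilbert_series (adjoin (adjoin K f) u) = fps_interval d"
    using hilbert_series_adjoin_nzd[OF hI u] hilbert_series_adjoin_ramp[OF f(1,3)] by (simp add: delta_ramp)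
  then have "fps_nth (hilbert_series (adjoin (adjoin K f) u)) (Suc i) = 0" using i by simp
  then have "forms (Suc i) \<subseteq> adjoin (adjoin K f) u"
    using hilbert_fun_eq_0[OF ideal_adjoin[OF homog_ideal[OF hI]]] by simp
  also have "\<dots> \<subseteq> adjoin J u" by (intro adjoin_mono adjoin_minimal KJ f(2) homog_ideal[OF J])
  finally show ?thesis by (rule hilbert_decrease(1)[OF J u(1)])
qed

lemma hilbert_series_pair_K:
  assumes f: "f \<in> forms d" "nzd K f" and g: "g \<in> forms e" "nzd (adjoin K f) g"
  shows "hilbert_series (adjoin (adjoin K f) g) = fps_interval d * fps_interval e"
proof -
  have "hilbert_series (adjoin (adjoin K f) g) = (1 - fps_X ^ e) * fps_ramp d"
    using hilbert_series_adjoin_nzd[OF homog_adjoin[OF homogK f(1)] g] hilbert_series_adjoin_ramp[OF f] by simp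
  also have "\<dots> = fps_interval e * (fps_delta * fps_ramp d)"
    by (simp only: delta_interval[symmetric] mult_ac)
  finally show ?thesis unfolding delta_ramp by (simp only: mult.commute)
qed

text \<open>
  Eliminating \<open>z\<close> from \<open>x z = a f + b g\<close> and \<open>y z = a' f + b' g\<close> makes \<open>y b - x b'\<close> a multiple of
  \<open>f\<close> of degree less than \<open>d\<close>, so \<open>x\<close> divides \<open>b\<close>, and likewise \<open>a\<close>.
\<close>

lemma socle_pair:
  assumes f: "f \<in> forms d" "nzd K f" and g: "g \<in> forms e" "nzd (adjoin K f) g"
    and x: "x \<in> forms 1" "nzd K x" and y: "y \<in> forms 1" "nzd (adjoin K x) y"
    and z: "z \<in> forms i" "i + 2 < d + e"
    and mem: "x * z \<in> adjoin (adjoin K f) g" "y * z \<in> adjoin (adjoin K f) g"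
  shows "z \<in> adjoin (adjoin K f) g"
proof -
  note hF = homog_adjoin[OF homogK f(1)]
  have dec: "\<exists>a\<in>forms (Suc i - d). \<exists>b\<in>forms (Suc i - e). p - a * f - b * g \<in> K \<and> (Suc i < d \<longrightarrow> a = 0) \<and> (Suc i < e \<longrightarrow> b = 0)"
    if p: "p \<in> forms (Suc i)" "p \<in> adjoin (adjoin K f) g" for p
  proof -
    obtain b where b: "b \<in> forms (Suc i - e)" "p - b * g \<in> adjoin K f" "Suc i < e \<longrightarrow> b = 0"
      using adjoin_form[OF hF g(1) p(2,1)] by blast
    have "p - b * g \<in> forms (Suc i)"
    proof (cases "Suc i < e")
      case False
      then show ?thesis using forms_mult[OF b(1) g(1)] p(1) by (intro forms_diff) auto
    qed (use b(3) p(1) in simp)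
    then obtain a where "a \<in> forms (Suc i - d)" "p - b * g - a * f \<in> K" "Suc i < d \<longrightarrow> a = 0"
      using adjoin_form[OF homogK f(1) b(2)] by blast
    then show ?thesis using b by (intro bexI[of _ a] bexI[of _ b]) (auto simp: algebra_simps)
  qed
  have "x * z \<in> forms (Suc i)" "y * z \<in> forms (Suc i)"
    using forms_mult[OF x(1) z(1)] forms_mult[OF y(1) z(1)] by simp_all
  then obtain a b a' b' where
    a: "a \<in> forms (Suc i - d)" "Suc i < d \<longrightarrow> a = 0" and b: "b \<in> forms (Suc i - e)" "Suc i < e \<longrightarrow> b = 0"
    and xz: "x * z - a * f - b * g \<in> K"
    and a': "a' \<in> forms (Suc i - d)" "Suc i < d \<longrightarrow> a' = 0" and b': "b' \<in> forms (Suc i - e)" "Suc i < e \<longrightarrow> b' = 0"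
    and yz: "y * z - a' * f - b' * g \<in> K"
    using dec[OF _ mem(1)] dec[OF _ mem(2)] by metis
  have "x * (y * z - a' * f - b' * g) - y * (x * z - a * f - b * g) \<in> K"
    using ideal_diff[OF idealK ideal_mult[OF idealK yz] ideal_mult[OF idealK xz]] .
  moreover have "x * (y * z - a' * f - b' * g) - y * (x * z - a * f - b * g) =
      g * (y * b - x * b') - (x * a' - y * a) * f" by (simp add: algebra_simps)
  ultimately have syz: "g * (y * b - x * b') - (x * a' - y * a) * f \<in> K" by simp
  then have "g * (y * b - x * b') \<in> adjoin K f" by (rule adjoinI)
  then have yb: "y * b - x * b' \<in> adjoin K f" using g(2) by (auto simp: nzd_def)
  \<comment> \<open>Its degree i + 2 - e is less than d, so the multiplier of \<open>f\<close> in
    \<open>yb\<close> is zero.\<close>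
  have "y * b - x * b' \<in> K"
  proof (cases "Suc i < e")
    case True then show ?thesis using b b' ideal_0[OF idealK] by simp
  next
    case False
    have "y * b - x * b' \<in> forms (1 + (Suc i - e))"
      using b(1) b'(1) x(1) y(1) by (intro forms_diff forms_mult)
    then obtain w where "y * b - x * b' - w * f \<in> K" "1 + (Suc i - e) < d \<longrightarrow> w = 0"
      using adjoin_form[OF homogK f(1) yb] by blast
    then show ?thesis using False z(2) by simp
  qed
  then have ybx: "y * b - x * b' \<in> K" .
  have "(g * (y * b - x * b') - (x * a' - y * a) * f) - g * (y * b - x * b') \<in> K"
    using ideal_diff[OF idealK syz ideal_mult[OF idealK ybx]] .
  then have "f * (y * a - x * a') \<in> K" by (simp add: algebra_simps)
  then have yax: "y * a - x * a' \<in> K" using f(2) by (auto simp: nzd_def)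
  have div: "\<exists>c'. c - c' * x \<in> K" if "y * c - x * c1 \<in> K" for c c1
  proof -
    have "y * c \<in> adjoin K x" using that by (intro adjoinI[of _ c1]) (simp add: mult.commute)
    then have "c \<in> adjoin K x" using y(2) by (auto simp: nzd_def)
    then show ?thesis by (auto simp: adjoin_def)
  qed
  obtain a2 where a2: "a - a2 * x \<in> K" using div[OF yax] by blast
  obtain b2 where b2: "b - b2 * x \<in> K" using div[OF ybx] by blast
  have "(x * z - a * f - b * g) + (f * (a - a2 * x) + g * (b - b2 * x)) \<in> K"
    using ideal_add[OF idealK xz ideal_add[OF idealK ideal_mult[OF idealK a2] ideal_mult[OF idealK b2]]] .
  then have "x * (z - a2 * f - b2 * g) \<in> K" by (simp add: algebra_simps)
  then have "z - a2 * f - b2 * g \<in> K" using x(2) by (auto simp: nzd_def)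
  then have "z - b2 * g - a2 * f \<in> K" by (simp add: algebra_simps)
  then show ?thesis by (intro adjoinI)
qed

end


section \<open>Comparison of partial sums\<close>

text \<open>\<open>h\<close> belongs to the section of Y, \<open>g\<close> to that of \<Delta>. At
  the first violation h < g, which excludes degrees below \<open>e\<close>, where \<open>h\<close>
  reaches the upper bound of \<open>g\<close>. From there on \<open>h\<close> never exceeds
  \<open>g\<close>, so the deficit never closes, although the sums agree in the end.\<close>

lemma partial_sums_le:
  fixes h g E E' :: "nat \<Rightarrow> int"
  assumes r: "r < d" "s \<ge> 1" "s \<le> e" and e': "e' = d + s - 1 - r"
    and h0: "\<And>j. j < e \<Longrightarrow> h j = int (min (j + 1) d)"
    and hdec: "\<And>j. e \<le> Suc j \<Longrightarrow> h (Suc j) \<le> h j"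
    and hstrict: "\<And>j. e \<le> Suc j \<Longrightarrow> d \<le> Suc j \<Longrightarrow> h (Suc j) < h j \<or> h (Suc j) = 0"
    and hpos: "\<And>j. h j \<ge> 0"
    and g0: "g 0 = 1"
    and gS: "\<And>j. g (Suc j) = g j + (if Suc j < s then 1 else 0) - (if d \<le> Suc j \<and> Suc j < d + s then 1 else 0)
        - (if Suc j = e' then 1 else 0) + (if Suc j = e' + r then 1 else 0)"
    and E: "E 0 = h 0" "\<And>j. E (Suc j) = E j + h (Suc j)"
    and E': "E' 0 = g 0" "\<And>j. E' (Suc j) = E' j + g (Suc j)"
    and M: "\<And>n. n \<ge> M \<Longrightarrow> E n = E' n" "\<And>n. n \<ge> M \<Longrightarrow> g n = 0"
  shows "E' n \<le> E n"
proof (rule ccontr)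
  have e's: "s \<le> e'" "e' + r = d + s - 1" using e' r by auto
  have glow: "g j = int (min (j + 1) d)" if "j < s" for j
    using that
  proof (induction j)
    case 0 then show ?case using g0 r by simp
  next
    case (Suc j) then show ?case using gS[of j] e's r by (auto simp: min_def)
  qed
  have gdec: "g (Suc j) \<le> g j" if "s \<le> Suc j" for j
    using gS[of j] that e's r by auto
  have gmono: "g k \<le> g j" if "j \<le> k" "s \<le> Suc j" for j k
    using that
  proof (induction rule: dec_induct)
    case (step k) then show ?case using gdec[of k] by linarith
  qed simp
  have gpos: "g j \<ge> 0" for j
  proof (cases "j < s")
    case False
    then show ?thesis using gmono[of j "max j M"] M(2)[of "max j M"] by simp
  qed (simp add: glow)
  have gup: "g j \<le> int (min (j + 1) d)" for j
  proof (cases "j < s")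
    case False
    then have "g j \<le> g (s - 1)" using r by (intro gmono) auto
    also have "g (s - 1) = int (min s d)" using glow[of "s - 1"] r by simp
    finally show ?thesis using False by auto
  qed (simp add: glow)
  assume "\<not> E' n \<le> E n"
  then obtain m where m: "E m < E' m" "\<And>k. k < m \<Longrightarrow> E' k \<le> E k"
    using exists_least_iff[of "\<lambda>n. E n < E' n"] by (auto simp: not_less)
  have hm: "h m < g m"
  proof (cases m)
    case 0 then show ?thesis using m(1) E(1) E'(1) by simp
  next
    case (Suc k) then show ?thesis using m(1) m(2)[of k] E(2)[of k] E'(2)[of k] by simp
  qed
  have em: "e \<le> m"
  proof (rule ccontr)
    assume "\<not> e \<le> m"
    then have "h m = int (min (m + 1) d)" by (intro h0) simp
    then show False using hm gup[of m] by linarith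
  qed
  have key: "h j \<le> max 0 (g j - (if j < e' then 1 else 0))" if "m \<le> j" for j
    using that
  proof (induction rule: dec_induct)
    case base then show ?case using hm by auto
  next
    case (step j)
    show ?case
    proof (cases "h (Suc j) = 0")
      case False
      have ej: "e \<le> Suc j" "s \<le> Suc j" using step.hyps em r by auto
      have dec: "h (Suc j) \<le> h j - (if d \<le> Suc j then 1 else 0)"
        using hdec[OF ej(1)] hstrict[OF ej(1)] False by auto
      moreover have "h (Suc j) > 0" using False hpos[of "Suc j"] by simp
      ultimately have "h j \<le> g j - (if j < e' then 1 else 0)" using step.IH by (auto split: if_splits)
      moreover have "g j - (if j < e' then 1 else 0) - (if d \<le> Suc j then 1 else 0) \<le>
          g (Suc j) - (if Suc j < e' then 1 else 0)"
        unfolding gS[of j] using ej(2) by (simp split: if_split)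
      ultimately show ?thesis using dec by linarith
    qed simp
  qed
  have hg: "h j \<le> g j" if "m \<le> j" for j using key[OF that] gpos[of j] by (auto split: if_splits)
  have "E n - E' n \<le> E m - E' m" if "m \<le> n" for n
    using that
  proof (induction rule: dec_induct)
    case (step k) then show ?case using hg[of "Suc k"] E(2)[of k] E'(2)[of k] by linarith
  qed simp
  from this[of "max m M"] show False using m(1) M(1)[of "max m M"] by simp
qed


section \<open>Cohen-Macaulay subschemes of codimension two in a hypersurface\<close>

text \<open>Division by 1 - t is partial summation, which preserves inequalities.\<close>

lemma delta_mono:
  assumes "\<And>n. fps_nth (fps_delta * A) n \<le> fps_nth (fps_delta * B) n"
  shows "fps_nth A n \<le> fps_nth B n"
proof (induction n)
  case 0
  have "fps_nth (fps_delta * A) 0 \<le> fps_nth (fps_delta * B) 0" by (rule assms)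
  then show ?case unfolding nth_delta_mult by simp
next
  case (Suc n)
  have "fps_nth (fps_delta * A) (Suc n) \<le> fps_nth (fps_delta * B) (Suc n)" by (rule assms)
  then have "fps_nth A (Suc n) - fps_nth A n \<le> fps_nth B (Suc n) - fps_nth B n"
    unfolding nth_delta_mult by simp
  then show ?case using Suc.IH by linarith
qed

lemma delta_power_mono:
  assumes "\<And>n. fps_nth (fps_delta ^ m * A) n \<le> fps_nth (fps_delta ^ m * B) n"
  shows "fps_nth A n \<le> fps_nth B n"
  using assms
proof (induction m arbitrary: A B n)
  case (Suc m)
  have "fps_nth (fps_delta ^ m * (fps_delta * A)) k \<le> fps_nth (fps_delta ^ m * (fps_delta * B)) k" for k
    using Suc.prems[of k] by (simp only: power_Suc mult_ac)
  then have "fps_nth (fps_delta * A) k \<le> fps_nth (fps_delta * B) k" for k by (rule Suc.IH)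
  then show ?case by (rule delta_mono)
qed simp

lemma fps_mult_nth_cong:
  assumes "\<And>j. j \<le> n \<Longrightarrow> fps_nth A j = fps_nth B j"
  shows "fps_nth (C * A) n = fps_nth (C * B) n"
  unfolding fps_mult_nth using assms by (intro sum.cong) auto

lemma interval_mult_zero: "a + b \<le> n \<Longrightarrow> fps_nth (fps_interval a * fps_interval b) n = 0"
  by (subst nth_interval_mult) (auto intro!: sum.neutral)

text \<open>The socle degree of a complete intersection of type (a, b) in two variables, with its
  one-dimensional socle.\<close>

lemma interval_mult_top:
  assumes "a \<ge> 1" "b \<ge> 1" shows "fps_nth (fps_interval a * fps_interval b) (a + b - 2) = 1"
proof -
  have "fps_nth (fps_interval a * fps_interval b) (a + b - 2) = (\<Sum>i<a. fps_nth (fps_interval b) (a + b - 2 - i))"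
    using assms by (intro nth_interval_mult) simp
  also have "\<dots> = (\<Sum>i<a. if i = a - 1 then 1 else 0)"
    using assms by (intro sum.cong) auto
  finally show ?thesis using assms by simp
qed

text \<open>The Hilbert function of a plane section of the residual of type \<open>(1, r)\<close> in type \<open>(d, s)\<close>.\<close>

definition residual_fps :: "nat \<Rightarrow> nat \<Rightarrow> nat \<Rightarrow> int fps"
  where "residual_fps d s r = fps_interval d * fps_interval s - fps_X ^ (d + s - 1 - r) * fps_interval r"

text \<open>Partial sums of \<open>residual_fps\<close>, that is, the Hilbert function after one
  linear form fewer.\<close>

definition residual_sum :: "nat \<Rightarrow> nat \<Rightarrow> nat \<Rightarrow> int fps"
  where "residual_sum d s r = fps_interval d * fps_ramp s - fps_X ^ (d + s - 1 - r) * fps_ramp r"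

lemma delta_residual_sum: "fps_delta * residual_sum d s r = residual_fps d s r"
proof -
  have "fps_delta * residual_sum d s r =
      fps_interval d * (fps_delta * fps_ramp s) - fps_X ^ (d + s - 1 - r) * (fps_delta * fps_ramp r)"
    by (simp add: residual_sum_def algebra_simps)
  then show ?thesis by (simp only: delta_ramp residual_fps_def)
qed

lemma delta_residual_fps:
  "fps_delta * residual_fps d s r = (1 - fps_X ^ d) * fps_interval s - fps_X ^ (d + s - 1 - r) * (1 - fps_X ^ r)"
proof -
  have "fps_delta * residual_fps d s r =
      (fps_delta * fps_interval d) * fps_interval s - fps_X ^ (d + s - 1 - r) * (fps_delta * fps_interval r)"
    by (simp add: residual_fps_def algebra_simps)
  then show ?thesis by (simp only: delta_interval)
qed

lemma residual_fps_Suc: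
  "fps_nth (residual_fps d s r) (Suc j) = fps_nth (residual_fps d s r) j + (if Suc j < s then 1 else 0)
    - (if d \<le> Suc j \<and> Suc j < d + s then 1 else 0)
    - (if Suc j = d + s - 1 - r then 1 else 0) + (if Suc j = d + s - 1 - r + r then 1 else 0)"
proof -
  let ?e = "d + s - 1 - r"
  have "fps_nth (residual_fps d s r) (Suc j) - fps_nth (residual_fps d s r) j =
      fps_nth ((1 - fps_X ^ d) * fps_interval s - fps_X ^ ?e * (1 - fps_X ^ r)) (Suc j)"
    unfolding delta_residual_fps[symmetric] by (simp add: nth_delta_mult)
  also have "(1 - fps_X ^ d) * fps_interval s - fps_X ^ ?e * (1 - fps_X ^ r) =
      fps_interval s - fps_X ^ d * fps_interval s - fps_X ^ ?e + fps_X ^ (?e + r)"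
    by (simp add: algebra_simps power_add)
  also have "fps_nth \<dots> (Suc j) = (if Suc j < s then 1 else 0) - (if d \<le> Suc j \<and> Suc j < d + s then 1 else 0)
    - (if Suc j = ?e then 1 else 0) + (if Suc j = ?e + r then 1 else 0)"
    by (auto simp: fps_X_power_mult_nth fps_X_power_nth)
  finally show ?thesis by simp
qed

lemma residual_fps_0: "r < d \<Longrightarrow> s \<ge> 1 \<Longrightarrow> fps_nth (residual_fps d s r) 0 = 1"
  by (simp add: residual_fps_def fps_X_power_mult_nth)

lemma residual_sum_eventually:
  assumes "r < d" "s \<ge> 1" "n \<ge> 2 * (d + s)"
  shows "fps_nth (residual_sum d s r) n = int (s * d - r)"
proof -
  have "r \<le> s * d" using assms by (metis le_trans less_imp_le mult_le_mono1 mult_1)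
  moreover have "fps_nth (fps_X ^ (d + s - 1 - r) * fps_ramp r) n = int r"
    unfolding fps_X_power_mult_nth using assms by auto
  moreover have "fps_nth (fps_interval d * fps_ramp s) n = int d * int s"
    using assms by (intro interval_ramp_eventually) simp
  ultimately show ?thesis by (simp add: residual_sum_def of_nat_diff)
qed

lemma residual_series:
  fixes H :: "int fps"
  assumes H: "fps_delta ^ (m + 3) * H0 = 1"
    and H: "H = ((1 - fps_X ^ d) * (1 - fps_X ^ s) - fps_X ^ (d + s - 1 - r) * (1 - fps_X) * (1 - fps_X ^ r)) * H0"
  shows "fps_delta ^ m * H = residual_sum d s r"
proof -
  have "fps_delta ^ 3 * (fps_delta ^ m * H) =
      ((1 - fps_X ^ d) * (1 - fps_X ^ s) - fps_X ^ (d + s - 1 - r) * (1 - fps_X) * (1 - fps_X ^ r)) * (fps_delta ^ (m + 3) * H0)"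
    unfolding assms(2) power_add by (simp only: mult_ac)
  also have "\<dots> = fps_delta * ((1 - fps_X ^ d) * fps_interval s - fps_X ^ (d + s - 1 - r) * (1 - fps_X ^ r))"
    unfolding assms(1) delta_interval[of s, symmetric] by (simp add: algebra_simps)
  also have "\<dots> = fps_delta ^ 3 * residual_sum d s r"
    unfolding delta_residual_fps[symmetric] delta_residual_sum[symmetric] by (simp add: power3_eq_cube mult_ac)
  finally show ?thesis by (simp only: delta_power_cancel)
qed

text \<open>\<open>{0}\<close> joins the family with remaining depth 2, so that the quotient by K
  has the series and the depth of a polynomial ring in two variables.\<close>

lemma generic_plane_section:
  fixes \<D> :: "(('v::finite, 'k::{alg_closed_field, field_char_0}) mpoly set \<times> nat) set"
  assumes card: "CARD('v) = m + 3" and "finite \<D>"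
    and depth: "\<And>I q. (I, q) \<in> \<D> \<Longrightarrow> homog I \<and> depth_ge I (m + 1 + q)"
  obtains us where "length us = m + 1" "set us \<subseteq> forms 1" "regular {0} us"
    "line_ideal (adjoin_list {0} us)" "depth_ge (adjoin_list {0} us) 2"
    "\<And>I q. (I, q) \<in> \<D> \<Longrightarrow> regular I us \<and> depth_ge (adjoin_list I us) q"
proof -
  let ?D = "insert ({0}, 2) \<D>"
  have "finite ?D" using assms(2) by simp
  moreover have "homog I \<and> depth_ge I (m + 1 + q)" if "(I, q) \<in> ?D" for I q
  proof (cases "(I, q) \<in> \<D>")
    case False
    then have "I = {0}" "q = 2" using that by auto
    then show ?thesis using depth_ge_zero[where 'v = 'v and 'k = 'k] card homog_zero
      by (simp add: eval_nat_numeral)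
  qed (rule depth)
  ultimately obtain us where us: "length us = m + 1" "set us \<subseteq> forms 1"
    "\<forall>(I, q)\<in>?D. regular I us \<and> depth_ge (adjoin_list I us) q"
    using generic_linear_forms[of ?D "m + 1"] by blast
  have reg: "regular {0} us" "depth_ge (adjoin_list {0} us) 2" using us(3) by auto
  have "homog (adjoin_list {0} us)" using us(2) by (intro homog_adjoin_list homog_zero) auto
  moreover have "fps_delta ^ 2 * hilbert_series (adjoin_list {0} us) = 1"
  proof -
    have "fps_delta ^ 2 * fps_delta ^ (m + 1) = fps_delta ^ (m + 3)"
      unfolding power_add[symmetric] by (rule arg_cong[where f = "power fps_delta"]) simp
    then show ?thesis
      using hilbert_series_adjoin_list[OF homog_zero us(2) reg(1)] hilbert_series_zero[where 'v = 'v and 'k = 'k]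
      unfolding us(1) card by (metis mult.assoc)
  qed
  ultimately have "line_ideal (adjoin_list {0} us)" by (simp add: line_ideal_def)
  moreover have "\<And>I q. (I, q) \<in> \<D> \<Longrightarrow> regular I us \<and> depth_ge (adjoin_list I us) q" using us(3) by auto
  ultimately show thesis using that[OF us(1,2) reg(1) _ reg(2)] by blast
qed

section \<open>Hypersurfaces and complete intersections under the section\<close>

lemma regular_zero_single:
  fixes f :: "('v::finite, 'k::field) mpoly"
  assumes f: "pos_form f" "f \<noteq> 0" and us: "set us \<subseteq> forms 1" "regular (adjoin {0} f) us"
  shows "nzd (adjoin_list {0} us) f" "adjoin_list (adjoin {0} f) us = adjoin (adjoin_list {0} us) f"
proof -
  have pos: "pos_form u" if "u \<in> set us" for u using us(1) that pos_form_linear by blast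
  have "regular {0} (f # us)" using us(2) nzd_zero[OF f(2)] by simp
  then have "regular {0} (us @ [f])" using regular_rotate[OF homog_zero f(1) pos] by blast
  then show "nzd (adjoin_list {0} us) f" by (simp add: regular_append)
qed (rule adjoin_list_commute[OF ideal_zero])

text \<open>\<open>us\<close> is regular after \<open>f\<close> and \<open>g\<close>; rotating these
  two behind \<open>us\<close> makes them regular on the quotient by \<open>us\<close>.\<close>

lemma regular_zero_pair:
  fixes f g :: "('v::finite, 'k::field) mpoly"
  assumes f: "pos_form f" "f \<noteq> 0" and g: "pos_form g" "nzd (adjoin {0} f) g"
    and us: "set us \<subseteq> forms 1" "regular (adjoin (adjoin {0} f) g) us"
  shows "nzd (adjoin_list {0} us) f" "nzd (adjoin (adjoin_list {0} us) f) g"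
    "adjoin_list (adjoin (adjoin {0} f) g) us = adjoin (adjoin (adjoin_list {0} us) f) g"
proof -
  have pos: "pos_form u" if "u \<in> set us" for u using us(1) that pos_form_linear by blast
  have hF: "homog (adjoin {0} f)" by (rule homog_adjoin_pos[OF homog_zero f(1)])
  have "regular (adjoin {0} f) (g # us)" using us(2) g(2) by simp
  then have "regular (adjoin {0} f) (us @ [g])" using regular_rotate[OF hF g(1) pos] by blast
  then have r: "regular (adjoin {0} f) us" "nzd (adjoin_list (adjoin {0} f) us) g"
    by (simp_all add: regular_append)
  note single = regular_zero_single[OF f us(1) r(1)]
  show "nzd (adjoin_list {0} us) f" by (rule single(1))
  show "nzd (adjoin (adjoin_list {0} us) f) g" using r(2) single(2) by simp
  show "adjoin_list (adjoin (adjoin {0} f) g) us = adjoin (adjoin (adjoin_list {0} us) f) g"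
    using adjoin_list_commute[OF homog_ideal[OF hF], of g us] single(2) by simp
qed

lemma depth_ge_single:
  fixes f :: "('v::finite, 'k::field_char_0) mpoly"
  assumes "CARD('v) = Suc n" "pos_form f" "f \<noteq> 0"
  shows "depth_ge (adjoin {0} f) n"
  using depth_ge_adjoin[OF homog_zero _ assms(2) nzd_zero[OF assms(3)]] depth_ge_zero[where 'v = 'v and 'k = 'k] assms(1)
  by simp

lemma depth_ge_pair:
  fixes f g :: "('v::finite, 'k::field_char_0) mpoly"
  assumes "CARD('v) = Suc (Suc n)" "pos_form f" "f \<noteq> 0" "pos_form g" "nzd (adjoin {0} f) g"
  shows "depth_ge (adjoin (adjoin {0} f) g) n"
  using depth_ge_adjoin[OF homog_adjoin_pos[OF homog_zero assms(2)] depth_ge_single[OF assms(1-3)] assms(4,5)] .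

lemma pos_formI: "f \<in> forms d \<Longrightarrow> d \<ge> 1 \<Longrightarrow> pos_form f"
  unfolding pos_form_def by (metis One_nat_def Suc_le_D)

text \<open>Uniqueness of the Hilbert polynomial matches the dimension in the Cohen-Macaulay
  condition with \<open>m\<close>. A form in the sequence without positive degree would be a nonzero
  constant and make the last quotient zero.\<close>

lemma ACM_depth:
  fixes Y :: "('v::finite, 'k::field) mpoly set"
  assumes "ACM Y" "has_dim_degree Y m a"
  shows "homog Y" "saturated_ideal Y" "depth_ge Y (m + 1)"
proof -
  show hY: "homog Y" and "saturated_ideal Y"
    using assms(1) by (simp_all add: ACM_def proj_subscheme_def homogeneous_ideal_iff)
  obtain n fs where fs: "has_dim Y n" "length fs = n + 1" "set fs \<subseteq> (\<Union>l. forms l)" "regular_sequence Y fs"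
    using assms(1) by (auto simp: ACM_def)
  obtain P Q where "is_hilbert_poly Y P" "degree P = n" "is_hilbert_poly Y Q" "degree Q = m"
    using fs(1) assms(2) by (auto simp: has_dim_def has_dim_degree_def)
  then have "n = m" using hilbert_poly_unique by blast
  have "pos_form f" if f: "f \<in> set fs" for f
  proof (rule ccontr)
    assume np: "\<not> pos_form f"
    obtain l where "f \<in> forms l" using f fs(3) by auto
    then have f0: "f \<in> forms 0" using np pos_formI[of f l] by (cases l) auto
    have "f \<noteq> 0" using np forms_0[of "Suc 0"] by (auto simp: pos_form_def)
    have "f = mpoly_scale (coeff_at f 0) 1" using forms_zero_const[OF f0] by (simp add: mpoly_scale_def)
    moreover from this have "coeff_at f 0 \<noteq> 0" using \<open>f \<noteq> 0\<close> by auto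
    moreover have "f \<in> ideal_gen (Y \<union> set fs)" using f ideal_gen_superset by blast
    ultimately have "1 \<in> ideal_gen (Y \<union> set fs)" using scale_mem_ideal_iff[OF ideal_ideal_gen] by metis
    then have "ideal_gen (Y \<union> set fs) = UNIV" by (rule ideal_eq_UNIV[OF ideal_ideal_gen])
    then show False using fs(4) by (simp add: regular_sequence_def)
  qed
  then show "depth_ge Y (m + 1)"
    using regular_sequence_imp_regular[OF homog_ideal[OF hY] fs(4)] fs(2) \<open>n = m\<close> by (auto simp: depth_ge_def)
qed

text \<open>No hypersurface occurs here: these facts on Y suffice for the direction from linkage to
  the Hilbert function.\<close>

locale acm_codim_two =
  fixes Y :: "('v::finite, 'k::{alg_closed_field, field_char_0}) mpoly set" and d s r m :: nat
  assumes homogY: "homog Y" and depthY: "depth_ge Y (m + 1)" and card: "CARD('v) = m + 3"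
    and degY: "\<forall>\<^sub>F n in sequentially. fps_nth (fps_delta ^ m * hilbert_series Y) n = int (s * d - r)"
    and r: "r < d" and s: "s \<ge> 1"
begin

lemma idealY: "is_ideal Y" by (rule homog_ideal[OF homogY])

lemma series0: "fps_delta ^ (m + 3) * hilbert_series ({0} :: ('v, 'k) mpoly set) = 1"
  using hilbert_series_zero[where 'v = 'v and 'k = 'k] card by simp

lemma alpha_pos: "s * d - r > 0"
proof -
  have "d \<le> s * d" using s by simp
  then have "r < s * d" using r by (rule less_le_trans[rotated])
  then show ?thesis by simp
qed

lemma degY_obtain:
  obtains M where "\<And>n. n \<ge> M \<Longrightarrow> fps_nth (fps_delta ^ m * hilbert_series Y) n = int (s * d - r)"
  using degY by (auto simp: eventually_sequentially)

lemma Y_proper: "1 \<notin> Y"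
proof
  assume "1 \<in> Y"
  then have "Y = UNIV" by (rule ideal_eq_UNIV[OF idealY])
  then have "hilbert_series Y = 0" using hilbert_fun_eq_0[OF idealY] by (intro fps_ext) simp
  moreover obtain M where "fps_nth (fps_delta ^ m * hilbert_series Y) M = int (s * d - r)"
    using degY_obtain by blast
  ultimately have "int (s * d - r) = 0" by (simp only: mult_zero_right fps_zero_nth)
  then show False using alpha_pos by (simp only: of_nat_eq_0_iff less_irrefl)
qed

end

locale acm_in_hypersurface = acm_codim_two Y d s r m
  for Y :: "('v::finite, 'k::{alg_closed_field, field_char_0}) mpoly set" and d s r m +
  fixes F :: "('v, 'k) mpoly"
  assumes F: "F \<in> forms d" "F \<noteq> 0" "F \<in> Y" and prime: "prime_ideal (adjoin {0} F)"
begin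

lemma posF: "pos_form F" using pos_formI[OF F(1)] r by simp

lemma homogF: "homog (adjoin {0} F)" by (rule homog_adjoin[OF homog_zero F(1)])

lemma seriesF: "fps_delta ^ (m + 1) * hilbert_series (adjoin {0} F) = fps_ramp d"
proof -
  have "fps_delta ^ 2 * (fps_delta ^ (m + 1) * hilbert_series (adjoin {0} F)) =
      (1 - fps_X ^ d) * (fps_delta ^ (m + 3) * hilbert_series ({0} :: ('v, 'k) mpoly set))"
    using hilbert_series_adjoin_nzd[OF homog_zero F(1) nzd_zero[OF F(2)]]
    by (simp add: mult_ac power_add power2_eq_square power3_eq_cube)
  also have "\<dots> = fps_delta ^ 2 * fps_ramp d"
    unfolding series0 by (simp add: power2_eq_square mult.assoc delta_ramp delta_interval)
  finally show ?thesis by (simp only: delta_power_cancel)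
qed

lemma second_generator:
  obtains e G where "G \<in> forms e" "G \<in> Y" "G \<notin> adjoin {0} F" "e \<ge> 1"
    "\<And>j. j < e \<Longrightarrow> forms j \<inter> Y = forms j \<inter> adjoin {0} F"
proof -
  have sub: "adjoin {0} F \<subseteq> Y" using F(3) ideal_0[OF idealY] by (intro adjoin_minimal idealY) auto
  have "\<exists>j. \<not> forms j \<inter> Y \<subseteq> adjoin {0} F"
  proof (rule ccontr)
    assume "\<nexists>j. \<not> forms j \<inter> Y \<subseteq> adjoin {0} F"
    then have "Y \<subseteq> adjoin {0} F" by (intro homog_subset[OF homogY homog_ideal[OF homogF]]) auto
    then have "Y = adjoin {0} F" using sub by blast
    then have eq: "fps_delta * (fps_delta ^ m * hilbert_series Y) = fps_ramp d" using seriesF by (simp add: mult.assoc)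
    obtain M where M: "\<And>n. n \<ge> M \<Longrightarrow> fps_nth (fps_delta ^ m * hilbert_series Y) n = int (s * d - r)"
      using degY_obtain by blast
    \<comment> \<open>The difference of an eventually constant function vanishes, whereas a
      hypersurface leaves the eventual value d: its dimension is too large.\<close>
    have "fps_nth (fps_ramp d) (Suc M) = 0" unfolding eq[symmetric] using M[of M] M[of "Suc M"] by (simp add: nth_delta_mult)
    then show False using r by simp
  qed
  then obtain e where e: "\<not> forms e \<inter> Y \<subseteq> adjoin {0} F" "\<And>j. j < e \<Longrightarrow> forms j \<inter> Y \<subseteq> adjoin {0} F"
    using exists_least_iff[of "\<lambda>j. \<not> forms j \<inter> Y \<subseteq> adjoin {0} F"] by blast
  then obtain G where G: "G \<in> forms e" "G \<in> Y" "G \<notin> adjoin {0} F" by blast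
  have "e \<noteq> 0"
  proof
    assume "e = 0"
    then have "G = mpoly_scale (coeff_at G 0) 1" using forms_zero_const G(1) by (simp add: mpoly_scale_def)
    moreover have "G \<noteq> 0" using G(3) ideal_0[OF homog_ideal[OF homogF]] by auto
    moreover from calculation have "coeff_at G 0 \<noteq> 0" by auto
    ultimately have "1 \<in> Y" using scale_mem_ideal_iff[OF idealY] G(2) by metis
    then show False using Y_proper by simp
  qed
  then have "1 \<le> e" by simp
  moreover have "forms j \<inter> Y = forms j \<inter> adjoin {0} F" if "j < e" for j
    using e(2)[OF that] sub by blast
  ultimately show thesis by (rule that[OF G])
qed

lemma nzd_second: "G \<notin> adjoin {0} F \<Longrightarrow> nzd (adjoin {0} F) G"
  using prime by (auto simp: prime_ideal_def nzd_def)

lemma comparison: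
  obtains e G where "G \<in> forms e" "G \<in> Y" "G \<notin> adjoin {0} F" "s \<le> e"
    "\<And>j. j < e \<Longrightarrow> fps_nth (fps_delta ^ (m + 1) * hilbert_series Y) j = int (min (j + 1) d)"
    "\<And>n. fps_nth (residual_sum d s r) n \<le> fps_nth (fps_delta ^ m * hilbert_series Y) n"
proof -
  obtain e G where G: "G \<in> forms e" "G \<in> Y" "G \<notin> adjoin {0} F" "e \<ge> 1"
    and low: "\<And>j. j < e \<Longrightarrow> forms j \<inter> Y = forms j \<inter> adjoin {0} F"
    using second_generator by blast
  have posG: "pos_form G" by (rule pos_formI[OF G(1,4)])
  have G0: "G \<noteq> 0" using G(3) ideal_0[OF homog_ideal[OF homogF]] by auto
  note nzdG = nzd_second[OF G(3)]
  let ?Z = "adjoin (adjoin {0} F) G"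
  \<comment> \<open>(G) keeps depth 1, because \<open>hilbert_weak_decrease\<close> takes one more
    generic form on it; for Y and Z no remaining depth is asked.\<close>
  let ?D = "{(Y, 0), (?Z, 0), (adjoin {0} G, 1)}"
  have hom: "homog ?Z" "homog (adjoin {0} G)"
    by (rule homog_adjoin[OF homogF G(1)], rule homog_adjoin[OF homog_zero G(1)])
  have dep: "depth_ge ?Z (m + 1)" "depth_ge (adjoin {0} G) (m + 2)"
    using depth_ge_pair[OF _ posF F(2) posG nzdG, of "m + 1"] depth_ge_single[OF _ posG G0, of "m + 2"] card by simp_all
  obtain us where us: "length us = m + 1" "set us \<subseteq> forms 1" "regular {0} us"
    and line: "line_ideal (adjoin_list {0} us)" and gen: "\<And>I q. (I, q) \<in> ?D \<Longrightarrow> regular I us \<and> depth_ge (adjoin_list I us) q"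
    by (rule generic_plane_section[OF card, of ?D]) (use hom dep homogY depthY in auto)
  define K where "K = adjoin_list {0} us"
  interpret line_ideal K using line by (simp add: K_def)
  define J where "J = adjoin_list Y us"
  have hJ: "homog J" unfolding J_def using us(2) by (intro homog_adjoin_list homogY) auto
  have KJ: "K \<subseteq> J" unfolding K_def J_def using ideal_0[OF idealY] by (intro adjoin_list_mono) auto
  have YJ: "Y \<subseteq> J" unfolding J_def by (rule adjoin_list_superset)
  have regY: "regular Y us" and regZ: "regular ?Z us" and regG: "regular (adjoin {0} G) us"
    and depG: "depth_ge (adjoin_list (adjoin {0} G) us) 1" using gen by auto
  have nK: "nzd K F" "nzd (adjoin K F) G"
    unfolding K_def by (rule regular_zero_pair[OF posF F(2) posG nzdG us(2) regZ])+
  have nG: "nzd K G" "depth_ge (adjoin K G) 1"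
    using regular_zero_single[OF posG G0 us(2) regG] depG by (simp_all add: K_def)
  have seriesJ: "hilbert_series J = fps_delta ^ (m + 1) * hilbert_series Y"
    unfolding J_def using hilbert_series_adjoin_list[OF homogY us(2) regY] us(1) by simp
  define E where "E = fps_delta ^ m * hilbert_series Y"
  have JE: "hilbert_series J = fps_delta * E" by (simp add: seriesJ E_def mult.assoc)
  obtain M where M: "\<And>n. n \<ge> M \<Longrightarrow> fps_nth E n = int (s * d - r)" using degY_obtain unfolding E_def by blast
  let ?ZK = "adjoin (adjoin K F) G"
  have seriesZ: "hilbert_series ?ZK = fps_interval d * fps_interval e" by (rule hilbert_series_pair_K[OF F(1) nK(1) G(1) nK(2)])
  have ZJ: "?ZK \<subseteq> J"
    using KJ YJ F(3) G(2) by (intro adjoin_minimal homog_ideal[OF hJ]) auto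
  \<comment> \<open>The section of (F, G) dominates that of Y; comparing the eventual partial sums
    gives \<alpha> \<le> d e.\<close>
  have "fps_nth E n \<le> fps_nth (fps_interval d * fps_ramp e) n" for n
  proof (rule delta_mono)
    fix n
    have "fps_delta * (fps_interval d * fps_ramp e) = fps_interval d * (fps_delta * fps_ramp e)" by (simp only: mult_ac)
    also have "\<dots> = hilbert_series ?ZK" by (simp only: delta_ramp seriesZ)
    finally show "fps_nth (fps_delta * E) n \<le> fps_nth (fps_delta * (fps_interval d * fps_ramp e)) n"
      using hilbert_fun_mono[OF ZJ, of n] by (simp add: JE[symmetric])
  qed
  from this[of "M + d + e"] have "int (s * d - r) \<le> int d * int e"
    using M[of "M + d + e"] by (simp add: interval_ramp_eventually)
  then have "s * d - r \<le> d * e" by (metis of_nat_le_iff of_nat_mult)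
  have se: "s \<le> e"
  proof (rule ccontr)
    assume "\<not> s \<le> e"
    then have "Suc e \<le> s" by simp
    then have "Suc e * d \<le> s * d" by (rule mult_le_mono1)
    then show False using \<open>s * d - r \<le> d * e\<close> r by (simp add: mult.commute)
  qed
  \<comment> \<open>A coefficient of the cut series depends only on degrees up to its own, and there
    the ideals of Y and F agree.\<close>
  have h0: "fps_nth (hilbert_series J) j = int (min (j + 1) d)" if "j < e" for j
  proof -
    have "fps_nth (hilbert_series Y) i = fps_nth (hilbert_series (adjoin {0} F)) i" if "i \<le> j" for i
      using hilbert_fun_cong[OF low, of i] that \<open>j < e\<close> by simp
    then have "fps_nth (hilbert_series J) j = fps_nth (fps_delta ^ (m + 1) * hilbert_series (adjoin {0} F)) j"
      unfolding seriesJ by (rule fps_mult_nth_cong)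
    then show ?thesis unfolding seriesF by simp
  qed
  have "forms (d + e) \<subseteq> ?ZK"
  proof -
    have "fps_nth (hilbert_series ?ZK) (d + e) = 0" unfolding seriesZ by (rule interval_mult_zero) simp
    then have "hilbert_fun ?ZK (d + e) = 0" by simp
    then show ?thesis using hilbert_fun_eq_0[of ?ZK] ideal_adjoin[OF ideal_adjoin[OF idealK]] by blast
  qed
  note strict = hilbert_strict_decrease_pair[OF hJ KJ F(1) subsetD[OF YJ F(3)] G(1) subsetD[OF YJ G(2)] this]
  note weak = hilbert_weak_decrease[OF hJ KJ G(1) subsetD[OF YJ G(2)] nG]
  have le: "fps_nth (residual_sum d s r) n \<le> fps_nth E n" for n
  proof (rule partial_sums_le[where h = "fps_nth (hilbert_series J)" and g = "fps_nth (residual_fps d s r)" and e = e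
        and d = d and s = s and r = r and e' = "d + s - 1 - r" and M = "M + 2 * (d + s) + 1"])
    show "fps_nth (hilbert_series J) (Suc j) \<le> fps_nth (hilbert_series J) j" if "e \<le> Suc j" for j
      using weak[OF that] by simp
    show "fps_nth (hilbert_series J) (Suc j) < fps_nth (hilbert_series J) j \<or> fps_nth (hilbert_series J) (Suc j) = 0"
      if "e \<le> Suc j" "d \<le> Suc j" for j using strict[OF that(2,1)] by auto
    show "fps_nth E 0 = fps_nth (hilbert_series J) 0" "\<And>j. fps_nth E (Suc j) = fps_nth E j + fps_nth (hilbert_series J) (Suc j)"
      by (simp_all only: JE nth_delta_mult) simp_all
    show "fps_nth (residual_sum d s r) 0 = fps_nth (residual_fps d s r) 0"
      "\<And>j. fps_nth (residual_sum d s r) (Suc j) = fps_nth (residual_sum d s r) j + fps_nth (residual_fps d s r) (Suc j)"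
      by (simp_all only: delta_residual_sum[symmetric] nth_delta_mult) simp_all
    show "fps_nth E n = fps_nth (residual_sum d s r) n" if "M + 2 * (d + s) + 1 \<le> n" for n
      using M[of n] residual_sum_eventually[OF r s, of n] that by simp
    show "fps_nth (residual_fps d s r) n = 0" if "M + 2 * (d + s) + 1 \<le> n" for n
      using residual_sum_eventually[OF r s, of n] residual_sum_eventually[OF r s, of "n - 1"] that
      by (simp add: delta_residual_sum[symmetric] nth_delta_mult)
  qed (use r s se h0 residual_fps_0 residual_fps_Suc in simp_all)
  show thesis using that[OF G(1-3) se] h0 le unfolding seriesJ E_def by blast
qed

end


section \<open>The case of equality\<close>

text \<open>Takes a generator of the section back to the uncut ideal: multiples of the linear forms
  are subtracted one at a time without changing the degree.\<close>

lemma adjoin_list_lift: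
  assumes "homog I" "set us \<subseteq> forms 1" "p \<in> adjoin_list I us" "p \<in> forms j"
  shows "\<exists>q\<in>forms j. q \<in> I \<and> p - q \<in> adjoin_list {0} us"
  using assms
proof (induction us arbitrary: I)
  case Nil
  then show ?case by (intro bexI[of _ p]) auto
next
  case (Cons u us)
  have u: "u \<in> forms 1" using Cons.prems(2) by simp
  obtain q where q: "q \<in> forms j" "q \<in> adjoin I u" "p - q \<in> adjoin_list {0} us"
    using Cons.IH[OF homog_adjoin[OF Cons.prems(1) u]] Cons.prems by auto
  obtain w where w: "w \<in> forms (j - 1)" "q - w * u \<in> I" "j < 1 \<longrightarrow> w = 0"
    using adjoin_form[OF Cons.prems(1) u q(2,1)] by blast
  have wu: "w * u \<in> forms j"
  proof (cases "j < 1")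
    case False then show ?thesis using forms_mult[OF w(1) u] by simp
  qed (use w(3) in simp)
  let ?K = "adjoin_list (adjoin {0} u) us"
  have iK: "is_ideal ?K" by (intro ideal_adjoin_list ideal_adjoin ideal_zero)
  have "p - q \<in> ?K" using q(3) adjoin_list_mono[OF adjoin_superset[of "{0}" u], of us] by blast
  moreover have "w * u \<in> ?K"
    using ideal_mult[OF iK] adjoin_mem[OF ideal_zero, of u] adjoin_list_superset[of "adjoin {0} u" us] by blast
  ultimately have "(p - q) + w * u \<in> ?K" by (rule ideal_add[OF iK])
  then have "p - (q - w * u) \<in> adjoin_list {0} (u # us)" by (simp add: algebra_simps)
  then show ?case using w(2) forms_diff[OF q(1) wu] by blast
qed

text \<open>A linear nonzerodivisor exists, and a high power of it is a combination of the powers of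
  variables that send \<open>f\<close> into \<open>I\<close>.\<close>

lemma saturated_if_socle_free:
  fixes I :: "('v::finite, 'k::field_char_0) mpoly set"
  assumes I: "is_ideal I" and sf: "socle_free I"
  shows "saturated_ideal I"
  unfolding saturated_ideal_def
proof (intro allI impI)
  fix f assume "\<forall>i. \<exists>N. mpoly_var i ^ N * f \<in> I"
  then obtain N where N: "\<And>i. mpoly_var i ^ N i * f \<in> I" by metis
  have iC: "is_ideal (colon I f)" by (rule ideal_colon[OF I])
  obtain u where u: "u \<in> forms 1" "nzd I u" using linear_nzd_exists[of "{I}"] I sf by auto
  \<comment> \<open>A monomial of degree larger than the sum of all \<open>N i\<close> has an
    exponent of at least \<open>N i\<close> somewhere.\<close>
  define n where "n = (\<Sum>i\<in>UNIV. N i)"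
  have "u ^ Suc n \<in> colon I f"
  proof (rule mpoly_mem_if_monomials[OF iC])
    fix m assume m: "m \<in> Poly_Mapping.keys (u ^ Suc n)"
    have "u ^ Suc n \<in> forms (Suc n * 1)" by (rule forms_power[OF u(1)])
    then have "monom_deg m = Suc n" using m by (auto simp: forms_def)
    moreover have "monom_deg m \<le> n" if "\<And>i. Poly_Mapping.lookup m i \<le> N i"
      unfolding monom_deg_def n_def using that by (intro sum_mono)
    ultimately obtain i where i: "N i \<le> Poly_Mapping.lookup m i" by (metis Suc_n_not_le_n nle_le)
    have "m = (m - Poly_Mapping.single i (N i)) + Poly_Mapping.single i (N i)"
      using i by (intro poly_mapping_eqI) (auto simp: lookup_add lookup_minus lookup_single when_def)
    then have eq: "(Poly_Mapping.single m 1 :: ('v, 'k) mpoly) =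
        Poly_Mapping.single (m - Poly_Mapping.single i (N i)) 1 * mpoly_var i ^ N i"
      by (simp add: var_power mult_single)
    have "mpoly_var i ^ N i \<in> colon I f" using N[of i] by (simp add: colon_def mult.commute)
    then show "Poly_Mapping.single m 1 \<in> colon I f" unfolding eq by (rule ideal_mult[OF iC])
  qed
  then have uf: "u ^ Suc n * f \<in> I" by (simp add: colon_def mult.commute)
  have "f \<in> I" if "u ^ k * f \<in> I" for k
    using that
  proof (induction k)
    case (Suc k)
    then have "u * (u ^ k * f) \<in> I" by (simp add: mult.assoc)
    then show ?case using u(2) Suc.IH by (auto simp: nzd_def)
  qed simp
  then show "f \<in> I" using uf by blast
qed

lemma saturated_colon: "saturated_ideal I \<Longrightarrow> saturated_ideal (colon I f)"
  by (simp add: saturated_ideal_def colon_def mult.left_commute)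

lemma nth_hilbert_adjoin:
  assumes "homog I" "f \<in> forms a"
  shows "int (hilbert_fun (adjoin I f) n) = int (hilbert_fun I n) - (if n < a then 0 else int (hilbert_fun (colon I f) (n - a)))"
proof -
  have "fps_nth (hilbert_series (adjoin I f)) n = fps_nth (hilbert_series I - fps_X ^ a * hilbert_series (colon I f)) n"
    by (simp only: hilbert_series_adjoin[OF assms])
  then show ?thesis by (simp add: fps_X_power_mult_nth)
qed

lemma combination_in_ideal:
  fixes I :: "('v::finite, 'k::field) mpoly set"
  assumes I: "homog I" and t: "hilbert_fun I t = 1" and ab: "a \<in> forms t" "b \<in> forms t" "b \<notin> I"
  shows "\<exists>c. a - mpoly_scale c b \<in> I"
proof -
  note iI = homog_ideal[OF I]
  have "1 \<notin> colon I b" using ab(3) by (simp add: colon_def)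
  then have "\<not> forms 0 \<subseteq> colon I b" using forms_one by blast
  then have "hilbert_fun (colon I b) 0 \<noteq> 0" using hilbert_fun_eq_0[OF ideal_colon[OF iI]] by blast
  then have "hilbert_fun (adjoin I b) t = 0" using nth_hilbert_adjoin[OF I ab(2), of t] t by simp
  then have "a \<in> adjoin I b" using hilbert_fun_eq_0[OF ideal_adjoin[OF iI]] ab(1) by blast
  then obtain w where w: "w \<in> forms (t - t)" "a - w * b \<in> I" using adjoin_form[OF I ab(2) _ ab(1)] by blast
  then have "w * b = mpoly_scale (coeff_at w 0) b" using forms_zero_const[of w] by (simp add: mpoly_scale_def)
  then show ?thesis using w(2) by metis
qed

context line_ideal
begin

lemma linear_pair_exists:
  assumes "depth_ge K 2"
  shows "\<exists>x\<in>forms 1. \<exists>y\<in>forms 1. nzd K x \<and> nzd (adjoin K x) y"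
proof -
  obtain x where x: "x \<in> forms 1" "nzd K x" "depth_ge (adjoin K x) 1"
    using generic_linear_form[of "{(K, 1)}"] homogK assms by (auto simp: numeral_2_eq_2)
  obtain y where "y \<in> forms 1" "nzd (adjoin K x) y"
    using generic_linear_form[of "{(adjoin K x, 0)}"] homog_adjoin[OF homogK x(1)] x(3) by auto
  then show ?thesis using x by blast
qed

text \<open>Modulo (K, f, g) the ideal \<open>J\<close> has dimension one exactly in the
  \<open>r\<close> degrees that end with the socle degree d + s - 2, and \<open>D\<close> sits in
  the lowest of them. Before the socle degree some linear form moves a nonzero class to a nonzero
  class, so the multiples of \<open>D\<close> fill all these degrees.\<close>

lemma cyclic_residual:
  assumes depth: "depth_ge K 2"
    and f: "f \<in> forms d" "nzd K f" and g: "g \<in> forms s" "nzd (adjoin K f) g"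
    and r: "r < d" "s \<ge> 1" and J: "is_ideal J" "homog J" "adjoin (adjoin K f) g \<subseteq> J"
    and seriesJ: "hilbert_series J = residual_fps d s r"
    and D: "D \<in> forms (d + s - 1 - r)" "D \<in> J" "D \<notin> adjoin (adjoin K f) g"
  shows "adjoin (adjoin (adjoin K f) g) D = J"
proof -
  let ?Z = "adjoin (adjoin K f) g" and ?e = "d + s - 1 - r"
  have hZ: "homog ?Z" by (rule homog_adjoin[OF homog_adjoin[OF homogK f(1)] g(1)])
  note iZ = homog_ideal[OF hZ]
  obtain x y where xy: "x \<in> forms 1" "y \<in> forms 1" "nzd K x" "nzd (adjoin K x) y"
    using linear_pair_exists[OF depth] by blast
  have chain: "\<exists>t\<in>forms i. t * D \<notin> ?Z" if "i < r" for i
    using that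
  proof (induction i)
    case 0 then show ?case using D(3) by (intro bexI[of _ 1]) auto
  next
    case (Suc i)
    then obtain t where t: "t \<in> forms i" "t * D \<notin> ?Z" by auto
    have "t * D \<in> forms (i + ?e)" by (rule forms_mult[OF t(1) D(1)])
    moreover have "i + ?e + 2 < d + s" using Suc.prems r by simp
    ultimately have "x * (t * D) \<notin> ?Z \<or> y * (t * D) \<notin> ?Z"
      using socle_pair[OF f g xy(1,3,2,4)] t(2) by blast
    then have "(x * t) * D \<notin> ?Z \<or> (y * t) * D \<notin> ?Z" by (simp add: mult.assoc)
    moreover have "x * t \<in> forms (Suc i)" "y * t \<in> forms (Suc i)"
      using forms_mult[OF xy(1) t(1)] forms_mult[OF xy(2) t(1)] by simp_all
    ultimately show ?case by blast
  qed
  have hD: "homog (adjoin ?Z D)" by (rule homog_adjoin[OF hZ D(1)])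
  have sub: "adjoin ?Z D \<subseteq> J" by (intro adjoin_minimal J D(2))
  have "hilbert_series (adjoin ?Z D) = hilbert_series J"
  proof (rule fps_ext)
    fix n
    have "hilbert_fun J n \<le> hilbert_fun (adjoin ?Z D) n" by (rule hilbert_fun_mono[OF sub])
    moreover have "int (hilbert_fun (adjoin ?Z D) n) \<le> int (hilbert_fun J n)"
    proof -
      have "hilbert_fun (colon ?Z D) i \<ge> 1" if i: "i < r" for i
      proof -
        obtain t where "t \<in> forms i" "t * D \<notin> ?Z" using chain[OF i] by blast
        then have "t \<in> forms i" "t \<notin> colon ?Z D" by (simp_all add: colon_def mult.commute)
        then have "hilbert_fun (colon ?Z D) i \<noteq> 0" using hilbert_fun_eq_0[OF ideal_colon[OF iZ]] by blast
        then show ?thesis by simp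
      qed
      then have "(if n < ?e then 0 else if n - ?e < r then 1 else 0) \<le>
          (if n < ?e then 0 else int (hilbert_fun (colon ?Z D) (n - ?e)))" by auto
      moreover have "int (hilbert_fun J n) = int (hilbert_fun ?Z n) - (if n < ?e then 0 else if n - ?e < r then 1 else 0)"
      proof -
        have "int (hilbert_fun J n) = fps_nth (residual_fps d s r) n" using seriesJ by (metis nth_hilbert_series)
        moreover have "int (hilbert_fun ?Z n) = fps_nth (fps_interval d * fps_interval s) n"
          using hilbert_series_pair_K[OF f g] by (metis nth_hilbert_series)
        ultimately show ?thesis by (simp add: residual_fps_def fps_X_power_mult_nth)
      qed
      ultimately show ?thesis using nth_hilbert_adjoin[OF hZ D(1), of n] by simp
    qed
    ultimately show "fps_nth (hilbert_series (adjoin ?Z D)) n = fps_nth (hilbert_series J) n" by simp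
  qed
  then show ?thesis by (rule hilbert_series_eq_imp[OF sub homog_ideal[OF hD] J(2)])
qed

text \<open>
  The part of \<open>A / (K, f, g)\<close> killed by a linear form \<open>l\<close> is uniserial over the powers of a second
  linear form, so the Hilbert function of a submodule is the indicator function of an interval.
\<close>

lemma hilbert_series_killed:
  assumes f: "f \<in> forms d" "nzd K f" and g: "g \<in> forms s" "nzd (adjoin K f) g" and ds: "d \<ge> 1" "s \<ge> 1"
    and l: "l \<in> forms 1" "nzd K l" "depth_ge (adjoin K l) 1"
    and J: "homog J" "adjoin (adjoin K f) g \<subseteq> J" "\<And>p. p \<in> J \<Longrightarrow> l * p \<in> adjoin (adjoin K f) g"
  shows "\<exists>k < d + s. hilbert_series J = fps_interval d * fps_interval s - fps_X ^ (d + s - 1 - k) * fps_interval k"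
proof -
  let ?Z = "adjoin (adjoin K f) g" and ?t = "d + s - 2"
  have hZ: "homog ?Z" by (rule homog_adjoin[OF homog_adjoin[OF homogK f(1)] g(1)])
  note iZ = homog_ideal[OF hZ] and iJ = homog_ideal[OF J(1)]
  have seriesZ: "hilbert_series ?Z = fps_interval d * fps_interval s" by (rule hilbert_series_pair_K[OF f g])
  obtain y where y: "y \<in> forms 1" "nzd (adjoin K l) y"
    using generic_linear_form[of "{(adjoin K l, 0)}"] homog_adjoin[OF homogK l(1)] l(3) by auto
  have top: "hilbert_fun ?Z ?t = 1"
    using interval_mult_top[OF ds] seriesZ by (metis nth_hilbert_series of_nat_1 of_nat_eq_iff)
  have above: "forms n \<subseteq> ?Z" if "n > ?t" for n
  proof -
    have "fps_nth (hilbert_series ?Z) n \<le> 0"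
    proof (cases "d + s \<le> n")
      case True then show ?thesis unfolding seriesZ by (simp add: interval_mult_zero)
    next
      case False
      then have "n = d + s - 1" using that by simp
      then have "fps_nth (hilbert_series ?Z) n = (\<Sum>i<d. fps_nth (fps_interval s) (n - i))"
        unfolding seriesZ using ds by (intro nth_interval_mult) simp
      also have "\<dots> = 0" using \<open>n = d + s - 1\<close> by (intro sum.neutral) auto
      finally show ?thesis by simp
    qed
    then show ?thesis using hilbert_fun_eq_0[OF iZ] by simp
  qed
  \<comment> \<open>By \<open>socle_pair\<close> a nonzero class before the top degree that
    \<open>l\<close> kills is not killed by \<open>y\<close>; this removes the powers of
    \<open>y\<close> one at a time.\<close>
  have inj: "z \<in> ?Z" if "z \<in> forms i" "i + k \<le> ?t" "l * z \<in> ?Z" "y ^ k * z \<in> ?Z" for z i k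
    using that(2,4)
  proof (induction k)
    case (Suc k)
    have "y ^ k * z \<in> forms (k + i)" using forms_mult[OF forms_power[OF y(1), of k] that(1)] by simp
    moreover have "k + i + 2 < d + s" using Suc.prems(1) by simp
    moreover have "l * (y ^ k * z) \<in> ?Z" using ideal_mult[OF iZ that(3), of "y ^ k"] by (simp add: mult.left_commute)
    moreover have "y * (y ^ k * z) \<in> ?Z" using Suc.prems(2) by (simp add: mult.assoc)
    ultimately have "y ^ k * z \<in> ?Z" using socle_pair[OF f g l(1,2) y] by blast
    then show ?case using Suc.IH Suc.prems(1) by simp
  qed simp
  show ?thesis
  proof (cases "J \<subseteq> ?Z")
    case True
    then have "J = ?Z" using J(2) by blast
    then show ?thesis using ds seriesZ by (intro exI[of _ 0]) (simp add: fps_interval_def fps_zero_def[symmetric])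
  next
    case False
    then have "\<exists>j. \<not> forms j \<inter> J \<subseteq> ?Z" using homog_subset[OF J(1) iZ] by blast
    then obtain j where j: "\<not> forms j \<inter> J \<subseteq> ?Z" "\<And>i. i < j \<Longrightarrow> forms i \<inter> J \<subseteq> ?Z"
      using exists_least_iff[of "\<lambda>j. \<not> forms j \<inter> J \<subseteq> ?Z"] by blast
    then obtain D where D: "D \<in> forms j" "D \<in> J" "D \<notin> ?Z" by blast
    have jt: "j \<le> ?t" using above[of j] D(1,3) by (meson not_le subsetD)
    have ynD: "y ^ i * D \<notin> ?Z" if "j + i \<le> ?t" for i
      using inj[OF D(1) that J(3)[OF D(2)]] D(3) by blast
    \<comment> \<open>In the one-dimensional top degree the images of \<open>p\<close> and
      \<open>D\<close> under powers of \<open>y\<close> are proportional. The corresponding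
      difference in degree \<open>n\<close> is killed by \<open>l\<close> and by a power of
      \<open>y\<close>, so it vanishes modulo (K, f, g).\<close>
    have "J \<subseteq> adjoin ?Z D"
    proof (rule homog_subset[OF J(1) ideal_adjoin[OF iZ]])
      fix n p assume p: "p \<in> J" "p \<in> forms n"
      show "p \<in> adjoin ?Z D"
      proof (cases "p \<in> ?Z")
        case True then show ?thesis using adjoin_superset by blast
      next
        case False
        then have n: "j \<le> n" "n \<le> ?t" using j(2)[of n] above[of n] p by (meson IntI not_le subsetD)+
        have eqs: "(?t - n) * 1 + n = ?t" "(?t - j) * 1 + j = ?t" using n jt by simp_all
        have "y ^ (?t - n) * p \<in> forms ?t" "y ^ (?t - j) * D \<in> forms ?t"
          using forms_mult[OF forms_power[OF y(1)] p(2), of "?t - n"] forms_mult[OF forms_power[OF y(1)] D(1), of "?t - j"]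
          unfolding eqs by simp_all
        moreover have "y ^ (?t - j) * D \<notin> ?Z" using ynD[of "?t - j"] jt by simp
        ultimately obtain c where c: "y ^ (?t - n) * p - mpoly_scale c (y ^ (?t - j) * D) \<in> ?Z"
          using combination_in_ideal[OF hZ top] by blast
        define z where "z = p - mpoly_scale c (y ^ (n - j) * D)"
        have "y ^ (n - j) * D \<in> forms n" using forms_mult[OF forms_power[OF y(1)] D(1), of "n - j"] n by simp
        then have "z \<in> forms n" unfolding z_def using p(2) by (intro forms_diff forms_scale)
        moreover have "n + (?t - n) \<le> ?t" using n by simp
        moreover have "z \<in> J"
          unfolding z_def using p(1) D(2) by (intro ideal_diff[OF iJ] mpoly.subspace_scale[OF ideal_subspace[OF iJ]] ideal_mult[OF iJ])
        then have "l * z \<in> ?Z" by (rule J(3))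
        moreover have "y ^ (?t - n) * z \<in> ?Z"
        proof -
          have "?t - j = (?t - n) + (n - j)" using n by simp
          then have "y ^ (?t - n) * z = y ^ (?t - n) * p - mpoly_scale c (y ^ (?t - j) * D)"
            by (simp add: z_def mpoly_scale_def power_add algebra_simps)
          then show ?thesis using c by simp
        qed
        ultimately have "z \<in> ?Z" by (rule inj)
        then have "p - (Poly_Mapping.single 0 c * y ^ (n - j)) * D \<in> ?Z" by (simp add: z_def mpoly_scale_def mult.assoc)
        then show ?thesis by (rule adjoinI)
      qed
    qed
    moreover have "adjoin ?Z D \<subseteq> J" by (intro adjoin_minimal J(2) iJ D(2))
    ultimately have eqJ: "J = adjoin ?Z D" by blast
    \<comment> \<open>The colon ideal contains K and \<open>l\<close>, which bounds its Hilbert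
      function by 1; the powers of \<open>y\<close> show that this value is attained until
      \<open>D\<close> has been moved to the top degree.\<close>
    have seriesC: "hilbert_series (colon ?Z D) = fps_interval (?t + 1 - j)"
    proof (rule fps_ext)
      fix i
      have iC: "is_ideal (colon ?Z D)" by (rule ideal_colon[OF iZ])
      show "fps_nth (hilbert_series (colon ?Z D)) i = fps_nth (fps_interval (?t + 1 - j)) i"
      proof (cases "i < ?t + 1 - j")
        case True
        then have "y ^ i \<notin> colon ?Z D" using ynD[of i] by (simp add: colon_def mult.commute)
        moreover have "y ^ i \<in> forms i" using forms_power[OF y(1), of i] by simp
        ultimately have "hilbert_fun (colon ?Z D) i \<noteq> 0" using hilbert_fun_eq_0[OF iC] by blast
        moreover have "hilbert_fun (colon ?Z D) i \<le> hilbert_fun (adjoin K l) i"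
        proof (rule hilbert_fun_mono[OF adjoin_minimal[OF _ _ iC]])
          show "K \<subseteq> colon ?Z D"
            using colon_superset[OF iZ, of D] adjoin_superset[of K f] adjoin_superset[of "adjoin K f" g] by blast
          show "l \<in> colon ?Z D" using J(3)[OF D(2)] by (simp add: colon_def mult.commute)
        qed
        moreover have "hilbert_fun (adjoin K l) i = 1"
          using arg_cong[OF hilbert_series_adjoin_ramp[OF l(1,2)], of "\<lambda>h. fps_nth h i"] by simp
        ultimately show ?thesis using True by simp
      next
        case False
        have "forms i \<subseteq> colon ?Z D"
        proof
          fix p :: "('v, 'k) mpoly" assume "p \<in> forms i"
          then have "p * D \<in> forms (i + j)" using D(1) by (rule forms_mult)
          moreover have "i + j > ?t" using False by simp
          ultimately show "p \<in> colon ?Z D" using above by (auto simp: colon_def mult.commute)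
        qed
        then show ?thesis using hilbert_fun_eq_0[OF iC] False by simp
      qed
    qed
    have "hilbert_series J = fps_interval d * fps_interval s - fps_X ^ j * fps_interval (?t + 1 - j)"
      unfolding eqJ hilbert_series_adjoin[OF hZ D(1)] seriesZ seriesC ..
    moreover have "?t + 1 - j < d + s" "d + s - 1 - (?t + 1 - j) = j" using jt ds by auto
    ultimately show ?thesis by (intro exI[of _ "?t + 1 - j"]) simp
  qed
qed

end

section \<open>From linkage to the Hilbert function\<close>

context acm_codim_two
begin

text \<open>A linear form in the ideal of V kills Y / Z, and this persists in the section, where
  \<open>hilbert_series_killed\<close> leaves one parameter \<open>k\<close>. The degree of Y forces
  k = r.\<close>

lemma linked_degenerate_imp_series:
  assumes Z: "complete_intersection d s Z" and V: "degenerate V" and link: "linked Z V Y"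
  shows "fps_delta ^ m * hilbert_series Y = residual_sum d s r"
proof -
  obtain f g where fg: "f \<in> forms d" "g \<in> forms s" "f \<noteq> 0" "nzd (adjoin {0} f) g" "Z = adjoin (adjoin {0} f) g"
    using complete_intersection_regular[OF Z] by blast
  obtain l where l: "l \<in> V" "l \<noteq> 0" "l \<in> forms 1" using V by (auto simp: degenerate_def)
  have ZY: "Z \<subseteq> Y" and lY: "\<And>p. p \<in> Y \<Longrightarrow> l * p \<in> Z" using link l(1) by (auto simp: linked_def)
  have pos: "pos_form f" "pos_form g" "pos_form l"
    using pos_formI[OF fg(1)] pos_formI[OF fg(2) s] pos_form_linear[OF l(3)] r by simp_all
  have hZ: "homog Z" unfolding fg(5) by (rule homog_pair[OF fg(1,2)])
  have hl: "homog (adjoin {0} l)" by (rule homog_adjoin[OF homog_zero l(3)])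
  have dep: "depth_ge Z (m + 1)" "depth_ge (adjoin {0} l) (m + 2)"
    using depth_ge_pair[OF _ pos(1) fg(3) pos(2) fg(4), of "m + 1"] depth_ge_single[OF _ pos(3) l(2), of "m + 2"] card fg(5)
    by simp_all
  let ?D = "{(Y, 0), (Z, 0), (adjoin {0} l, 1)}"
  obtain us where us: "length us = m + 1" "set us \<subseteq> forms 1" "regular {0} us"
    and line: "line_ideal (adjoin_list {0} us)" and gen: "\<And>I q. (I, q) \<in> ?D \<Longrightarrow> regular I us \<and> depth_ge (adjoin_list I us) q"
    by (rule generic_plane_section[OF card, of ?D]) (use hZ hl dep homogY depthY in auto)
  define K where "K = adjoin_list {0} us"
  interpret line_ideal K using line by (simp add: K_def)
  define J where "J = adjoin_list Y us"
  have hJ: "homog J" unfolding J_def using us(2) by (intro homog_adjoin_list homogY) auto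
  have regY: "regular Y us" and regZ: "regular (adjoin (adjoin {0} f) g) us" and regl: "regular (adjoin {0} l) us"
    and depl: "depth_ge (adjoin_list (adjoin {0} l) us) 1" using gen fg(5) by auto
  note pair = regular_zero_pair[OF pos(1) fg(3) pos(2) fg(4) us(2) regZ, folded K_def]
  note single = regular_zero_single[OF pos(3) l(2) us(2) regl, folded K_def]
  let ?Z = "adjoin (adjoin K f) g"
  have iZ: "is_ideal ?Z" by (intro ideal_adjoin idealK)
  have Z_eq: "adjoin_list Z us = ?Z" using pair(3) fg(5) by simp
  have ZJ: "?Z \<subseteq> J" unfolding J_def Z_eq[symmetric] by (rule adjoin_list_mono[OF ZY])
  have "J \<subseteq> colon ?Z l"
    unfolding J_def
  proof (rule adjoin_list_minimal[OF _ _ ideal_colon[OF iZ]])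
    show "Y \<subseteq> colon ?Z l" using lY adjoin_list_superset[of Z us] Z_eq by (auto simp: colon_def)
    show "set us \<subseteq> colon ?Z l"
      using adjoin_list_mem[OF homog_ideal[OF hZ], of us] Z_eq colon_superset[OF iZ, of l] by blast
  qed
  then have lJ: "l * p \<in> ?Z" if "p \<in> J" for p using that by (auto simp: colon_def)
  have d1: "d \<ge> 1" using r by simp
  obtain k where k: "k < d + s"
    "hilbert_series J = fps_interval d * fps_interval s - fps_X ^ (d + s - 1 - k) * fps_interval k"
    using hilbert_series_killed[OF fg(1) pair(1) fg(2) pair(2) d1 s l(3) single(1) _ hJ ZJ lJ] depl single(2) by auto
  have "fps_delta * (fps_delta ^ m * hilbert_series Y) = hilbert_series J"
    unfolding J_def using hilbert_series_adjoin_list[OF homogY us(2) regY] us(1) by (simp add: mult.assoc)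
  also have "\<dots> = fps_delta * residual_sum d s k"
    unfolding delta_residual_sum residual_fps_def k(2) ..
  finally have E: "fps_delta ^ m * hilbert_series Y = residual_sum d s k" by (simp only: delta_cancel)
  obtain M where M: "\<And>n. n \<ge> M \<Longrightarrow> fps_nth (residual_sum d s k) n = int (s * d - r)"
    using degY_obtain unfolding E by blast
  define n where "n = M + 2 * (d + s)"
  have "fps_nth (residual_sum d s k) n = int d * int s - int k"
  proof -
    have "fps_nth (fps_X ^ (d + s - 1 - k) * fps_ramp k) n = int k"
      unfolding fps_X_power_mult_nth n_def using k(1) by auto
    moreover have "fps_nth (fps_interval d * fps_ramp s) n = int d * int s"
      unfolding n_def by (intro interval_ramp_eventually) simp
    ultimately show ?thesis by (simp add: residual_sum_def)
  qed
  moreover have "fps_nth (residual_sum d s k) n = int (s * d - r)" by (rule M) (simp add: n_def)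
  moreover have "int (s * d - r) = int s * int d - int r" using alpha_pos by (simp add: of_nat_diff)
  ultimately have "k = r" by (simp add: mult.commute)
  then show ?thesis using E by simp
qed

end

section \<open>From the Hilbert function to linkage\<close>

context acm_in_hypersurface
begin

lemma second_generator_of_degree_s:
  assumes "fps_delta ^ m * hilbert_series Y = residual_sum d s r"
  obtains G where "G \<in> forms s" "G \<in> Y" "G \<notin> adjoin {0} F"
proof -
  obtain e G where G: "G \<in> forms e" "G \<in> Y" "G \<notin> adjoin {0} F" "s \<le> e"
    and low: "\<And>j. j < e \<Longrightarrow> fps_nth (fps_delta ^ (m + 1) * hilbert_series Y) j = int (min (j + 1) d)"
    and "\<And>n. fps_nth (residual_sum d s r) n \<le> fps_nth (fps_delta ^ m * hilbert_series Y) n"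
    by (rule comparison) (rule that)
  have h: "fps_delta ^ (m + 1) * hilbert_series Y = residual_fps d s r"
    using assms delta_residual_sum[of d s r] by (simp add: mult.assoc)
  have "e = s"
  proof (rule ccontr)
    assume "e \<noteq> s"
    then have "s < e" using G(4) by simp
    \<comment> \<open>With \<open>e\<close> larger than \<open>s\<close> the section of Y would
      still follow \<open>min (j + 1) d\<close> at degree \<open>s\<close>, but the residual
      function increases by less in this step.\<close>
    then have "fps_nth (residual_fps d s r) s = int (min (s + 1) d)"
      "fps_nth (residual_fps d s r) (s - 1) = int (min s d)"
      using low[of s] low[of "s - 1"] s unfolding h by simp_all
    moreover obtain t where "s = Suc t" using s by (cases s) auto
    ultimately show False
      using residual_fps_Suc[of d s r t] r by (auto simp: min_def split: if_splits)
  qed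
  then show thesis using that G by blast
qed

lemma series_imp_linked:
  assumes sat: "saturated_ideal Y" and eq: "fps_delta ^ m * hilbert_series Y = residual_sum d s r"
  shows "\<exists>Z V. complete_intersection d s Z \<and> proj_subscheme V \<and> codim_two_degree V r \<and>
         degenerate V \<and> linked Z V Y"
proof -
  obtain G where G: "G \<in> forms s" "G \<in> Y" "G \<notin> adjoin {0} F" using second_generator_of_degree_s[OF eq] by blast
  have G0: "G \<noteq> 0" using G(3) ideal_0[OF homog_ideal[OF homogF]] by auto
  have posG: "pos_form G" by (rule pos_formI[OF G(1) s])
  note nzdG = nzd_second[OF G(3)]
  define Z where "Z = adjoin (adjoin {0} F) G"
  have ciZ: "complete_intersection d s Z"
    unfolding Z_def by (rule complete_intersectionI[OF F(1) G(1) F(2) G0 prime G(3)])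
  have hZ: "homog Z" unfolding Z_def by (rule homog_pair[OF F(1) G(1)])
  note iZ = homog_ideal[OF hZ]
  have ZY: "Z \<subseteq> Y" unfolding Z_def using F(3) G(2) ideal_0[OF idealY] by (intro adjoin_minimal idealY) auto
  have depZ: "depth_ge Z (m + 1)"
    unfolding Z_def using depth_ge_pair[OF _ posF F(2) posG nzdG, of "m + 1"] card by simp
  have satZ: "saturated_ideal Z"
  proof -
    obtain fs where "length fs = m + 1" "\<forall>f\<in>set fs. pos_form f" "regular Z fs" using depZ by (auto simp: depth_ge_def)
    then obtain f where "pos_form f" "nzd Z f" by (cases fs) auto
    then show ?thesis using saturated_if_socle_free[OF iZ] socle_free_if_nzd[OF iZ] by blast
  qed
  have pZ: "proj_subscheme Z" and pY: "proj_subscheme Y"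
    using hZ satZ homogY sat by (simp_all add: proj_subscheme_def homogeneous_ideal_iff)
  \<comment> \<open>The conditions on homomorphisms are automatic once each of the two ideals is the
    colon of the other.\<close>
  have linkI: "linked Z V Y" if V: "proj_subscheme V" "Z \<subseteq> V" "colon_ideal Z V = Y" "colon_ideal Z Y = V" for V
  proof -
    have iV: "is_ideal V" using V(1) by (simp add: proj_subscheme_def homogeneous_ideal_iff homog_ideal)
    have "x * y \<in> Z" if "x \<in> V" "y \<in> Y" for x y using V(4) that by (auto simp: colon_ideal_def)
    then show ?thesis
      unfolding linked_def
      using pZ pY V(1,2) ZY ideal_hom_colon_bij[OF iV F(2) nzdG Z_def V(2)]
        ideal_hom_colon_bij[OF idealY F(2) nzdG Z_def ZY] V(3,4) by simp
  qed
  let ?H0 = "hilbert_series ({0} :: ('v, 'k) mpoly set)" and ?e = "d + s - 1 - r"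
  have seriesZ: "hilbert_series Z = (1 - fps_X ^ d) * (1 - fps_X ^ s) * ?H0"
    unfolding Z_def by (rule hilbert_series_pair[OF F(1) G(1) F(2) nzdG])
  have seriesY: "hilbert_series Y = hilbert_series Z - fps_X ^ ?e * ((1 - fps_X) * (1 - fps_X ^ r) * ?H0)"
  proof -
    have "fps_delta ^ m * hilbert_series Y = fps_delta ^ m * (((1 - fps_X ^ d) * (1 - fps_X ^ s) -
        fps_X ^ ?e * (1 - fps_X) * (1 - fps_X ^ r)) * ?H0)"
      unfolding eq by (rule residual_series[OF series0 refl, symmetric])
    then have "hilbert_series Y = ((1 - fps_X ^ d) * (1 - fps_X ^ s) -
        fps_X ^ ?e * (1 - fps_X) * (1 - fps_X ^ r)) * ?H0" by (simp only: delta_power_cancel)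
    then show ?thesis by (simp add: seriesZ algebra_simps)
  qed
  show ?thesis
  proof (cases "r = 0")
    case True
    \<comment> \<open>Here Y is the complete intersection itself and its residual is empty.\<close>
    have "hilbert_series Z = hilbert_series Y" using seriesY True by simp
    then have "Z = Y" by (rule hilbert_series_eq_imp[OF ZY iZ homogY])
    moreover have "proj_subscheme (UNIV :: ('v, 'k) mpoly set)"
      by (simp add: proj_subscheme_def homogeneous_ideal_iff homog_UNIV saturated_ideal_def)
    moreover have "colon_ideal Z UNIV = Z"
      using ideal_mult_right[OF iZ] by (auto simp: colon_ideal_def) (metis mult.right_neutral)
    moreover have "colon_ideal Z Z = UNIV" using ideal_mult[OF iZ] by (auto simp: colon_ideal_def)
    ultimately have "linked Z UNIV Y" by (intro linkI) auto
    moreover have "degenerate (UNIV :: ('v, 'k) mpoly set)"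
    proof -
      have "Poly_Mapping.keys (mpoly_var i :: ('v, 'k) mpoly) \<noteq> {}" for i by (simp add: mpoly_var_def)
      then have "(mpoly_var i :: ('v, 'k) mpoly) \<noteq> 0" for i by (metis keys_zero)
      then show ?thesis using forms_var by (auto simp: degenerate_def)
    qed
    moreover have "codim_two_degree (UNIV :: ('v, 'k) mpoly set) r" using True by (simp add: codim_two_degree_def)
    ultimately show ?thesis using ciZ \<open>proj_subscheme UNIV\<close> by blast
  next
    case False
    let ?D = "{(Y, 0), (Z, 0)}"
    obtain us where us: "length us = m + 1" "set us \<subseteq> forms 1" "regular {0} us"
      and line: "line_ideal (adjoin_list {0} us)" and depK: "depth_ge (adjoin_list {0} us) 2"
      and gen: "\<And>I q. (I, q) \<in> ?D \<Longrightarrow> regular I us \<and> depth_ge (adjoin_list I us) q"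
      by (rule generic_plane_section[OF card, of ?D]) (use hZ depZ homogY depthY in auto)
    define K where "K = adjoin_list {0} us"
    interpret line_ideal K using line by (simp add: K_def)
    define J where "J = adjoin_list Y us"
    have hJ: "homog J" unfolding J_def using us(2) by (intro homog_adjoin_list homogY) auto
    have regY: "regular Y us" and regZ: "regular (adjoin (adjoin {0} F) G) us" using gen Z_def by auto
    note pair = regular_zero_pair[OF posF F(2) posG nzdG us(2) regZ, folded K_def Z_def]
    let ?Z = "adjoin (adjoin K F) G"
    have hZK: "homog ?Z" by (rule homog_adjoin[OF homog_adjoin[OF homogK F(1)] G(1)])
    note iZK = homog_ideal[OF hZK]
    have ZJ: "?Z \<subseteq> J" unfolding J_def pair(3)[symmetric] by (rule adjoin_list_mono[OF ZY])
    have seriesJ: "hilbert_series J = residual_fps d s r"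
      unfolding J_def delta_residual_sum[symmetric] eq[symmetric]
      using hilbert_series_adjoin_list[OF homogY us(2) regY] us(1) by (simp add: mult.assoc)
    \<comment> \<open>\<open>?e\<close> is the lowest degree in which the sections of the ideals of
      Y and Z differ.\<close>
    have "int (hilbert_fun J ?e) \<noteq> int (hilbert_fun ?Z ?e)"
    proof -
      have "int (hilbert_fun J ?e) = fps_nth (residual_fps d s r) ?e" using seriesJ by (metis nth_hilbert_series)
      moreover have "int (hilbert_fun ?Z ?e) = fps_nth (fps_interval d * fps_interval s) ?e"
        using hilbert_series_pair_K[OF F(1) pair(1) G(1) pair(2)] by (metis nth_hilbert_series)
      ultimately show ?thesis using False by (simp add: residual_fps_def fps_X_power_mult_nth)
    qed
    then have "forms ?e \<inter> ?Z \<noteq> forms ?e \<inter> J" using hilbert_fun_cong by metis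
    then obtain D0 where D0: "D0 \<in> forms ?e" "D0 \<in> J" "D0 \<notin> ?Z" using ZJ by blast
    obtain D where D: "D \<in> forms ?e" "D \<in> Y" "D0 - D \<in> K"
      using adjoin_list_lift[OF homogY us(2) D0(2)[unfolded J_def] D0(1)] unfolding K_def by blast
    have KZ: "K \<subseteq> ?Z" using adjoin_superset[of K F] adjoin_superset[of "adjoin K F" G] by blast
    have DZ: "D \<notin> ?Z" using D0(3) D(3) KZ ideal_cong[OF iZK] by blast
    have DJ: "D \<in> J" using D(2) adjoin_list_superset unfolding J_def by blast
    have "adjoin ?Z D = J"
      by (rule cyclic_residual[OF depK[folded K_def] F(1) pair(1) G(1) pair(2) r s homog_ideal[OF hJ] hJ ZJ seriesJ D(1) DJ DZ])
    \<comment> \<open>The sections of Z + (D) and Y agree, and regularity of \<open>us\<close> on Y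
      carries this back to the ideals.\<close>
    then have "adjoin_list (adjoin Z D) us = adjoin_list Y us"
      using adjoin_list_commute[OF iZ, of D us] pair(3) by (simp add: J_def)
    moreover have "adjoin Z D \<subseteq> Y" by (intro adjoin_minimal ZY D(2) idealY)
    moreover have "pos_form u" if "u \<in> set us" for u using us(2) that pos_form_linear by blast
    ultimately have Y_eq: "Y = adjoin Z D"
      using nakayama_adjoin_list[OF homogY homog_adjoin[OF hZ D(1)], of us] regY by metis
    have DnZ: "D \<notin> Z" using DZ adjoin_list_superset[of Z us] pair(3) by blast
    define V where "V = colon Z D"
    have hV: "homog V" unfolding V_def by (rule homog_colon[OF hZ D(1)])
    note iV = homog_ideal[OF hV]
    have ZV: "Z \<subseteq> V" unfolding V_def by (rule colon_superset[OF iZ])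
    have pV: "proj_subscheme V"
      using hV saturated_colon[OF satZ] by (simp add: proj_subscheme_def homogeneous_ideal_iff V_def)
    \<comment> \<open>The exact sequence for Z + (D) isolates the series of Z : D, which turns out
      to be that of a complete intersection of type (1, r).\<close>
    have "fps_X ^ ?e * hilbert_series V = fps_X ^ ?e * ((1 - fps_X) * (1 - fps_X ^ r) * ?H0)"
      using hilbert_series_adjoin[OF hZ D(1)] seriesY unfolding V_def Y_eq[symmetric] by simp
    then have seriesV: "hilbert_series V = (1 - fps_X) * (1 - fps_X ^ r) * ?H0" by simp
    \<comment> \<open>The series of a hyperplane. In degree 1 the series of V is below that of the
      full ring, which yields \<open>l\<close>; in degree \<open>r\<close> it is below that of the
      hyperplane, which yields \<open>q\<close>.\<close>
    define A1 where "A1 = fps_delta * ?H0"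
    have H00: "fps_nth ?H0 0 = 1"
    proof -
      have "fps_nth (fps_delta ^ (m + 3) * ?H0) 0 = 1" unfolding series0 by simp
      then show ?thesis by (simp add: fps_mult_nth_0 fps_power_zeroth del: power_Suc nth_hilbert_series)
    qed
    have A10: "fps_nth A1 0 = 1" and A11: "fps_nth A1 1 = fps_nth ?H0 1 - 1"
      unfolding A1_def nth_delta_mult using H00 by simp_all
    have V_A1: "hilbert_series V = A1 - fps_X ^ r * A1" unfolding seriesV A1_def by (simp add: algebra_simps)
    have "fps_nth (hilbert_series V) 1 < fps_nth ?H0 1"
      unfolding V_A1 using A10 A11 False by (cases "r = 1") (simp_all add: fps_X_power_mult_nth)
    then have "forms 1 \<inter> {0} \<noteq> forms 1 \<inter> V" using hilbert_fun_cong[of 1 "{0}" V] by auto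
    then obtain l where l: "l \<in> forms 1" "l \<in> V" "l \<noteq> 0" using ideal_0[OF iV] by auto
    have posl: "homog (adjoin {0} l)" by (rule homog_adjoin[OF homog_zero l(1)])
    have lV: "adjoin {0} l \<subseteq> V" using l(2) ideal_0[OF iV] by (intro adjoin_minimal iV) auto
    have seriesl: "hilbert_series (adjoin {0} l) = A1"
      using hilbert_series_adjoin_nzd[OF homog_zero l(1) nzd_zero[OF l(3)]] by (simp add: A1_def)
    have "fps_nth (hilbert_series V) r \<noteq> fps_nth (hilbert_series (adjoin {0} l)) r"
      unfolding V_A1 seriesl using A10 by (simp add: fps_X_power_mult_nth)
    then have "forms r \<inter> adjoin {0} l \<noteq> forms r \<inter> V" using hilbert_fun_cong[of r "adjoin {0} l" V] by auto
    then obtain q where q: "q \<in> forms r" "q \<in> V" "q \<notin> adjoin {0} l" using lV by blast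
    have nq: "nzd (adjoin {0} l) q" using q(3) by (intro linear_form_nzd[OF l(1,3)]) (simp add: adjoin_zero)
    have "adjoin (adjoin {0} l) q = V"
    proof (rule hilbert_series_eq_imp)
      show "adjoin (adjoin {0} l) q \<subseteq> V" by (intro adjoin_minimal lV q(2) iV)
      show "hilbert_series (adjoin (adjoin {0} l) q) = hilbert_series V"
        using hilbert_series_pair[OF l(1) q(1) l(3) nq] seriesV by simp
    qed (use hV ideal_adjoin ideal_zero in blast)+
    then have V_eq: "V = adjoin (adjoin {0} l) q" by simp
    have FG: "F \<in> V" "G \<in> V" using ZV pair_mem[where f = F and g = G] by (auto simp: Z_def)
    obtain D' where D': "D' \<in> forms ?e" "colon_ideal Z V = adjoin Z D'"
      using colon_ideal_degenerate_pair[OF F(1) G(1) F(2) nzdG l(1) q(1) l(3) nq FG[unfolded V_eq] r s]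
      unfolding V_eq Z_def by blast
    \<comment> \<open>\<open>D\<close> and the generator \<open>D'\<close> have the same degree, so
      modulo Z they differ by a nonzero scalar; hence Z : V is Z + (D), which is Y.\<close>
    have "D \<in> colon_ideal Z V" by (simp add: colon_ideal_def V_def colon_def)
    then obtain w where w: "w \<in> forms (?e - ?e)" "D - w * D' \<in> Z"
      using adjoin_form[OF hZ D'(1) _ D(1)] D'(2) by blast
    define c where "c = coeff_at w 0"
    have wD: "w * D' = mpoly_scale c D'" using forms_zero_const[of w] w(1) by (simp add: mpoly_scale_def c_def)
    have "c \<noteq> 0" using w(2) DnZ by (auto simp: wD)
    have iY': "is_ideal (adjoin Z D)" by (rule ideal_adjoin[OF iZ])
    have "D - (D - w * D') \<in> adjoin Z D"
      using ideal_diff[OF iY' adjoin_mem[OF iZ] subsetD[OF adjoin_superset w(2)]] .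
    then have "D' \<in> adjoin Z D" using scale_mem_ideal_iff[OF iY' \<open>c \<noteq> 0\<close>] by (simp add: wD)
    then have "adjoin Z D' \<subseteq> adjoin Z D" by (intro adjoin_minimal adjoin_superset iY')
    moreover have "adjoin Z D \<subseteq> adjoin Z D'"
      using \<open>D \<in> colon_ideal Z V\<close> D'(2) by (intro adjoin_minimal adjoin_superset ideal_adjoin[OF iZ]) simp
    ultimately have ZV_eq: "colon_ideal Z V = Y" using D'(2) Y_eq by blast
    have "colon_ideal Z Y = V" unfolding Y_eq V_def by (rule colon_ideal_adjoin[OF iZ])
    then have "linked Z V Y" by (rule linkI[OF pV ZV ZV_eq])
    moreover have "degenerate V" using l by (auto simp: degenerate_def)
    moreover have "codim_two_degree V r"
    proof -
      have "fps_delta ^ 3 * (fps_delta ^ m * hilbert_series V) = (1 - fps_X) * (1 - fps_X ^ r) * (fps_delta ^ (m + 3) * ?H0)"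
        unfolding seriesV power_add by (simp only: mult_ac)
      also have "\<dots> = fps_delta ^ 3 * fps_ramp r"
        unfolding series0 delta_interval[symmetric] delta_ramp[symmetric] by (simp add: power3_eq_cube mult.assoc)
      finally have "fps_delta ^ m * hilbert_series V = fps_ramp r" by (simp only: delta_power_cancel)
      then have "has_dim_degree V m r"
        using False by (intro has_dim_degreeI) (auto simp: eventually_sequentially intro!: exI[of _ r])
      then show ?thesis using False card by (auto simp: codim_two_degree_def)
    qed
    ultimately show ?thesis using ciZ pV by blast
  qed
qed

end

theorem proposition2:
  fixes d s r \<alpha> :: nat
    and \<Delta> X Y :: "('v::finite, 'k::{alg_closed_field, field_char_0}) mpoly set"
  assumes "d \<ge> 1" and "s \<ge> 1" and "r < d" and "\<alpha> = s * d - r"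
    and "\<exists>Z L. complete_intersection d s Z \<and> complete_intersection 1 r L \<and> linked Z L \<Delta>"
    and "ACM Y" and "codim_two_degree Y \<alpha>"
    and "irreducible_hypersurface d X" and "X \<subseteq> Y"
  shows "(\<forall>i. hilbert_fun Y i \<ge> hilbert_fun \<Delta> i) \<and>
    ((\<forall>i. hilbert_fun Y i = hilbert_fun \<Delta> i) \<longleftrightarrow>
      (\<exists>Z V. complete_intersection d s Z \<and> proj_subscheme V \<and> codim_two_degree V r \<and>
         degenerate V \<and> linked Z V Y))"
proof -
  \<comment> \<open>\<alpha> is positive, so Y is not the empty scheme that
    \<open>codim_two_degree\<close> assigns to degree 0.\<close>
  have "d \<le> s * d" using assms(2) by simp
  then have "r < s * d" using assms(3) by linarith
  then have "\<alpha> \<noteq> 0" using assms(4) by simp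
  then obtain m where m: "m + 3 = CARD('v)" "has_dim_degree Y m \<alpha>"
    using assms(7) by (auto simp: codim_two_degree_def)
  note acm = ACM_depth[OF assms(6) m(2)]
  obtain F where F: "F \<in> forms d" "F \<noteq> 0" "X = adjoin {0} F" "prime_ideal X"
    using assms(8) by (auto simp: irreducible_hypersurface_def ideal_gen_single)
  have FY: "F \<in> Y" using assms(9) F(3) adjoin_mem[OF ideal_zero, of F] by blast
  interpret acm_in_hypersurface Y d s r m F
    using acm m assms(2,3,4) has_dim_degree_imp[OF m(2)] F FY by unfold_locales auto
  obtain Z L where ZL: "complete_intersection d s Z" "complete_intersection 1 r L" "linked Z L \<Delta>"
    using assms(5) by blast
  have series\<Delta>: "fps_delta ^ m * hilbert_series \<Delta> = residual_sum d s r"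
    by (rule residual_series[OF series0 residual_hilbert_series[OF ZL assms(3,2)]])
  have cmp: "fps_nth (residual_sum d s r) n \<le> fps_nth (fps_delta ^ m * hilbert_series Y) n" for n
    by (rule comparison)
  \<comment> \<open>The comparison was made after \<open>m\<close> cuts; summing \<open>m\<close>
    times undoes them.\<close>
  have "fps_nth (hilbert_series \<Delta>) i \<le> fps_nth (hilbert_series Y) i" for i
    by (rule delta_power_mono[of m]) (unfold series\<Delta>, rule cmp)
  then have le: "\<forall>i. hilbert_fun Y i \<ge> hilbert_fun \<Delta> i" by simp
  have "(\<forall>i. hilbert_fun Y i = hilbert_fun \<Delta> i) \<longleftrightarrow> hilbert_series Y = hilbert_series \<Delta>"
    by (simp add: fps_eq_iff)
  also have "\<dots> \<longleftrightarrow> fps_delta ^ m * hilbert_series Y = residual_sum d s r"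
    unfolding series\<Delta>[symmetric] by (simp only: delta_power_cancel)
  also have "\<dots> \<longleftrightarrow> (\<exists>Z V. complete_intersection d s Z \<and> proj_subscheme V \<and> codim_two_degree V r \<and>
         degenerate V \<and> linked Z V Y)"
    using series_imp_linked[OF acm(2)] linked_degenerate_imp_series by blast
  finally show ?thesis using le by blast
qed

end
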